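(* Let $d\ge 1$, let $h\ge 1$ be an integer and let $0=m_0<m_1<\dots<m_h=M$ be real numbers. For $j=0,\dots,h$ let $p_{m_j}:\mathbb{R}^d\setminus\{0\}\to\mathbb{C}$ be a $C^\infty$ function which is positively homogeneous of degree $m_j$, and set $p(\xi)=\sum_{j=0}^h p_{m_j}(\xi)$. Assume that there is a constant $C>0$ such that $|p(\xi)|\ge C\langle\xi\rangle^M$ for all $\xi\in\mathbb{R}^d$, $\xi\neq 0$. Let $F:\mathbb{C}\to\mathbb{C}$ be a measurable function for which there is an exponent $\sigma>1$ such that for every compact set $K\subset\mathbb{C}$ there is a constant $C_K>0$ with $|F(z)|\le C_K|z|^{\sigma}$ for all $z\in K$. Let $u$ be a distribution solution of $p(D)u=F(u)$ on $\mathbb{R}^d$ satisfying $\langle x\rangle^{\epsilon_0}u\in L^\infty(\mathbb{R}^d)$ for some $\epsilon_0>0$. Then $\langle x\rangle^{d}u\in L^\infty(\mathbb{R}^d)$.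
   Context: Notation: $\langle x\rangle=(1+|x|^2)^{1/2}$ for $x\in\mathbb{R}^d$. The Fourier transform is $\widehat f(\xi)=\mathcal{F}f(\xi)=\int_{\mathbb{R}^d}e^{-ix\xi}f(x)\,dx$. A function $f$ on $\mathbb{R}^d\setminus\{0\}$ is positively homogeneous of degree $r$ if $f(\lambda\xi)=\lambda^r f(\xi)$ for all $\lambda>0$, $\xi\ne0$. The functions $p_{m_j}$ may be non-smooth at $\xi=0$; in particular $p_0:=p_{m_0}$ (homogeneous of degree $0$) need not be constant. For a symbol $p$, $p(D)$ denotes the Fourier multiplier $p(D)f=(2\pi)^{-d}\int_{\mathbb{R}^d}e^{ix\xi}p(\xi)\widehat f(\xi)\,d\xi$, i.e. the convolution operator $p(D)f=K\ast f$ with $K=\mathcal{F}^{-1}(p)$. For $u$ with $\langle x\rangle^{\epsilon_0}u\in L^\infty(\mathbb{R}^d)$, $\epsilon_0>0$, the distribution $p(D)u$ is understood in this sense: choosing $\chi\in C_0^\infty(\mathbb{R}^d)$ with $\chi=1$ near $0$, $p(D)u=\mathcal{F}^{-1}(\chi p)\ast u+\mathcal{F}^{-1}\big((1-\chi)p\,\widehat u\big)$, where the first term is an absolutely convergent convolution integral because $\mathcal{F}^{-1}(\chi p)$ is $O(\langle x\rangle^{-d})$, and the second is defined for tempered distributions because $(1-\chi)p$ is smooth with polynomially bounded derivatives. The equation $p(D)u=F(u)$ is meant as an equality of distributions. *)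

theory Defs
  imports "HOL-Analysis.Analysis"
begin

text \<open>The Euclidean space \<open>R\<^sup>d\<close> is an arbitrary type of class
  \<^class>\<open>euclidean_space\<close>, with \<open>d = DIM('a) \<ge> 1\<close>; integrals are
  Lebesgue integrals over \<open>lebesgue\<close>.\<close>

definition japanese :: "'a::euclidean_space \<Rightarrow> real"  (\<open>\<langle>_\<rangle>\<close>)
  where "\<langle>x\<rangle> = sqrt (1 + (norm x)\<^sup>2)"

definition L_inf :: "('a::euclidean_space \<Rightarrow> complex) \<Rightarrow> bool"
  where "L_inf f \<longleftrightarrow> f \<in> borel_measurable lebesgue \<and> (\<exists>B. AE x in lebesgue. norm (f x) \<le> B)"

text \<open>\<open>C\<^sup>k\<close> on a set \<open>S\<close>, via iterated partial derivatives. It is meant for open \<open>S\<close> only,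
  since the derivatives are taken in the whole space.\<close>

primrec Ck_on :: "nat \<Rightarrow> 'a::euclidean_space set \<Rightarrow> ('a \<Rightarrow> 'b::real_normed_vector) \<Rightarrow> bool"
  where
    "Ck_on 0 S f \<longleftrightarrow> continuous_on S f"
  | "Ck_on (Suc k) S f \<longleftrightarrow> (\<forall>x\<in>S. f differentiable (at x)) \<and>
       (\<forall>b\<in>Basis. Ck_on k S (\<lambda>x. frechet_derivative f (at x) b))"

definition smooth_on :: "'a::euclidean_space set \<Rightarrow> ('a \<Rightarrow> 'b::real_normed_vector) \<Rightarrow> bool"
  where "smooth_on S f \<longleftrightarrow> (\<forall>k. Ck_on k S f)"

definition test_function :: "('a::euclidean_space \<Rightarrow> complex) \<Rightarrow> bool"
  where "test_function \<phi> \<longleftrightarrow> smooth_on UNIV \<phi> \<and> compact (closure {x. \<phi> x \<noteq> 0})"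

definition pos_homogeneous :: "real \<Rightarrow> ('a::euclidean_space \<Rightarrow> complex) \<Rightarrow> bool"
  where "pos_homogeneous r f \<longleftrightarrow>
    (\<forall>t>0. \<forall>\<xi>. \<xi> \<noteq> 0 \<longrightarrow> f (t *\<^sub>R \<xi>) = complex_of_real (t powr r) * f \<xi>)"

definition fourier :: "('a::euclidean_space \<Rightarrow> complex) \<Rightarrow> 'a \<Rightarrow> complex"
  where "fourier f \<xi> = (\<integral>x. exp (- (\<i> * complex_of_real (x \<bullet> \<xi>))) * f x \<partial>lebesgue)"

definition inv_fourier :: "('a::euclidean_space \<Rightarrow> complex) \<Rightarrow> 'a \<Rightarrow> complex"
  where "inv_fourier g x = complex_of_real (1 / (2 * pi) ^ DIM('a)) *
    (\<integral>\<xi>. exp (\<i> * complex_of_real (x \<bullet> \<xi>)) * g \<xi> \<partial>lebesgue)"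

definition convolve :: "('a::euclidean_space \<Rightarrow> complex) \<Rightarrow> ('a \<Rightarrow> complex) \<Rightarrow> 'a \<Rightarrow> complex"
  where "convolve f g x = (\<integral>y. f (x - y) * g y \<partial>lebesgue)"

text \<open>Distributions are represented by their action on functions. Continuity and linearity are
  not part of the type: every distribution below is obtained from locally integrable functions by
  the operations that follow, each of which is the transpose of the corresponding operation on
  Schwartz functions.\<close>

type_synonym 'a distribution = "('a \<Rightarrow> complex) \<Rightarrow> complex"

definition dist_of :: "('a::euclidean_space \<Rightarrow> complex) \<Rightarrow> 'a distribution"
  where "dist_of f \<phi> = (\<integral>x. f x * \<phi> x \<partial>lebesgue)"

definition dist_mult :: "('a::euclidean_space \<Rightarrow> complex) \<Rightarrow> 'a distribution \<Rightarrow> 'a distribution"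
  where "dist_mult a T \<phi> = T (\<lambda>\<xi>. a \<xi> * \<phi> \<xi>)"

definition dist_fourier :: "'a::euclidean_space distribution \<Rightarrow> 'a distribution"
  where "dist_fourier T \<phi> = T (fourier \<phi>)"

definition dist_inv_fourier :: "'a::euclidean_space distribution \<Rightarrow> 'a distribution"
  where "dist_inv_fourier T \<phi> = T (inv_fourier \<phi>)"

definition dist_eq :: "'a::euclidean_space distribution \<Rightarrow> 'a distribution \<Rightarrow> bool"
  where "dist_eq S T \<longleftrightarrow> (\<forall>\<phi>. test_function \<phi> \<longrightarrow> S \<phi> = T \<phi>)"

definition low_cutoff :: "('a::euclidean_space \<Rightarrow> complex) \<Rightarrow> bool"
  where "low_cutoff \<eta> \<longleftrightarrow> test_function \<eta> \<and> (\<forall>\<^sub>F \<xi> in nhds 0. \<eta> \<xi> = 1)"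

text \<open>The distribution \<open>p(D)u\<close>, as the sum of the convolution of \<open>u\<close> with the function
  \<open>inv_fourier (\<eta> p)\<close> and the inverse Fourier transform of \<open>(1 - \<eta>) p\<close> times the Fourier
  transform of the tempered distribution \<open>u\<close>. It does not depend on the cutoff \<open>\<eta>\<close>, nor on the
  value of \<open>p\<close> at 0, where \<open>1 - \<eta>\<close> vanishes.\<close>

definition fourier_multiplier ::
    "('a::euclidean_space \<Rightarrow> complex) \<Rightarrow> ('a \<Rightarrow> complex) \<Rightarrow> ('a \<Rightarrow> complex) \<Rightarrow> 'a distribution"
  where "fourier_multiplier \<eta> p u = (\<lambda>\<phi>.
    dist_of (convolve (inv_fourier (\<lambda>\<xi>. \<eta> \<xi> * p \<xi>)) u) \<phi> +
    dist_inv_fourier (dist_mult (\<lambda>\<xi>. (1 - \<eta> \<xi>) * p \<xi>) (dist_fourier (dist_of u))) \<phi>)"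

end

theory Submission
  imports Defs "HOL-Probability.Characteristic_Functions"
begin

text \<open>
  Put \<open>d = DIM('a)\<close> and \<open>q = 1 / p\<close>. Formally \<open>u\<close> is the convolution of \<open>F u\<close> with the inverse Fourier
  transform \<open>K\<close> of \<open>q\<close>. The symbol estimates \<open>|D\<^sup>k q| \<le> C \<langle>\<xi>\<rangle>\<^sup>-\<^sup>M |\<xi>|\<^sup>-\<^sup>k\<close> give
  \<open>|K x| \<le> C min(|x|\<^sup>-\<^sup>d, |x|\<^sup>r\<^sup>-\<^sup>d)\<close> for a small \<open>r > 0\<close>, so convolution with \<open>K\<close> turns the decay
  \<open>\<langle>x\<rangle>\<^sup>-\<^sup>s\<close> into \<open>\<langle>x\<rangle>\<^sup>-\<^sup>t\<close> for every \<open>t < s\<close> with \<open>t \<le> d\<close>. As \<open>F u\<close> decays \<open>\<sigma>\<close> times as fast as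
  \<open>u\<close>, iterating reaches the decay \<open>\<langle>x\<rangle>\<^sup>-\<^sup>d\<close>.

  The symbols \<open>p\<close> and \<open>q\<close> are singular at 0, so the equation is tested only against Fourier
  transforms of functions supported in a shell \<open>\<rho> \<le> |\<xi>| \<le> R\<close>: there \<open>q\<close> is cut off to
  \<open>(1 - \<eta>(n\<xi>)) q(\<xi>) \<eta>(\<delta>\<xi>)\<close>, with estimates uniform in \<open>n\<close> and \<open>\<delta>\<close>. The limit \<open>n \<rightarrow> \<infinity>\<close> costs nothing
  because \<open>u\<close> decays, and \<open>\<delta> \<rightarrow> 0\<close> is taken weakly, against continuous functions of compact support.
\<close>

section \<open>Japanese bracket and radial integrals\<close>

text \<open>The rate stops at d because \<open>p\<close> need not be continuous at 0: the inverse
  transform of q then has size |x|^-d at infinity in general, however fast the right-hand side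
  decays. This size misses integrability by a logarithm, which forces t < s; the factor \<sigma> > 1
  pays for the loss in every round. At the origin the kernel is integrable because M > 0, and this
  is where r comes from. For M \<le> d the function q is not integrable, so no kernel of 1/p is ever
  formed. All estimates are for transforms of integrable truncations, with constants that see a
  truncation only through its symbol constant. Dilation invariance of order 0 symbol bounds makes
  that constant uniform. A single cutoff \<eta> does everything. It defines p(D)u, it truncates q at
  low and at high frequency, and its transform, of mass (2 \<pi>)^d because \<eta> 0 = 1, is the
  mollifier both for the equation and for u. Each round treats a linear equation p(D)u = v; the
  nonlinearity is seen only through the decay of v.\<close>

lemma japanese_ge_1: "1 \<le> \<langle>x\<rangle>"
  unfolding japanese_def by (simp add: real_le_rsqrt)

lemma japanese_pos [simp]: "0 < \<langle>x\<rangle>"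
  using japanese_ge_1[of x] by linarith

lemma japanese_neq_0 [simp]: "\<langle>x\<rangle> \<noteq> 0"
  using japanese_pos[of x] by linarith

lemma japanese_ge_norm: "norm x \<le> \<langle>x\<rangle>"
  unfolding japanese_def by (rule real_le_rsqrt) simp

lemma japanese_le: "\<langle>x\<rangle> \<le> 1 + norm x"
  unfolding japanese_def by (rule real_le_lsqrt) (auto simp: power2_sum)

lemma japanese_minus [simp]: "\<langle>- x\<rangle> = \<langle>x\<rangle>"
  by (simp add: japanese_def)

lemma japanese_minus_commute: "\<langle>x - y\<rangle> = \<langle>y - x\<rangle>"
  by (simp add: japanese_def norm_minus_commute)

lemma japanese_mono: "norm x \<le> norm y \<Longrightarrow> \<langle>x\<rangle> \<le> \<langle>y\<rangle>"
  unfolding japanese_def by (simp add: power_mono)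

lemma continuous_on_japanese [continuous_intros]:
  "continuous_on S g \<Longrightarrow> continuous_on S (\<lambda>x. \<langle>g x\<rangle>)"
  unfolding japanese_def by (intro continuous_intros)

lemma borel_measurable_japanese [measurable]: "japanese \<in> borel_measurable borel"
  unfolding japanese_def by measurable

lemma japanese_add: "\<langle>x + y\<rangle> \<le> 2 * \<langle>x\<rangle> * \<langle>y\<rangle>"
proof (rule power2_le_imp_le)
  have "(norm (x + y))\<^sup>2 \<le> (norm x + norm y)\<^sup>2"
    by (intro power_mono norm_triangle_ineq norm_ge_zero)
  also have "\<dots> \<le> 2 * (norm x)\<^sup>2 + 2 * (norm y)\<^sup>2"
    using sum_squares_bound[of "norm x" "norm y"] by (simp add: power2_sum)
  finally have "1 + (norm (x + y))\<^sup>2 \<le> 4 * ((1 + (norm x)\<^sup>2) * (1 + (norm y)\<^sup>2))"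
    by (simp add: algebra_simps)
      (smt (verit) mult_nonneg_nonneg zero_le_power2)
  then show "\<langle>x + y\<rangle>\<^sup>2 \<le> (2 * \<langle>x\<rangle> * \<langle>y\<rangle>)\<^sup>2"
    by (simp add: japanese_def power_mult_distrib add_nonneg_nonneg mult.assoc del: distrib_left_numeral)
qed (simp add: mult_nonneg_nonneg less_imp_le)

text \<open>The shells may overlap: each point picks one index whose step function dominates
  \<open>f\<close> there, and the sum over all indices dominates that one. Whole balls instead of
  annuli cost only a constant, because height times volume still decays geometrically.\<close>

lemma shell_sum_bound:
  fixes f :: "'a::euclidean_space \<Rightarrow> ennreal"
  assumes le: "\<And>x. \<exists>n. f x \<le> ennreal (c n) * indicator (ball 0 (\<rho> n)) x"
    and nonneg: "\<And>n. 0 \<le> c n" "\<And>n. 0 \<le> \<rho> n"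
    and geo: "\<And>n. c n * \<rho> n ^ DIM('a) = K * q ^ n"
    and q: "0 \<le> q" "q < 1" and K: "0 \<le> K"
  shows "(\<integral>\<^sup>+x. f x \<partial>lborel) \<le> ennreal (unit_ball_vol (DIM('a)) / (1 - q) * K)"
proof -
  let ?g = "\<lambda>n (x::'a). ennreal (c n) * indicator (ball 0 (\<rho> n)) x"
  let ?V = "unit_ball_vol (real DIM('a))"
  have "f x \<le> (\<Sum>n. ?g n x)" for x
  proof -
    obtain n where "f x \<le> ?g n x" using le by blast
    also have "\<dots> \<le> (\<Sum>n. ?g n x)"
      using sum_le_suminf[of "\<lambda>n. ?g n x" "{n}"] by (simp only: finite.intros sum.insert sum.empty empty_iff not_False_eq_True add_0_right zero_le summableI simp_thms)
    finally show ?thesis .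
  qed
  then have "(\<integral>\<^sup>+x. f x \<partial>lborel) \<le> (\<integral>\<^sup>+x. (\<Sum>n. ?g n x) \<partial>lborel)"
    by (intro nn_integral_mono) auto
  also have "\<dots> = (\<Sum>n. \<integral>\<^sup>+x. ?g n x \<partial>lborel)"
    by (rule nn_integral_suminf) (auto intro!: borel_measurable_indicator borel_measurable_times_ennreal)
  also have "\<dots> = (\<Sum>n. ennreal (?V * K * q ^ n))"
  proof (rule suminf_cong)
    fix n
    have "(\<integral>\<^sup>+x. ?g n x \<partial>lborel) = ennreal (c n) * ennreal (?V * \<rho> n ^ DIM('a))"
      by (subst nn_integral_cmult_indicator) (auto simp: emeasure_ball nonneg)
    also have "\<dots> = ennreal (c n * (?V * \<rho> n ^ DIM('a)))"
      using nonneg by (simp add: ennreal_mult unit_ball_vol_nonneg)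
    also have "c n * (?V * \<rho> n ^ DIM('a)) = ?V * K * q ^ n"
      using geo[of n] by (simp add: algebra_simps)
    finally show "(\<integral>\<^sup>+x. ?g n x \<partial>lborel) = ennreal (?V * K * q ^ n)" .
  qed
  also have "\<dots> = ennreal (\<Sum>n. ?V * K * q ^ n)"
    using q K by (intro suminf_ennreal2) (auto intro!: summable_mult summable_geometric)
  also have "(\<Sum>n. ?V * K * q ^ n) = ?V * K * (1 / (1 - q))"
    using q by (subst suminf_mult) (auto simp: suminf_geometric intro!: summable_geometric)
  also have "\<dots> = ?V / (1 - q) * K" by simp
  finally show ?thesis .
qed

lemma powr_minus_antimono: "0 < x \<Longrightarrow> x \<le> y \<Longrightarrow> 0 \<le> s \<Longrightarrow> y powr - s \<le> x powr - (s::real)"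
  by (rule powr_mono2') auto

text \<open>Height at radius R 2^a times the volume factor of radius R 2^b, in the form that
  \<open>shell_sum_bound\<close> wants: the level n survives only in the ratio
  \<open>2 powr g\<close>. It serves shells shrinking to the origin and shells growing to infinity
  alike.\<close>

lemma shell_term:
  assumes "0 < R" "a * - s + b * real m = e + g * real n"
    and "r = real m - s"
  shows "(R * 2 powr a) powr - s * (R * 2 powr b) ^ m = 2 powr e * R powr r * (2 powr g) ^ n"
proof -
  have "(R * 2 powr b) ^ m = (R * 2 powr b) powr real m"
    using assms by (subst powr_realpow) auto
  then have "(R * 2 powr a) powr - s * (R * 2 powr b) ^ m
      = (R powr - s * R powr real m) * (2 powr (a * - s) * 2 powr (b * real m))"
    using assms(1) by (simp only: powr_mult powr_powr) simp
  also have "\<dots> = R powr r * 2 powr (e + g * real n)"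
    by (simp only: powr_add[symmetric] assms) simp
  also have "\<dots> = 2 powr e * R powr r * (2 powr g) ^ n"
    by (simp add: powr_add powr_power mult.commute)
  finally show ?thesis .
qed

lemma japanese_powr_le_1: "0 \<le> s \<Longrightarrow> \<langle>x\<rangle> powr - s \<le> 1"
  using powr_minus_antimono[of 1 "\<langle>x\<rangle>" s] japanese_ge_1[of x] by simp

lemma norm_le_of_weight:
  assumes "norm y \<le> B * \<langle>x\<rangle> powr - s" "0 \<le> s"
  shows "norm y \<le> B"
proof -
  have "0 \<le> B * \<langle>x\<rangle> powr - s" using assms(1) norm_ge_zero order_trans by blast
  then have "0 \<le> B" by (simp add: zero_le_mult_iff)
  then show ?thesis
    using assms(1) mult_left_mono[OF japanese_powr_le_1[OF assms(2), of x], of B] by simp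
qed

text \<open>Peetre's inequality, from \<open>japanese_add\<close> applied to (x - a) + a. It trades
  decay in x - a for decay in x, at the price of a growing factor in a.\<close>

lemma japanese_powr_shift:
  assumes "0 \<le> s"
  shows "\<langle>x - a\<rangle> powr - s \<le> 2 powr s * \<langle>a\<rangle> powr s * \<langle>x\<rangle> powr - s"
proof -
  have "\<langle>x\<rangle> \<le> 2 * \<langle>x - a\<rangle> * \<langle>a\<rangle>" using japanese_add[of "x - a" a] by simp
  then have "(2 * \<langle>x - a\<rangle> * \<langle>a\<rangle>) powr - s \<le> \<langle>x\<rangle> powr - s"
    using assms by (intro powr_minus_antimono) auto
  then show ?thesis
    by (simp add: powr_mult mult_nonneg_nonneg less_imp_le powr_minus field_simps)
qed

lemma norm_powr_le_japanese:
  assumes "1 \<le> norm x" "0 \<le> s"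
  shows "norm x powr - s \<le> 2 powr s * \<langle>x\<rangle> powr - s"
proof -
  have "(2 * norm x) powr - s \<le> \<langle>x\<rangle> powr - s"
    using japanese_le[of x] assms by (intro powr_minus_antimono) auto
  moreover have "(2 * norm x) powr - s = norm x powr - s / 2 powr s"
    by (simp add: powr_mult powr_minus divide_inverse)
  ultimately show ?thesis by (simp add: divide_le_eq mult.commute)
qed

lemma one_le_japanese_powr:
  assumes "norm x \<le> 1" "0 \<le> s"
  shows "1 \<le> 2 powr s * \<langle>x\<rangle> powr - s"
proof -
  have "2 powr - s \<le> \<langle>x\<rangle> powr - s"
    using japanese_le[of x] assms by (intro powr_minus_antimono) auto
  then show ?thesis by (simp add: powr_minus field_simps)
qed

text \<open>Balls of radius R 2^-n shrink to the origin; heights grow like 2^(ns) while volumes fall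
  like 2^(-nd), and s < d makes the ratio 2^(s-d) less than 1.\<close>

lemma nn_integral_powr_near:
  assumes "0 \<le> s" "s < real DIM('a)"
  shows "\<exists>C\<ge>0. \<forall>R>0::real. (\<integral>\<^sup>+x.
    ennreal (norm (x::'a::euclidean_space) powr - s) * indicator (ball 0 R) x \<partial>lborel) \<le> ennreal (C * R powr (real DIM('a) - s))"
proof -
  define d where "d = real DIM('a)"
  define q where "q = 2 powr (s - d)"
  have q: "0 \<le> q" "q < 1" using assms by (auto simp: q_def d_def powr_less_one)
  let ?V = "unit_ball_vol (real DIM('a))"
  have *: "(\<integral>\<^sup>+x. ennreal (norm (x::'a) powr - s) * indicator (ball 0 R) x \<partial>lborel)
      \<le> ennreal (?V / (1 - q) * (2 powr s * R powr (d - s)))" if R: "R > 0" for R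
  proof (rule shell_sum_bound[where c = "\<lambda>n. (R * 2 powr (- real n - 1)) powr - s"
        and \<rho> = "\<lambda>n. R * 2 powr - real n"])
    fix x :: 'a
    show "\<exists>n. ennreal (norm x powr - s) * indicator (ball 0 R) x
      \<le> ennreal ((R * 2 powr (- real n - 1)) powr - s) * indicator (ball 0 (R * 2 powr - real n)) x"
    proof (cases "x \<noteq> 0 \<and> norm x < R")
      case True
      define n where "n = nat \<lfloor>log 2 (R / norm x)\<rfloor>"
      have "0 < log 2 (R / norm x)" using True R by (subst zero_less_log_cancel_iff) auto
      then have n: "real n \<le> log 2 (R / norm x)" "log 2 (R / norm x) < real n + 1"
        unfolding n_def by auto
      have 1: "norm x \<le> R * 2 powr - real n"
      proof -
        have "2 powr real n \<le> 2 powr (log 2 (R / norm x))" using n(1) by (intro powr_mono) auto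
        also have "\<dots> = R / norm x" using True R by (subst powr_log_cancel) auto
        finally show ?thesis using True by (simp add: powr_minus field_simps)
      qed
      have 2: "R * 2 powr (- real n - 1) \<le> norm x"
      proof -
        have "R / norm x = 2 powr (log 2 (R / norm x))" using True R by (subst powr_log_cancel) auto
        also have "\<dots> \<le> 2 powr (real n + 1)" using n(2) by (intro powr_mono) auto
        finally show ?thesis using True
          by (simp add: powr_minus field_simps powr_add powr_diff)
      qed
      show ?thesis
      proof (cases "norm x = R * 2 powr - real n")
        case False
        then show ?thesis using 1 2 True R assms(1)
          by (intro exI[of _ n]) (auto simp: indicator_def intro!: ennreal_leI powr_minus_antimono)
      next
        case eq: True
        \<comment> \<open>A point on the boundary of the open ball of index n is covered by the ball
          of index n - 1 instead; n = 0 is excluded because the point lies inside the ball of radius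
          R.\<close>
        then have "0 < n" using True by (cases n) auto
        then have e: "R * 2 powr (- real (n - 1) - 1) = R * 2 powr - real n"
          by (simp add: of_nat_diff)
        have "R * 2 powr - real n < R * 2 powr - real (n - 1)"
          using \<open>0 < n\<close> R by (simp add: of_nat_diff)
        then show ?thesis using eq e True R assms(1)
          by (intro exI[of _ "n - 1"]) (auto simp: indicator_def intro!: ennreal_leI powr_minus_antimono)
      qed
    next
      case False
      then show ?thesis by (auto simp: indicator_def)
    qed
  next
    show "(R * 2 powr (- real n - 1)) powr - s * (R * 2 powr - real n) ^ DIM('a) =
         2 powr s * R powr (d - s) * q ^ n" for n
      unfolding q_def
      by (rule shell_term) (use R in \<open>auto simp: d_def algebra_simps\<close>)
  qed (use R q in auto)
  show ?thesis
    by (rule exI[of _ "?V / (1 - q) * 2 powr s"])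
      (use * q in \<open>auto simp: d_def mult.assoc\<close>)
qed

text \<open>The outward analogue. The height is taken at the inner radius R 2^n and the open ball
  has radius R 2^(n+1), so it contains the half-open shell and no boundary case arises.\<close>

lemma nn_integral_powr_far:
  assumes "real DIM('a) < s"
  shows "\<exists>C\<ge>0. \<forall>R>0::real. (\<integral>\<^sup>+x.
    ennreal (norm (x::'a::euclidean_space) powr - s) * indicator {x. R \<le> norm x} x \<partial>lborel)
      \<le> ennreal (C * R powr (real DIM('a) - s))"
proof -
  define d where "d = real DIM('a)"
  have s0: "0 \<le> s" using assms by linarith
  define q where "q = 2 powr (d - s)"
  have q: "0 \<le> q" "q < 1" using assms by (auto simp: q_def d_def powr_less_one)
  let ?V = "unit_ball_vol (real DIM('a))"
  have *: "(\<integral>\<^sup>+x. ennreal (norm (x::'a) powr - s) * indicator {x. R \<le> norm x} x \<partial>lborel)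
      \<le> ennreal (?V / (1 - q) * (2 powr d * R powr (d - s)))" if R: "R > 0" for R
  proof (rule shell_sum_bound[where c = "\<lambda>n. (R * 2 powr real n) powr - s"
        and \<rho> = "\<lambda>n. R * 2 powr (real n + 1)"])
    fix x :: 'a
    show "\<exists>n. ennreal (norm x powr - s) * indicator {x. R \<le> norm x} x
      \<le> ennreal ((R * 2 powr real n) powr - s) * indicator (ball 0 (R * 2 powr (real n + 1))) x"
    proof (cases "R \<le> norm x")
      case True
      define n where "n = nat \<lfloor>log 2 (norm x / R)\<rfloor>"
      have x0: "norm x > 0" using True R by linarith
      have "0 \<le> log 2 (norm x / R)" using True R x0 by (subst zero_le_log_cancel_iff) auto
      then have n: "real n \<le> log 2 (norm x / R)" "log 2 (norm x / R) < real n + 1"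
        unfolding n_def by auto
      have 1: "R * 2 powr real n \<le> norm x"
      proof -
        have "2 powr real n \<le> 2 powr (log 2 (norm x / R))" using n(1) by (intro powr_mono) auto
        also have "\<dots> = norm x / R" using x0 R by (subst powr_log_cancel) auto
        finally show ?thesis using R by (simp add: field_simps)
      qed
      have 2: "norm x < R * 2 powr (real n + 1)"
      proof -
        have "norm x / R = 2 powr (log 2 (norm x / R))" using x0 R by (subst powr_log_cancel) auto
        also have "\<dots> < 2 powr (real n + 1)" using n(2) by (intro powr_less_mono) auto
        finally show ?thesis using R by (simp add: field_simps)
      qed
      show ?thesis using 1 2 True R s0
        by (intro exI[of _ n]) (auto simp: indicator_def intro!: ennreal_leI powr_minus_antimono)
    next
      case False
      then show ?thesis by (auto simp: indicator_def)
    qed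
  next
    show "(R * 2 powr real n) powr - s * (R * 2 powr (real n + 1)) ^ DIM('a) =
         2 powr d * R powr (d - s) * q ^ n" for n
      unfolding q_def
      by (rule shell_term) (use R in \<open>auto simp: d_def algebra_simps\<close>)
  qed (use R q in auto)
  show ?thesis
    by (rule exI[of _ "?V / (1 - q) * 2 powr d"])
      (use * q in \<open>auto simp: d_def mult.assoc\<close>)
qed

lemma integrable_japanese:
  assumes "real DIM('a) < s"
  shows "integrable lborel (\<lambda>x::'a::euclidean_space. \<langle>x\<rangle> powr - s)"
proof (rule integrableI_nonneg)
  from nn_integral_powr_far[OF assms] obtain C where
    C: "\<forall>R>0. (\<integral>\<^sup>+x. ennreal (norm (x::'a) powr - s) *
      indicator {x. R \<le> norm x} x \<partial>lborel) \<le> ennreal (C * R powr (real DIM('a) - s))"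
    by (elim exE conjE)
  have s0: "0 \<le> s" using assms by linarith
  have "(\<integral>\<^sup>+x. ennreal (\<langle>x::'a\<rangle> powr - s) \<partial>lborel) \<le>
      (\<integral>\<^sup>+x. indicator (ball (0::'a) 1) x + ennreal (norm (x::'a) powr - s) * indicator {x. 1 \<le> norm x} x \<partial>lborel)"
  proof (rule nn_integral_mono)
    fix x :: 'a
    show "ennreal (\<langle>x\<rangle> powr - s) \<le> indicator (ball 0 1) x + ennreal (norm x powr - s) * indicator {x. 1 \<le> norm x} x"
    proof (cases "norm x < 1")
      case True
      then show ?thesis using japanese_powr_le_1[OF s0, of x]
        by (auto simp: indicator_def intro: ennreal_leI)
    next
      case False
      then have "\<langle>x\<rangle> powr - s \<le> norm x powr - s"
        by (intro powr_minus_antimono) (use japanese_ge_norm s0 in auto)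
      then show ?thesis using False by (auto simp: indicator_def intro: ennreal_leI)
    qed
  qed
  also have "\<dots> = emeasure lborel (ball (0::'a) 1) + (\<integral>\<^sup>+x. ennreal (norm (x::'a) powr - s) *
      indicator {x. 1 \<le> norm x} x \<partial>lborel)"
    by (subst nn_integral_add) (auto intro!: borel_measurable_indicator)
  also have "\<dots> < \<infinity>"
    using C[rule_format, of 1] by (auto simp: emeasure_ball ennreal_add_eq_top less_top[symmetric] top_unique)
  finally show "(\<integral>\<^sup>+x. ennreal (\<langle>x::'a\<rangle> powr - s) \<partial>lborel) < \<infinity>" .
qed auto

section \<open>Finite differences and decay of Fourier transforms\<close>

lemma lborel_integral_affine:
  fixes f :: "'a::euclidean_space \<Rightarrow> 'b::{banach, second_countable_topology}"
  assumes [measurable]: "f \<in> borel_measurable borel" and c: "c \<noteq> 0"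
  shows "integral\<^sup>L lborel (\<lambda>x. f (t + c *\<^sub>R x)) = (1 / \<bar>c\<bar> ^ DIM('a)) *\<^sub>R integral\<^sup>L lborel f"
proof -
  have "integral\<^sup>L lborel f = \<bar>c\<bar> ^ DIM('a) *\<^sub>R integral\<^sup>L lborel (\<lambda>x. f (t + c *\<^sub>R x))"
    by (subst lborel_affine[OF c, of t])
      (simp add: integral_density integral_distr)
  then show ?thesis using c by simp
qed

lemma lborel_integrable_affine:
  fixes f :: "'a::euclidean_space \<Rightarrow> 'b::{banach, second_countable_topology}"
  assumes f: "integrable lborel f" and c: "c \<noteq> 0"
  shows "integrable lborel (\<lambda>x. f (t + c *\<^sub>R x))"
proof -
  have [measurable]: "f \<in> borel_measurable borel"
    using borel_measurable_integrable[OF f] by simp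
  have "integrable (density (distr lborel borel (\<lambda>x. t + c *\<^sub>R x)) (\<lambda>_. ennreal (\<bar>c\<bar> ^ DIM('a)))) f"
    using f lborel_affine[OF c, of t] by (simp add: ennreal_power)
  then have "integrable lborel (\<lambda>x. \<bar>c\<bar> ^ DIM('a) *\<^sub>R f (t + c *\<^sub>R x))" using c
    by (subst (asm) integrable_density) (auto simp: integrable_distr_eq)
  from integrable_scaleR_right[OF this, of "1 / \<bar>c\<bar> ^ DIM('a)"] show ?thesis
    using c by simp
qed

lemma lborel_nn_integral_shift:
  fixes f :: "'a::euclidean_space \<Rightarrow> ennreal"
  assumes [measurable]: "f \<in> borel_measurable borel"
  shows "integral\<^sup>N lborel (\<lambda>x. f (t + x)) = integral\<^sup>N lborel f"
  by (subst (2) lborel_distr_plus[of t, symmetric]) (simp add: nn_integral_distr)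

lemmas lborel_integral_shift = lborel_integral_affine[of _ 1, simplified]
lemmas lborel_integrable_shift = lborel_integrable_affine[of _ 1, simplified]
lemmas lborel_integral_reflect = lborel_integral_affine[of _ "-1", simplified]

abbreviation fexp :: "'a::euclidean_space \<Rightarrow> 'a \<Rightarrow> complex"
  where "fexp \<xi> x \<equiv> exp (- (\<i> * complex_of_real (\<xi> \<bullet> x)))"

lemma fourier_lborel:
  assumes [measurable]: "f \<in> borel_measurable borel"
  shows "fourier f x = (\<integral>\<xi>. fexp \<xi> x * f \<xi> \<partial>lborel)"
  unfolding fourier_def by (rule integral_completion) measurable

lemma integrable_phase:
  fixes f :: "'a::euclidean_space \<Rightarrow> complex"
  assumes "integrable lborel f" and [measurable]: "g \<in> borel_measurable borel"
  shows "integrable lborel (\<lambda>\<xi>. exp (- (\<i> * complex_of_real (g \<xi>))) * f \<xi>)"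
proof (rule Bochner_Integration.integrable_bound[OF assms(1)])
  show "(\<lambda>\<xi>. exp (- (\<i> * complex_of_real (g \<xi>))) * f \<xi>) \<in> borel_measurable lborel"
    using borel_measurable_integrable[OF assms(1)] by measurable
qed (auto simp: norm_mult)

lemma norm_fourier_le:
  assumes "integrable lborel f"
  shows "norm (fourier f x) \<le> (\<integral>\<xi>. norm (f \<xi>) \<partial>lborel)"
proof -
  have [measurable]: "f \<in> borel_measurable borel"
    using borel_measurable_integrable[OF assms] by simp
  show ?thesis
    unfolding fourier_lborel[OF \<open>f \<in> borel_measurable borel\<close>]
    by (rule order_trans[OF integral_norm_bound]) (simp add: norm_mult)
qed

lemma fourier_shift:
  assumes "integrable lborel f"
  shows "fourier (\<lambda>\<xi>. f (v + \<xi>)) x = exp (\<i> * complex_of_real (v \<bullet> x)) * fourier f x"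
proof -
  have [measurable]: "f \<in> borel_measurable borel"
    using borel_measurable_integrable[OF assms] by simp
  have "fourier f x = (\<integral>\<xi>. fexp (v + \<xi>) x * f (v + \<xi>) \<partial>lborel)"
    by (simp add: fourier_lborel
        lborel_integral_shift[of "\<lambda>\<xi>. fexp \<xi> x * f \<xi>"])
  also have "\<dots> = (\<integral>\<xi>. fexp v x *
      (fexp \<xi> x * f (v + \<xi>)) \<partial>lborel)"
    by (simp add: inner_add_left ring_distribs mult.assoc[symmetric] flip: exp_add)
  also have "\<dots> = fexp v x * fourier (\<lambda>\<xi>. f (v + \<xi>)) x"
    by (simp add: fourier_lborel)
  finally show ?thesis
    by (simp add: exp_minus field_simps)
qed

lemma fourier_diff:
  assumes "integrable lborel f" "integrable lborel g"
  shows "fourier (\<lambda>\<xi>. f \<xi> - g \<xi>) x = fourier f x - fourier g x"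
proof -
  have [measurable]: "f \<in> borel_measurable borel" "g \<in> borel_measurable borel"
    using assms[THEN borel_measurable_integrable] by simp_all
  show ?thesis
    using assms[THEN integrable_phase, of "\<lambda>\<xi>. \<xi> \<bullet> x"]
    by (simp add: fourier_lborel right_diff_distrib)
qed

section \<open>Iterated differences\<close>

primrec fdiff :: "nat \<Rightarrow> 'a::real_vector \<Rightarrow> ('a \<Rightarrow> complex) \<Rightarrow> 'a \<Rightarrow> complex" where
  "fdiff 0 v f \<xi> = f \<xi>"
| "fdiff (Suc n) v f \<xi> = fdiff n v f (v + \<xi>) - fdiff n v f \<xi>"

lemma integrable_fdiff:
  fixes f :: "'a::euclidean_space \<Rightarrow> complex"
  shows "integrable lborel f \<Longrightarrow> integrable lborel (fdiff n v f)"
proof (induction n)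
  case (Suc n)
  then show ?case
    using lborel_integrable_shift[of "fdiff n v f" v] by (simp add: fdiff.simps(2)[abs_def])
qed (simp add: fdiff.simps(1)[abs_def])

lemma fourier_fdiff:
  assumes "integrable lborel f"
  shows "fourier (fdiff n v f) x = (exp (\<i> * complex_of_real (v \<bullet> x)) - 1) ^ n * fourier f x"
proof (induction n)
  case 0
  then show ?case by (simp add: fdiff.simps(1)[abs_def])
next
  case (Suc n)
  have "fourier (fdiff (Suc n) v f) x =
      fourier (\<lambda>\<xi>. fdiff n v f (v + \<xi>)) x - fourier (fdiff n v f) x"
    unfolding fdiff.simps(2)[abs_def]
    by (rule fourier_diff) (auto intro: lborel_integrable_shift integrable_fdiff assms)
  also have "\<dots> = (exp (\<i> * complex_of_real (v \<bullet> x)) - 1) * fourier (fdiff n v f) x"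
    by (subst fourier_shift) (auto simp: integrable_fdiff assms left_diff_distrib)
  finally show ?case by (simp add: Suc mult.assoc del: fdiff.simps)
qed

text \<open>A step of half a period in the direction \<open>v\<close> multiplies the Fourier transform by \<open>-2\<close>. This
  replaces integration by parts: neither a cutoff nor the integrability of derivatives is needed.\<close>

lemma fourier_fdiff_pi:
  assumes f: "integrable lborel f" and "v \<bullet> x = pi"
  shows "2 ^ n * norm (fourier f x) \<le> (\<integral>\<xi>. norm (fdiff n v f \<xi>) \<partial>lborel)"
proof -
  have "fourier (fdiff n v f) x = (- 2) ^ n * fourier f x"
    using fourier_fdiff[OF f, of n v x] assms(2) by (simp add: mult.commute)
  then have "2 ^ n * norm (fourier f x) = norm (fourier (fdiff n v f) x)"
    by (simp add: norm_mult norm_power)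
  then show ?thesis using norm_fourier_le[OF integrable_fdiff[OF f]] by simp
qed

text \<open>Near the origin a symbol has no useful derivative bounds, so its differences are
  controlled by its size: each difference at most doubles the mass, taken over a ball enlarged by
  one step.\<close>

lemma nn_integral_fdiff_ball:
  fixes f :: "'a::euclidean_space \<Rightarrow> complex"
  assumes f: "integrable lborel f"
  shows "(\<integral>\<^sup>+\<xi>. ennreal (norm (fdiff n v f \<xi>)) * indicator (ball 0 S) \<xi> \<partial>lborel)
    \<le> 2 ^ n * (\<integral>\<^sup>+\<xi>. ennreal (norm (f \<xi>)) * indicator (ball 0 (S + n * norm v)) \<xi> \<partial>lborel)"
proof (induction n arbitrary: S)
  case (Suc n)
  define g where "g = fdiff n v f"
  have [measurable]: "g \<in> borel_measurable borel"
    using borel_measurable_integrable[OF integrable_fdiff[OF f]] by (simp add: g_def)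
  have [measurable]: "ball 0 r \<in> sets (borel :: 'a measure)" for r by simp
  let ?I = "\<lambda>r. \<integral>\<^sup>+\<xi>. ennreal (norm (g \<xi>)) * indicator (ball 0 r) \<xi> \<partial>lborel"
  have "(\<integral>\<^sup>+\<xi>. ennreal (norm (fdiff (Suc n) v f \<xi>)) * indicator (ball 0 S) \<xi> \<partial>lborel)
      \<le> (\<integral>\<^sup>+\<xi>. ennreal (norm (g (v + \<xi>))) * indicator (ball 0 (S + norm v)) (v + \<xi>)
         + ennreal (norm (g \<xi>)) * indicator (ball 0 (S + norm v)) \<xi> \<partial>lborel)"
  proof (rule nn_integral_mono)
    fix \<xi> :: 'a
    have "norm (v + \<xi>) < S + norm v" if "norm \<xi> < S"
      using that norm_triangle_ineq[of v \<xi>] by linarith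
    moreover have "norm \<xi> < S + norm v" if "norm \<xi> < S"
      using that norm_ge_zero[of v] by linarith
    ultimately show "ennreal (norm (fdiff (Suc n) v f \<xi>)) * indicator (ball 0 S) \<xi> \<le>
        ennreal (norm (g (v + \<xi>))) * indicator (ball 0 (S + norm v)) (v + \<xi>)
         + ennreal (norm (g \<xi>)) * indicator (ball 0 (S + norm v)) \<xi>"
      by (auto simp: indicator_def g_def ennreal_plus[symmetric] simp del: ennreal_plus
          intro!: ennreal_leI norm_triangle_ineq4)
  qed
  also have "\<dots> = ?I (S + norm v) + ?I (S + norm v)"
    by (subst nn_integral_add)
      (auto simp: lborel_nn_integral_shift[of "\<lambda>\<xi>. ennreal (norm (g \<xi>)) * indicator (ball 0 (S + norm v)) \<xi>"])
  also have "\<dots> = 2 * ?I (S + norm v)" by (simp add: mult_2)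
  also have "\<dots> \<le> 2 * (2 ^ n * (\<integral>\<^sup>+\<xi>. ennreal (norm (f \<xi>)) * indicator (ball 0 (S + norm v + n * norm v)) \<xi> \<partial>lborel))"
    unfolding g_def by (intro mult_left_mono Suc) simp
  finally show ?case
    by (simp add: algebra_simps)
qed simp

text \<open>Only the last derivative is bounded. The derivatives are existential witnesses along
  lines in the direction \<open>b\<close>, so \<open>U\<close> may be a mere segment.\<close>

primrec dchain :: "'a::euclidean_space set \<Rightarrow> 'a \<Rightarrow> real \<Rightarrow> nat \<Rightarrow> ('a \<Rightarrow> complex) \<Rightarrow> bool" where
  "dchain U b B 0 f \<longleftrightarrow> (\<forall>\<xi>\<in>U. norm (f \<xi>) \<le> B)"
| "dchain U b B (Suc n) f \<longleftrightarrow>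
    (\<exists>f'. (\<forall>\<xi>\<in>U. ((\<lambda>t. f (\<xi> + t *\<^sub>R b)) has_vector_derivative f' \<xi>) (at 0)) \<and> dchain U b B n f')"

lemma has_vector_derivative_fdiff:
  assumes "\<And>j. j \<le> n \<Longrightarrow> ((\<lambda>t. f (\<xi> + real j *\<^sub>R v + t *\<^sub>R b)) has_vector_derivative f' (\<xi> + real j *\<^sub>R v)) (at 0)"
  shows "((\<lambda>t. fdiff n v f (\<xi> + t *\<^sub>R b)) has_vector_derivative fdiff n v f' \<xi>) (at 0)"
  using assms
proof (induction n arbitrary: \<xi>)
  case 0
  then show ?case by simp
next
  case (Suc n)
  have "((\<lambda>t. fdiff n v f (v + \<xi> + t *\<^sub>R b)) has_vector_derivative fdiff n v f' (v + \<xi>)) (at 0)"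
  proof (rule Suc.IH)
    fix j assume "j \<le> n"
    then show "((\<lambda>t. f (v + \<xi> + real j *\<^sub>R v + t *\<^sub>R b)) has_vector_derivative f' (v + \<xi> + real j *\<^sub>R v)) (at 0)"
      using Suc.prems[of "Suc j"] by (simp add: algebra_simps)
  qed
  moreover have "((\<lambda>t. fdiff n v f (\<xi> + t *\<^sub>R b)) has_vector_derivative fdiff n v f' \<xi>) (at 0)"
    by (rule Suc.IH) (rule Suc.prems, simp)
  ultimately show ?case
    by (auto simp: add.assoc intro!: derivative_intros)
qed

lemma has_vector_derivative_line:
  fixes g :: "'a::real_vector \<Rightarrow> 'b::real_normed_vector"
  assumes "((\<lambda>t. g (\<xi> + s *\<^sub>R v + t *\<^sub>R v)) has_vector_derivative D) (at 0)"
  shows "((\<lambda>t. g (\<xi> + t *\<^sub>R v)) has_vector_derivative D) (at s)"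
proof -
  have "((\<lambda>t. g (\<xi> + s *\<^sub>R v + (t - s) *\<^sub>R v)) has_vector_derivative 1 *\<^sub>R D) (at s)"
    using assms
    by (intro vector_diff_chain_at[of "\<lambda>t. t - s" 1 s "\<lambda>t. g (\<xi> + s *\<^sub>R v + t *\<^sub>R v)", unfolded o_def])
      (auto intro!: derivative_eq_intros)
  moreover have "\<xi> + s *\<^sub>R v + (t - s) *\<^sub>R v = \<xi> + t *\<^sub>R v" for t
    by (simp add: algebra_simps)
  ultimately show ?thesis by simp
qed

lemma has_vector_derivative_scale_dir:
  fixes g :: "'a::real_vector \<Rightarrow> 'b::real_normed_vector"
  assumes "((\<lambda>t. g (\<xi> + t *\<^sub>R b)) has_vector_derivative D) (at 0)"
  shows "((\<lambda>t. g (\<xi> + t *\<^sub>R (\<tau> *\<^sub>R b))) has_vector_derivative \<tau> *\<^sub>R D) (at 0)"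
proof -
  have "((\<lambda>t. g (\<xi> + (t * \<tau>) *\<^sub>R b)) has_vector_derivative \<tau> *\<^sub>R D) (at 0)"
    using assms
    by (intro vector_diff_chain_at[of "\<lambda>t. t * \<tau>" \<tau> 0 "\<lambda>t. g (\<xi> + t *\<^sub>R b)", unfolded o_def])
      (auto intro!: derivative_eq_intros)
  then show ?thesis by (simp only: scaleR_scaleR)
qed

text \<open>Iterated mean value inequality. Differences commute with the derivative along
  \<open>b\<close>, so each difference is exchanged for a factor |\<tau>| and one derivative; all
  points involved lie on the segment from \<xi> to \<xi> + n \<tau> b.\<close>

lemma norm_fdiff_le:
  assumes "dchain U b B n f" and "\<And>s. 0 \<le> s \<Longrightarrow> s \<le> real n \<Longrightarrow> \<xi> + (s * \<tau>) *\<^sub>R b \<in> U"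
  shows "norm (fdiff n (\<tau> *\<^sub>R b) f \<xi>) \<le> \<bar>\<tau>\<bar> ^ n * B"
  using assms
proof (induction n arbitrary: f \<xi>)
  case 0
  then show ?case using "0.prems"(2)[of 0] by simp
next
  case (Suc n)
  let ?v = "\<tau> *\<^sub>R b"
  from Suc.prems obtain f' where f': "\<And>\<xi>. \<xi> \<in> U \<Longrightarrow> ((\<lambda>t. f (\<xi> + t *\<^sub>R b)) has_vector_derivative f' \<xi>) (at 0)"
    and ch: "dchain U b B n f'" by auto
  have bd: "norm (fdiff n ?v f' (\<xi> + s *\<^sub>R ?v)) \<le> \<bar>\<tau>\<bar> ^ n * B" if "0 \<le> s" "s \<le> 1" for s
  proof (rule Suc.IH[OF ch])
    fix s' assume "0 \<le> s'" "s' \<le> real n"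
    then show "\<xi> + s *\<^sub>R ?v + (s' * \<tau>) *\<^sub>R b \<in> U"
      using Suc.prems(2)[of "s + s'"] that by (simp add: algebra_simps)
  qed
  have der: "((\<lambda>s. fdiff n ?v f (\<xi> + s *\<^sub>R ?v)) has_vector_derivative \<tau> *\<^sub>R fdiff n ?v f' (\<xi> + s *\<^sub>R ?v)) (at s)"
    if "0 \<le> s" "s \<le> 1" for s
  proof (rule has_vector_derivative_line, rule has_vector_derivative_scale_dir,
      rule has_vector_derivative_fdiff, rule f')
    fix j assume "j \<le> n"
    then show "\<xi> + s *\<^sub>R ?v + real j *\<^sub>R ?v \<in> U"
      using Suc.prems(2)[of "s + real j"] that by (simp add: algebra_simps)
  qed
  have "norm (fdiff n ?v f (\<xi> + 1 *\<^sub>R ?v) - fdiff n ?v f (\<xi> + 0 *\<^sub>R ?v)) \<le> \<bar>\<tau>\<bar> ^ Suc n * B * norm (1 - 0 :: real)"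
  proof (rule differentiable_bound[of "{0..1}" "\<lambda>s. fdiff n ?v f (\<xi> + s *\<^sub>R ?v)"
        "\<lambda>s h. h *\<^sub>R (\<tau> *\<^sub>R fdiff n ?v f' (\<xi> + s *\<^sub>R ?v))"])
    fix s :: real assume s: "s \<in> {0..1}"
    show "((\<lambda>s. fdiff n ?v f (\<xi> + s *\<^sub>R ?v)) has_derivative
        (\<lambda>h. h *\<^sub>R (\<tau> *\<^sub>R fdiff n ?v f' (\<xi> + s *\<^sub>R ?v)))) (at s within {0..1})"
      using der[of s] s by (auto simp: has_vector_derivative_def intro: has_derivative_at_withinI)
    have "norm (\<tau> *\<^sub>R fdiff n ?v f' (\<xi> + s *\<^sub>R ?v)) \<le> \<bar>\<tau>\<bar> ^ Suc n * B"
      using mult_left_mono[OF bd[of s], of "\<bar>\<tau>\<bar>"] s by (simp add: mult.assoc)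
    then show "onorm (\<lambda>h. h *\<^sub>R (\<tau> *\<^sub>R fdiff n ?v f' (\<xi> + s *\<^sub>R ?v))) \<le> \<bar>\<tau>\<bar> ^ Suc n * B"
      by (intro onorm_le) (metis mult.commute mult_left_mono norm_ge_zero norm_scaleR real_norm_def)
  qed auto
  then show ?case by (simp add: add.commute)
qed

lemma dchain_mono: "dchain U b B n f \<Longrightarrow> V \<subseteq> U \<Longrightarrow> B \<le> B' \<Longrightarrow> dchain V b B' n f"
proof (induction n arbitrary: f)
  case 0
  then show ?case by (auto intro: order_trans)
next
  case (Suc n)
  then obtain f' where f': "\<And>\<xi>. \<xi> \<in> U \<Longrightarrow> ((\<lambda>t. f (\<xi> + t *\<^sub>R b)) has_vector_derivative f' \<xi>) (at 0)"
    and ch: "dchain U b B n f'" by auto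
  then show ?case using Suc.prems(2) Suc.IH[OF ch Suc.prems(2,3)] by auto
qed

text \<open>Only the pure derivatives in one direction \<open>b\<close> are controlled, each costing a factor \<open>|\<xi>|\<^sup>-\<^sup>1\<close>:
  the Fourier transform at \<open>x\<close> is estimated through the largest coordinate of \<open>x\<close> alone. The value
  at 0 is irrelevant. A homogeneous function of degree \<open>r\<close> has \<open>s = 0\<close> and \<open>t = -r\<close>.\<close>

definition symbol_bound :: "real \<Rightarrow> real \<Rightarrow> real \<Rightarrow> ('a::euclidean_space \<Rightarrow> complex) \<Rightarrow> bool" where
  "symbol_bound s A t f \<longleftrightarrow> continuous_on (- {0}) f \<and>
    (\<forall>\<xi>. \<xi> \<noteq> 0 \<longrightarrow> norm (f \<xi>) \<le> A * \<langle>\<xi>\<rangle> powr s * norm \<xi> powr - t)"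

primrec symbol :: "'a::euclidean_space \<Rightarrow> real \<Rightarrow> real \<Rightarrow> nat \<Rightarrow> real \<Rightarrow> ('a \<Rightarrow> complex) \<Rightarrow> bool" where
  "symbol b s A 0 t f \<longleftrightarrow> symbol_bound s A t f"
| "symbol b s A (Suc k) t f \<longleftrightarrow> symbol_bound s A t f \<and>
    (\<exists>f'. (\<forall>\<xi>. \<xi> \<noteq> 0 \<longrightarrow> ((\<lambda>\<tau>. f (\<xi> + \<tau> *\<^sub>R b)) has_vector_derivative f' \<xi>) (at 0)) \<and>
      symbol b s A k (t + 1) f')"

lemma symbol_imp_bound: "symbol b s A k t f \<Longrightarrow> symbol_bound s A t f"
  by (cases k) auto

text \<open>Bridge to \<open>norm_fdiff_le\<close>: at distance at least \<open>S\<close> from the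
  origin the singular factor is at most its value at \<open>S\<close>.\<close>

lemma symbol_imp_dchain:
  assumes "symbol b 0 A n t f" "0 \<le> t" "0 \<le> A" "0 < S" "\<And>\<xi>. \<xi> \<in> U \<Longrightarrow> S \<le> norm \<xi>"
  shows "dchain U b (A * S powr - (t + n)) n f"
  using assms
proof (induction n arbitrary: f t)
  case 0
  have "norm (f \<xi>) \<le> A * S powr - t" if "\<xi> \<in> U" for \<xi>
  proof -
    have "0 < norm \<xi>" using 0(4) 0(5)[OF that] by linarith
    then have "\<xi> \<noteq> 0" by simp
    then have "norm (f \<xi>) \<le> A * norm \<xi> powr - t"
      using 0 by (simp add: symbol_bound_def)
    also have "\<dots> \<le> A * S powr - t"
      using 0 that by (intro mult_left_mono powr_minus_antimono) auto
    finally show ?thesis .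
  qed
  then show ?case by simp
next
  case (Suc n)
  then obtain f' where f': "\<forall>\<xi>. \<xi> \<noteq> 0 \<longrightarrow> ((\<lambda>\<tau>. f (\<xi> + \<tau> *\<^sub>R b)) has_vector_derivative f' \<xi>) (at 0)"
    and s: "symbol b 0 A n (t + 1) f'" by auto
  have "dchain U b (A * S powr - (t + 1 + n)) n f'"
    by (rule Suc.IH[OF s]) (use Suc.prems in auto)
  moreover have "\<xi> \<noteq> 0" if "\<xi> \<in> U" for \<xi>
    using Suc.prems(4) Suc.prems(5)[OF that] by auto
  ultimately show ?case using f' by (auto simp: add.assoc)
qed

text \<open>A coordinate of size at least |x| / d keeps the half-period step \<pi> / (x \<bullet> b)
  of order 1 / |x|.\<close>

lemma ex_large_coordinate:
  fixes x :: "'a::euclidean_space"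
  shows "\<exists>b\<in>Basis. norm x \<le> real DIM('a) * \<bar>x \<bullet> b\<bar>"
proof (rule ccontr)
  assume "\<not> ?thesis"
  then have "\<bar>x \<bullet> b\<bar> < norm x / real DIM('a)" if "b \<in> Basis" for b
    using that by (auto simp: field_simps not_le)
  then have "(\<Sum>b\<in>Basis. \<bar>x \<bullet> b\<bar>) < (\<Sum>b\<in>(Basis::'a set). norm x / real DIM('a))"
    by (intro sum_strict_mono) auto
  then show False using norm_le_l1[of x] by simp
qed

text \<open>For |x| \<ge> 1 the half-period step has length of order 1 / |x|, and n differences
  bring its n-th power while the supports stay in a fixed ball. For |x| < 1 the L1 norm
  suffices.\<close>

lemma fourier_decay:
  assumes f: "integrable lborel f" and supp: "\<And>\<xi>. R < norm \<xi> \<Longrightarrow> f \<xi> = 0"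
    and ch: "\<And>b. b \<in> Basis \<Longrightarrow> \<exists>B. dchain UNIV b B n f"
  shows "\<exists>C\<ge>0. \<forall>x::'a::euclidean_space. norm (fourier f x) \<le> C * \<langle>x\<rangle> powr - real n"
proof -
  obtain B where B: "\<And>b. b \<in> Basis \<Longrightarrow> dchain UNIV b (B b) n f"
    using ch by metis
  define d where "d = real DIM('a)"
  define B' where "B' = Max (insert 0 (B ` Basis))"
  have B'0: "0 \<le> B'" by (simp add: B'_def)
  have B': "dchain UNIV b B' n f" if "b \<in> Basis" for b
    by (rule dchain_mono[OF B[OF that]]) (use that in \<open>auto simp: B'_def le_max_iff_disj intro!: disjI2 Max_ge\<close>)
  \<comment> \<open>For |x| \<ge> 1 the step has length at most \<pi> d, so this ball contains the
    support of every n-th difference that occurs.\<close>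
  define R' where "R' = \<bar>R\<bar> + real n * (pi * d) + 1"
  define V where "V = measure lborel (ball (0::'a) R')"
  define I where "I = (\<integral>\<xi>. norm (f \<xi>) \<partial>lborel)"
  have fd0: "fdiff m v f \<xi> = 0" if "\<bar>R\<bar> + real m * norm v < norm \<xi>" for m v \<xi>
    using that
  proof (induction m arbitrary: \<xi>)
    case 0
    then show ?case using supp[of \<xi>] by simp
  next
    case (Suc m)
    have "norm \<xi> \<le> norm (v + \<xi>) + norm v"
      using norm_triangle_ineq4[of "v + \<xi>" v] by simp
    then have "\<bar>R\<bar> + real m * norm v < norm (v + \<xi>)" "\<bar>R\<bar> + real m * norm v < norm \<xi>"
      using Suc.prems norm_ge_zero[of v] unfolding of_nat_Suc distrib_right by linarith+
    then show ?case using Suc.IH by simp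
  qed
  have big: "norm (fourier f x) \<le> (pi * d) ^ n * B' * V * norm x powr - real n" if x: "1 \<le> norm x" for x
  proof -
    obtain b where b: "b \<in> Basis" "norm x \<le> d * \<bar>x \<bullet> b\<bar>"
      using ex_large_coordinate[of x] by (auto simp: d_def)
    have xb: "\<bar>x \<bullet> b\<bar> > 0" using b(2) x by (auto simp: d_def)
    define \<tau> where "\<tau> = pi / (x \<bullet> b)"
    have \<tau>: "\<bar>\<tau>\<bar> \<le> pi * d / norm x"
    proof -
      have "0 < norm x" using x by auto
      then show ?thesis
        using mult_left_mono[OF b(2), of pi] xb by (simp add: \<tau>_def field_simps)
    qed
    have \<tau>1: "\<bar>\<tau>\<bar> \<le> pi * d"
      by (rule order_trans[OF \<tau>]) (use x divide_left_mono[of 1 "norm x" "pi * d"] in \<open>fastforce simp: d_def\<close>)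
    have pi: "(\<tau> *\<^sub>R b) \<bullet> x = pi" using xb by (simp add: \<tau>_def inner_commute)
    have "norm (fourier f x) \<le> 2 ^ n * norm (fourier f x)"
      by (simp add: mult_le_cancel_right1)
    also have "\<dots> \<le> (\<integral>\<xi>. norm (fdiff n (\<tau> *\<^sub>R b) f \<xi>) \<partial>lborel)"
      by (rule fourier_fdiff_pi[OF f pi])
    also have "\<dots> \<le> (\<integral>\<xi>. \<bar>\<tau>\<bar> ^ n * B' * indicator (ball (0::'a) R') \<xi> \<partial>lborel)"
    proof (rule integral_mono)
      show "integrable lborel (\<lambda>\<xi>. norm (fdiff n (\<tau> *\<^sub>R b) f \<xi>))"
        by (intro integrable_norm integrable_fdiff f)
      show "integrable lborel (\<lambda>\<xi>::'a. \<bar>\<tau>\<bar> ^ n * B' * indicator (ball 0 R') \<xi>)"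
        by (intro integrable_mult_right integrable_real_indicator)
          (auto simp: emeasure_ball R'_def d_def)
      fix \<xi> :: 'a
      show "norm (fdiff n (\<tau> *\<^sub>R b) f \<xi>) \<le> \<bar>\<tau>\<bar> ^ n * B' * indicator (ball 0 R') \<xi>"
      proof (cases "norm \<xi> < R'")
        case True
        then show ?thesis using norm_fdiff_le[OF B'[OF b(1)], of \<xi> \<tau>] by simp
      next
        case False
        have "real n * \<bar>\<tau>\<bar> \<le> real n * (pi * d)" using \<tau>1 by (intro mult_left_mono) auto
        then have "fdiff n (\<tau> *\<^sub>R b) f \<xi> = 0"
          using False b(1) by (intro fd0) (auto simp: R'_def)
        then show ?thesis using False by simp
      qed
    qed
    also have "\<dots> = \<bar>\<tau>\<bar> ^ n * B' * V"
      by (simp add: V_def)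
    also have "\<dots> \<le> (pi * d / norm x) ^ n * B' * V"
      using \<tau> B'0 by (intro mult_right_mono power_mono) (auto simp: V_def)
    also have "\<dots> = (pi * d) ^ n * B' * V * norm x powr - real n"
      using x powr_realpow[of "norm x" n] by (cases "x = 0") (auto simp: power_divide powr_minus field_simps)
    finally show ?thesis .
  qed
  define C where "C = 2 ^ n * ((pi * d) ^ n * B' * V + I)"
  have nn: "0 \<le> (pi * d) ^ n * B' * V" "0 \<le> I"
    using B'0 by (auto simp: V_def I_def d_def intro!: mult_nonneg_nonneg)
  have "norm (fourier f x) \<le> C * \<langle>x\<rangle> powr - real n" for x
  proof (cases "1 \<le> norm x")
    case True
    then have *: "norm x powr - real n \<le> 2 ^ n * \<langle>x\<rangle> powr - real n"
      using norm_powr_le_japanese[of x "real n"] by (simp add: powr_realpow)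
    have "norm (fourier f x) \<le> (pi * d) ^ n * B' * V * (2 ^ n * \<langle>x\<rangle> powr - real n)"
      using big[OF True] mult_left_mono[OF * nn(1)] by linarith
    also have "\<dots> \<le> ((pi * d) ^ n * B' * V + I) * (2 ^ n * \<langle>x\<rangle> powr - real n)"
      using nn by (intro mult_right_mono) auto
    also have "\<dots> = C * \<langle>x\<rangle> powr - real n"
      by (simp add: C_def)
    finally show ?thesis .
  next
    case False
    then have *: "1 \<le> 2 ^ n * \<langle>x\<rangle> powr - real n"
      using one_le_japanese_powr[of x "real n"] by (simp add: powr_realpow)
    have "norm (fourier f x) \<le> I * 1" using norm_fourier_le[OF f] by (simp add: I_def)
    also have "\<dots> \<le> I * (2 ^ n * \<langle>x\<rangle> powr - real n)"
      by (intro mult_left_mono * nn)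
    also have "\<dots> \<le> ((pi * d) ^ n * B' * V + I) * (2 ^ n * \<langle>x\<rangle> powr - real n)"
      using nn by (intro mult_right_mono) auto
    also have "\<dots> = C * \<langle>x\<rangle> powr - real n"
      by (simp add: C_def)
    finally show ?thesis .
  qed
  moreover have "C \<ge> 0" using nn by (simp add: C_def)
  ultimately show ?thesis by blast
qed

text \<open>The frequency integral is split at |\<xi>| of order 1 / |x|, the length of the
  half-period step. Inside, the size of \<open>f\<close> alone is integrated, which uses r < d;
  outside, d + 1 differences gain |\<tau>|^(d+1) against |\<xi>|^-(r+d+1). Both parts scale like
  |\<tau>|^(d-r), hence like |x|^(r-d). The constant sees \<open>f\<close> only through
  \<open>A\<close>.\<close>

lemma fourier_kernel_bound:
  assumes r: "0 \<le> r" "r < real DIM('a)"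
  shows "\<exists>C\<ge>0. \<forall>A\<ge>0. \<forall>f. integrable lborel f \<longrightarrow>
    (\<forall>b\<in>Basis. symbol b 0 A (Suc DIM('a)) r f) \<longrightarrow>
    (\<forall>x::'a::euclidean_space. x \<noteq> 0 \<longrightarrow> norm (fourier f x) \<le> C * A * norm x powr (r - real DIM('a)))"
proof -
  define d where "d = real DIM('a)"
  \<comment> \<open>One difference more than the dimension makes |\<xi>|^-(r+N) integrable at
    infinity for every r \<ge> 0.\<close>
  define N where "N = Suc DIM('a)"
  define n where "n = real N"
  have n: "n = d + 1" "0 < d" "0 < n" by (auto simp: n_def d_def N_def)
  from nn_integral_powr_near[OF r] obtain C1 where "0 \<le> C1" and
    C1: "\<forall>R>0::real. (\<integral>\<^sup>+x. ennreal (norm (x::'a) powr - r) *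
      indicator (ball 0 R) x \<partial>lborel) \<le> ennreal (C1 * R powr (d - r))"
    unfolding d_def by (elim exE conjE)
  have "real DIM('a) < r + n" using n r unfolding d_def by simp
  from nn_integral_powr_far[OF this] obtain C2 where "0 \<le> C2" and
    C2: "\<forall>R>0::real. (\<integral>\<^sup>+x. ennreal (norm (x::'a) powr - (r + n)) *
      indicator {x. R \<le> norm x} x \<partial>lborel) \<le> ennreal (C2 * R powr (d - (r + n)))"
    unfolding d_def by (elim exE conjE)
  define C where "C = (2 ^ N * (C1 * (3 * n) powr (d - r)) +
    2 powr (r + n) * (C2 * (2 * n) powr (d - (r + n)))) * (pi * d) powr (d - r)"
  have "C \<ge> 0" using \<open>0 \<le> C1\<close> \<open>0 \<le> C2\<close> by (simp add: C_def)
  moreover have "norm (fourier f x) \<le> C * A * norm x powr (r - d)"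
    if A: "A \<ge> 0" and f: "integrable lborel f" and sym: "\<forall>b\<in>Basis. symbol b 0 A N r f"
      and x: "x \<noteq> 0" for A f and x :: 'a
  proof -
    have [measurable]: "f \<in> borel_measurable borel"
      using borel_measurable_integrable[OF f] by simp
    obtain b where b: "b \<in> Basis" "norm x \<le> d * \<bar>x \<bullet> b\<bar>"
      using ex_large_coordinate[of x] by (auto simp: d_def)
    have xb: "\<bar>x \<bullet> b\<bar> > 0" using b(2) x by (auto simp: d_def)
    define \<tau> where "\<tau> = pi / (x \<bullet> b)"
    have \<tau>: "\<bar>\<tau>\<bar> \<le> pi * d / norm x"
    proof -
      have "0 < norm x" using x by auto
      then show ?thesis
        using mult_left_mono[OF b(2), of pi] xb by (simp add: \<tau>_def field_simps)
    qed
    have \<tau>0: "0 < \<bar>\<tau>\<bar>" using xb by (simp add: \<tau>_def)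
    have pi: "(\<tau> *\<^sub>R b) \<bullet> x = pi" using xb by (simp add: \<tau>_def inner_commute)
    let ?v = "\<tau> *\<^sub>R b"
    have nv: "norm ?v = \<bar>\<tau>\<bar>" using b by simp
    \<comment> \<open>Beyond this radius the segment swept by the differences has length n |\<tau>|
      \<le> |\<xi>| / 2, so it stays at distance at least |\<xi>| / 2 from the singularity at
      0.\<close>
    define S where "S = 2 * n * \<bar>\<tau>\<bar>"
    have S0: "0 < S" using \<tau>0 n by (simp add: S_def)
    let ?g = "fdiff N ?v f"
    have [measurable]: "?g \<in> borel_measurable borel"
      using borel_measurable_integrable[OF integrable_fdiff[OF f]] by simp
    have [measurable]: "ball 0 S \<in> sets (borel :: 'a measure)"
      "{x. S \<le> norm x} \<in> sets (borel :: 'a measure)" by auto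
    have "(\<integral>\<^sup>+\<xi>. ennreal (norm (?g \<xi>)) * indicator (ball 0 S) \<xi> \<partial>lborel)
        \<le> 2 ^ N * (\<integral>\<^sup>+\<xi>. ennreal (norm (f \<xi>)) * indicator (ball 0 (S + N * norm ?v)) \<xi> \<partial>lborel)"
      by (rule nn_integral_fdiff_ball[OF f])
    also have "S + N * norm ?v = 3 * n * \<bar>\<tau>\<bar>" using nv by (simp add: S_def n_def)
    also have "(\<integral>\<^sup>+\<xi>. ennreal (norm (f \<xi>)) * indicator (ball 0 (3 * n * \<bar>\<tau>\<bar>)) \<xi> \<partial>lborel)
        \<le> (\<integral>\<^sup>+\<xi>. ennreal A * (ennreal (norm (\<xi>::'a) powr - r) * indicator (ball 0 (3 * n * \<bar>\<tau>\<bar>)) \<xi>) \<partial>lborel)"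
    proof (rule nn_integral_mono_AE)
      have "AE \<xi> in lborel. \<xi> \<noteq> (0::'a)" by (rule AE_lborel_singleton)
      then show "AE \<xi> in lborel. ennreal (norm (f \<xi>)) * indicator (ball 0 (3 * n * \<bar>\<tau>\<bar>)) \<xi> \<le>
          ennreal A * (ennreal (norm \<xi> powr - r) * indicator (ball 0 (3 * n * \<bar>\<tau>\<bar>)) \<xi>)"
      proof eventually_elim
        case (elim \<xi>)
        have "norm (f \<xi>) \<le> A * norm \<xi> powr - r"
          using symbol_imp_bound[OF sym[rule_format, OF b(1)]] elim by (simp add: symbol_bound_def)
        then show ?case
          using A by (auto simp: indicator_def ennreal_mult[symmetric] intro!: ennreal_leI)
      qed
    qed
    also have "\<dots> = ennreal A * (\<integral>\<^sup>+\<xi>. ennreal (norm (\<xi>::'a) powr - r) * indicator (ball 0 (3 * n * \<bar>\<tau>\<bar>)) \<xi> \<partial>lborel)"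
      by (intro nn_integral_cmult borel_measurable_times_ennreal borel_measurable_indicator) auto
    also have "\<dots> \<le> ennreal A * ennreal (C1 * (3 * n * \<bar>\<tau>\<bar>) powr (d - r))"
      using C1 \<tau>0 n by (intro mult_left_mono) auto
    also have "\<dots> = ennreal (A * (C1 * (3 * n * \<bar>\<tau>\<bar>) powr (d - r)))"
      using A \<open>0 \<le> C1\<close> by (simp add: ennreal_mult)
    also have "2 ^ N * \<dots> = ennreal (2 ^ N * (A * (C1 * (3 * n * \<bar>\<tau>\<bar>) powr (d - r))))"
      by (simp only: ennreal_mult'[of "2 ^ N"] ennreal_power[symmetric] ennreal_numeral zero_le_numeral zero_le_power)
    finally have near: "(\<integral>\<^sup>+\<xi>. ennreal (norm (?g \<xi>)) * indicator (ball 0 S) \<xi> \<partial>lborel)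
        \<le> ennreal (2 ^ N * (A * (C1 * (3 * n * \<bar>\<tau>\<bar>) powr (d - r))))"
      by (simp add: mult_left_mono)
    have pt: "norm (?g \<xi>) \<le> \<bar>\<tau>\<bar> ^ N * (A * 2 powr (r + n)) * norm \<xi> powr - (r + n)" if \<xi>: "S \<le> norm \<xi>" for \<xi>
    proof -
      have xi0: "0 < norm \<xi>" using \<xi> S0 by linarith
      define U where "U = (\<lambda>s. \<xi> + (s * \<tau>) *\<^sub>R b) ` {0..n}"
      have U: "norm \<xi> / 2 \<le> norm y" if "y \<in> U" for y
      proof -
        obtain s where s: "0 \<le> s" "s \<le> n" "y = \<xi> + (s * \<tau>) *\<^sub>R b"
          using \<open>y \<in> U\<close> by (auto simp: U_def)
        have "norm ((s * \<tau>) *\<^sub>R b) = s * \<bar>\<tau>\<bar>" using s b by (simp add: abs_mult)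
        also have "\<dots> \<le> n * \<bar>\<tau>\<bar>" using s by (intro mult_right_mono) auto
        also have "\<dots> \<le> norm \<xi> / 2" using \<xi> by (simp add: S_def)
        finally have "norm ((s * \<tau>) *\<^sub>R b) \<le> norm \<xi> / 2" .
        moreover have "norm \<xi> \<le> norm y + norm ((s * \<tau>) *\<^sub>R b)"
          using norm_triangle_ineq4[of y "(s * \<tau>) *\<^sub>R b"] s by simp
        ultimately show ?thesis by linarith
      qed
      have "dchain U b (A * (norm \<xi> / 2) powr - (r + N)) N f"
        by (rule symbol_imp_dchain[OF sym[rule_format, OF b(1)] r(1) A _ U]) (use xi0 in auto)
      then have "norm (?g \<xi>) \<le> \<bar>\<tau>\<bar> ^ N * (A * (norm \<xi> / 2) powr - (r + N))"
        by (rule norm_fdiff_le) (auto simp: U_def n_def)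
      also have "(norm \<xi> / 2) powr - (r + N) = 2 powr (r + n) * norm \<xi> powr - (r + n)"
        using xi0 unfolding n_def[symmetric]
        by (subst powr_divide) (auto simp: powr_minus field_simps simp flip: powr_add)
      finally show ?thesis by (simp add: mult_ac)
    qed
    have "(\<integral>\<^sup>+\<xi>. ennreal (norm (?g \<xi>)) * indicator {\<xi>. S \<le> norm \<xi>} \<xi> \<partial>lborel) \<le>
       (\<integral>\<^sup>+\<xi>. ennreal (\<bar>\<tau>\<bar> ^ N * (A * 2 powr (r + n))) *
         (ennreal (norm (\<xi>::'a) powr - (r + n)) * indicator {\<xi>. S \<le> norm \<xi>} \<xi>) \<partial>lborel)"
      using pt A by (intro nn_integral_mono) (auto simp: indicator_def ennreal_mult[symmetric] simp del: minus_add_distrib intro!: ennreal_leI)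
    also have "\<dots> = ennreal (\<bar>\<tau>\<bar> ^ N * (A * 2 powr (r + n))) *
         (\<integral>\<^sup>+\<xi>. ennreal (norm (\<xi>::'a) powr - (r + n)) * indicator {\<xi>. S \<le> norm \<xi>} \<xi> \<partial>lborel)"
      by (intro nn_integral_cmult borel_measurable_times_ennreal borel_measurable_indicator) auto
    also have "\<dots> \<le> ennreal (\<bar>\<tau>\<bar> ^ N * (A * 2 powr (r + n))) * ennreal (C2 * S powr (d - (r + n)))"
      using C2 S0 by (intro mult_left_mono) auto
    also have "\<dots> = ennreal (\<bar>\<tau>\<bar> ^ N * (A * 2 powr (r + n)) * (C2 * S powr (d - (r + n))))"
      using A \<open>0 \<le> C2\<close> by (subst ennreal_mult) auto
    finally have far: "(\<integral>\<^sup>+\<xi>. ennreal (norm (?g \<xi>)) * indicator {\<xi>. S \<le> norm \<xi>} \<xi> \<partial>lborel)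
      \<le> ennreal (\<bar>\<tau>\<bar> ^ N * (A * 2 powr (r + n)) * (C2 * S powr (d - (r + n))))" .
    have "(\<integral>\<^sup>+\<xi>. ennreal (norm (?g \<xi>)) \<partial>lborel) =
      (\<integral>\<^sup>+\<xi>. ennreal (norm (?g \<xi>)) * indicator (ball 0 S) \<xi> + ennreal (norm (?g \<xi>)) * indicator {\<xi>. S \<le> norm \<xi>} \<xi> \<partial>lborel)"
      by (intro nn_integral_cong) (auto simp: indicator_def)
    also have "\<dots> = (\<integral>\<^sup>+\<xi>. ennreal (norm (?g \<xi>)) * indicator (ball 0 S) \<xi> \<partial>lborel) +
      (\<integral>\<^sup>+\<xi>. ennreal (norm (?g \<xi>)) * indicator {\<xi>. S \<le> norm \<xi>} \<xi> \<partial>lborel)"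
      by (rule nn_integral_add) measurable
    also have "\<dots> \<le> ennreal (2 ^ N * (A * (C1 * (3 * n * \<bar>\<tau>\<bar>) powr (d - r)))) +
      ennreal (\<bar>\<tau>\<bar> ^ N * (A * 2 powr (r + n)) * (C2 * S powr (d - (r + n))))"
      by (rule add_mono[OF near far])
    also have "\<dots> = ennreal (2 ^ N * (A * (C1 * (3 * n * \<bar>\<tau>\<bar>) powr (d - r))) +
      \<bar>\<tau>\<bar> ^ N * (A * 2 powr (r + n)) * (C2 * S powr (d - (r + n))))"
      using A \<open>0 \<le> C1\<close> \<open>0 \<le> C2\<close> by (intro ennreal_plus[symmetric]) auto
    also have "2 ^ N * (A * (C1 * (3 * n * \<bar>\<tau>\<bar>) powr (d - r))) +
      \<bar>\<tau>\<bar> ^ N * (A * 2 powr (r + n)) * (C2 * S powr (d - (r + n))) =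
      A * ((2 ^ N * (C1 * (3 * n) powr (d - r)) +
       2 powr (r + n) * (C2 * (2 * n) powr (d - (r + n)))) * \<bar>\<tau>\<bar> powr (d - r))"
    proof -
      have 1: "(3 * n * \<bar>\<tau>\<bar>) powr (d - r) = (3 * n) powr (d - r) * \<bar>\<tau>\<bar> powr (d - r)"
        using n by (simp add: powr_mult)
      have 2: "\<bar>\<tau>\<bar> ^ N * S powr (d - (r + n)) = (2 * n) powr (d - (r + n)) * \<bar>\<tau>\<bar> powr (d - r)"
      proof -
        have "\<bar>\<tau>\<bar> ^ N = \<bar>\<tau>\<bar> powr n" using \<tau>0 by (simp add: n_def powr_realpow)
        moreover have "S powr (d - (r + n)) = (2 * n) powr (d - (r + n)) * \<bar>\<tau>\<bar> powr (d - (r + n))"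
          using n by (simp add: S_def powr_mult)
        ultimately show ?thesis by (simp add: powr_add[symmetric])
      qed
      have "\<bar>\<tau>\<bar> ^ N * (A * 2 powr (r + n)) * (C2 * S powr (d - (r + n))) =
        A * 2 powr (r + n) * C2 * (\<bar>\<tau>\<bar> ^ N * S powr (d - (r + n)))" by (simp add: mult_ac)
      then show ?thesis unfolding 1 2 by (simp add: algebra_simps)
    qed
    finally have "(\<integral>\<^sup>+\<xi>. ennreal (norm (?g \<xi>)) \<partial>lborel) \<le> ennreal (A * ((2 ^ N * (C1 * (3 * n) powr (d - r)) +
       2 powr (r + n) * (C2 * (2 * n) powr (d - (r + n)))) * \<bar>\<tau>\<bar> powr (d - r)))" .
    then have "(\<integral>\<xi>. norm (?g \<xi>) \<partial>lborel) \<le> A * ((2 ^ N * (C1 * (3 * n) powr (d - r)) +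
       2 powr (r + n) * (C2 * (2 * n) powr (d - (r + n)))) * \<bar>\<tau>\<bar> powr (d - r))"
      using A \<open>0 \<le> C1\<close> \<open>0 \<le> C2\<close> 
      by (subst integral_eq_nn_integral) (auto intro!: enn2real_leI)
    moreover have "norm (fourier f x) \<le> 2 ^ N * norm (fourier f x)"
      by (simp add: mult_le_cancel_right1)
    moreover have "\<dots> \<le> (\<integral>\<xi>. norm (?g \<xi>) \<partial>lborel)"
      by (rule fourier_fdiff_pi[OF f pi])
    ultimately have "norm (fourier f x) \<le> A * ((2 ^ N * (C1 * (3 * n) powr (d - r)) +
       2 powr (r + n) * (C2 * (2 * n) powr (d - (r + n)))) * \<bar>\<tau>\<bar> powr (d - r))" by linarith
    also have "\<dots> \<le> A * ((2 ^ N * (C1 * (3 * n) powr (d - r)) +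
       2 powr (r + n) * (C2 * (2 * n) powr (d - (r + n)))) * (pi * d / norm x) powr (d - r))"
      using \<tau> r A \<open>0 \<le> C1\<close> \<open>0 \<le> C2\<close>
      by (intro mult_left_mono powr_mono2) (auto simp: d_def)
    also have "(pi * d / norm x) powr (d - r) = (pi * d) powr (d - r) * norm x powr (r - d)"
      using x n by (subst powr_divide) (auto simp: powr_diff)
    finally show ?thesis
      unfolding C_def by (simp only: mult_ac)
  qed
  ultimately show ?thesis unfolding d_def N_def by blast
qed

section \<open>Calculus of symbols\<close>

lemma symbol_SucI:
  assumes "symbol_bound s A t f" "symbol b s A k (t + 1) f'"
    and "\<And>\<xi>. \<xi> \<noteq> 0 \<Longrightarrow> ((\<lambda>\<tau>. f (\<xi> + \<tau> *\<^sub>R b)) has_vector_derivative f' \<xi>) (at 0)"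
  shows "symbol b s A (Suc k) t f"
  using assms by auto

lemma symbol_bound_mono: "symbol_bound s A t f \<Longrightarrow> A \<le> B \<Longrightarrow> symbol_bound s B t f"
  unfolding symbol_bound_def
  by (meson mult_right_mono order_trans powr_ge_zero)

lemma symbol_mono: "symbol b s A k t f \<Longrightarrow> A \<le> B \<Longrightarrow> symbol b s B k t f"
proof (induction k arbitrary: t f)
  case (Suc k)
  then show ?case by (auto intro: symbol_bound_mono)
qed (auto intro: symbol_bound_mono)

lemma symbol_Suc_imp: "symbol b s A (Suc k) t f \<Longrightarrow> symbol b s A k t f"
proof (induction k arbitrary: t f)
  case (Suc k)
  then obtain f' where "\<forall>\<xi>. \<xi> \<noteq> 0 \<longrightarrow> ((\<lambda>\<tau>. f (\<xi> + \<tau> *\<^sub>R b)) has_vector_derivative f' \<xi>) (at 0)"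
    and "symbol b s A (Suc k) (t + 1) f'" "symbol_bound s A t f" by auto
  then show ?case using Suc.IH[of "t + 1" f'] by auto
qed simp

text \<open>A comparison of the weights alone carries over to every derivative, because all orders
  share the same weight up to their own power of |\<xi>|.\<close>

lemma symbol_reweight:
  fixes f :: "'a::euclidean_space \<Rightarrow> complex"
  assumes le: "\<And>\<xi>::'a. \<xi> \<noteq> 0 \<Longrightarrow> \<langle>\<xi>\<rangle> powr s \<le> D * \<langle>\<xi>\<rangle> powr s' * norm \<xi> powr - c"
    and "0 \<le> A"
  shows "symbol b s A k t f \<Longrightarrow> symbol b s' (A * D) k (t + c) f"
proof -
  have *: "symbol_bound s' (A * D) (t + c) f" if "symbol_bound s A t f" for t and f :: "'a \<Rightarrow> complex"
    unfolding symbol_bound_def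
  proof (intro conjI allI impI)
    show "continuous_on (- {0}) f" using that by (simp add: symbol_bound_def)
    fix \<xi> :: 'a assume "\<xi> \<noteq> 0"
    then have "norm (f \<xi>) \<le> A * \<langle>\<xi>\<rangle> powr s * norm \<xi> powr - t"
      using that by (simp add: symbol_bound_def)
    also have "\<dots> \<le> A * (D * \<langle>\<xi>\<rangle> powr s' * norm \<xi> powr - c) * norm \<xi> powr - t"
      using le[OF \<open>\<xi> \<noteq> 0\<close>] \<open>0 \<le> A\<close> by (intro mult_right_mono mult_left_mono) auto
    also have "\<dots> = A * D * \<langle>\<xi>\<rangle> powr s' * norm \<xi> powr - (t + c)"
      by (simp add: powr_add[symmetric] mult.assoc add.commute)
    finally show "norm (f \<xi>) \<le> A * D * \<langle>\<xi>\<rangle> powr s' * norm \<xi> powr - (t + c)" .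
  qed
  show "symbol b s A k t f \<Longrightarrow> symbol b s' (A * D) k (t + c) f"
  proof (induction k arbitrary: t f)
    case (Suc k)
    then obtain f' where f': "\<forall>\<xi>. \<xi> \<noteq> 0 \<longrightarrow> ((\<lambda>\<tau>. f (\<xi> + \<tau> *\<^sub>R b)) has_vector_derivative f' \<xi>) (at 0)"
      and s: "symbol b s A k (t + 1) f'" and b: "symbol_bound s A t f" by auto
    have "symbol b s' (A * D) k (t + c + 1) f'"
      using Suc.IH[OF s] by (simp add: algebra_simps)
    then show ?case using f' *[OF b] by auto
  qed (auto intro: *)
qed

lemma symbol_bound_zero: "0 \<le> A \<Longrightarrow> symbol_bound s A t (\<lambda>_. 0)"
  by (simp add: symbol_bound_def)

lemma symbol_zero: "0 \<le> A \<Longrightarrow> symbol b s A k t (\<lambda>_. 0)"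
proof (induction k arbitrary: t)
  case (Suc k)
  then show ?case by (auto simp: symbol_bound_zero intro!: exI[of _ "\<lambda>_. 0"])
qed (simp add: symbol_bound_zero)

lemma symbol_const: "symbol b 0 (norm c) k 0 (\<lambda>_. c)"
proof -
  have "symbol_bound 0 (norm c) 0 (\<lambda>_::'a. c)" by (simp add: symbol_bound_def)
  then show ?thesis
    by (cases k) (auto intro!: exI[of _ "\<lambda>_. 0"] symbol_zero)
qed

lemma symbol_bound_add:
  assumes "symbol_bound s A t f" "symbol_bound s B t g"
  shows "symbol_bound s (A + B) t (\<lambda>\<xi>. f \<xi> + g \<xi>)"
  unfolding symbol_bound_def
proof (intro conjI allI impI)
  show "continuous_on (- {0}) (\<lambda>\<xi>. f \<xi> + g \<xi>)"
    using assms by (auto simp: symbol_bound_def intro!: continuous_intros)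
  fix \<xi> :: 'a assume "\<xi> \<noteq> 0"
  then have "norm (f \<xi>) \<le> A * \<langle>\<xi>\<rangle> powr s * norm \<xi> powr - t" "norm (g \<xi>) \<le> B * \<langle>\<xi>\<rangle> powr s * norm \<xi> powr - t"
    using assms by (auto simp: symbol_bound_def)
  then show "norm (f \<xi> + g \<xi>) \<le> (A + B) * \<langle>\<xi>\<rangle> powr s * norm \<xi> powr - t"
    using norm_triangle_ineq[of "f \<xi>" "g \<xi>"] by (simp add: algebra_simps)
qed

lemma symbol_add: "symbol b s A k t f \<Longrightarrow> symbol b s B k t g \<Longrightarrow> symbol b s (A + B) k t (\<lambda>\<xi>. f \<xi> + g \<xi>)"
proof (induction k arbitrary: t f g)
  case 0
  then show ?case by (simp add: symbol_bound_add)
next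
  case (Suc k)
  then obtain f' where f': "\<forall>\<xi>. \<xi> \<noteq> 0 \<longrightarrow> ((\<lambda>\<tau>. f (\<xi> + \<tau> *\<^sub>R b)) has_vector_derivative f' \<xi>) (at 0)"
    and sf: "symbol b s A k (t + 1) f'" by auto
  from Suc obtain g' where g': "\<forall>\<xi>. \<xi> \<noteq> 0 \<longrightarrow> ((\<lambda>\<tau>. g (\<xi> + \<tau> *\<^sub>R b)) has_vector_derivative g' \<xi>) (at 0)"
    and sg: "symbol b s B k (t + 1) g'" by auto
  show ?case
    by (rule symbol_SucI[OF symbol_bound_add Suc.IH[OF sf sg]])
      (use Suc.prems f' g' in \<open>auto intro!: derivative_intros\<close>)
qed

text \<open>Leibniz rule in one direction: each order doubles the number of terms, whence
  \<open>2 ^ k\<close>.\<close>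

lemma symbol_mult:
  assumes "0 \<le> A" "0 \<le> B"
  shows "symbol b s A k t f \<Longrightarrow> symbol b s' B k t' g \<Longrightarrow>
    symbol b (s + s') (2 ^ k * A * B) k (t + t') (\<lambda>\<xi>. f \<xi> * g \<xi>)"
proof (induction k arbitrary: t t' f g)
  case 0
  have "symbol_bound (s + s') (A * B) (t + t') (\<lambda>\<xi>. f \<xi> * g \<xi>)"
    unfolding symbol_bound_def
  proof (intro conjI allI impI)
    show "continuous_on (- {0}) (\<lambda>\<xi>. f \<xi> * g \<xi>)"
      using 0 by (auto simp: symbol_bound_def intro!: continuous_intros)
    fix \<xi> :: 'a assume "\<xi> \<noteq> 0"
    then have "norm (f \<xi>) \<le> A * \<langle>\<xi>\<rangle> powr s * norm \<xi> powr - t" "norm (g \<xi>) \<le> B * \<langle>\<xi>\<rangle> powr s' * norm \<xi> powr - t'"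
      using 0 by (auto simp: symbol_bound_def)
    then have "norm (f \<xi> * g \<xi>) \<le> (A * \<langle>\<xi>\<rangle> powr s * norm \<xi> powr - t) * (B * \<langle>\<xi>\<rangle> powr s' * norm \<xi> powr - t')"
      unfolding norm_mult by (intro mult_mono) (auto simp: assms)
    also have "\<dots> = A * B * \<langle>\<xi>\<rangle> powr (s + s') * norm \<xi> powr - (t + t')"
      by (simp add: powr_add powr_diff powr_minus divide_inverse mult_ac)
    finally show "norm (f \<xi> * g \<xi>) \<le> A * B * \<langle>\<xi>\<rangle> powr (s + s') * norm \<xi> powr - (t + t')" .
  qed
  then show ?case by simp
next
  case (Suc k)
  then obtain f' where f': "\<forall>\<xi>. \<xi> \<noteq> 0 \<longrightarrow> ((\<lambda>\<tau>. f (\<xi> + \<tau> *\<^sub>R b)) has_vector_derivative f' \<xi>) (at 0)"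
    and sf: "symbol b s A k (t + 1) f'" by auto
  from Suc obtain g' where g': "\<forall>\<xi>. \<xi> \<noteq> 0 \<longrightarrow> ((\<lambda>\<tau>. g (\<xi> + \<tau> *\<^sub>R b)) has_vector_derivative g' \<xi>) (at 0)"
    and sg: "symbol b s' B k (t' + 1) g'" by auto
  have fk: "symbol b s A k t f" and gk: "symbol b s' B k t' g"
    using Suc.prems symbol_Suc_imp by blast+
  have le: "2 ^ k * A * B \<le> 2 ^ Suc k * A * B"
    using assms by (intro mult_right_mono) auto
  have 1: "symbol_bound (s + s') (2 ^ Suc k * A * B) (t + t') (\<lambda>\<xi>. f \<xi> * g \<xi>)"
    using symbol_bound_mono[OF symbol_imp_bound[OF Suc.IH[OF fk gk]] le] .
  have "symbol b (s + s') (2 ^ k * A * B) k (t + t' + 1) (\<lambda>\<xi>. f \<xi> * g' \<xi>)"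
    using Suc.IH[OF fk sg] by (simp add: algebra_simps)
  moreover have "symbol b (s + s') (2 ^ k * A * B) k (t + t' + 1) (\<lambda>\<xi>. f' \<xi> * g \<xi>)"
    using Suc.IH[OF sf gk] by (simp add: algebra_simps)
  ultimately have "symbol b (s + s') (2 ^ k * A * B + 2 ^ k * A * B) k (t + t' + 1) (\<lambda>\<xi>. f \<xi> * g' \<xi> + f' \<xi> * g \<xi>)"
    by (rule symbol_add)
  then have 2: "symbol b (s + s') (2 ^ Suc k * A * B) k (t + t' + 1) (\<lambda>\<xi>. f \<xi> * g' \<xi> + f' \<xi> * g \<xi>)"
    by (simp add: algebra_simps)
  have "((\<lambda>\<tau>. f (\<xi> + \<tau> *\<^sub>R b) * g (\<xi> + \<tau> *\<^sub>R b)) has_vector_derivative f \<xi> * g' \<xi> + f' \<xi> * g \<xi>) (at 0)"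
    if "\<xi> \<noteq> 0" for \<xi>
    using has_vector_derivative_mult[OF f'[rule_format, OF that] g'[rule_format, OF that]] by simp
  then show ?case by (rule symbol_SucI[OF 1 2])
qed

text \<open>The derivative of q = 1/p is -p' q q, in which q is undifferentiated: symbol bounds of
  order k for q give those of order k + 1. The lower bound on |p| is the case of order 0.\<close>

lemma symbol_inverse:
  assumes C: "0 < C" and lower: "\<And>\<xi>. \<xi> \<noteq> 0 \<Longrightarrow> C * \<langle>\<xi>\<rangle> powr M \<le> norm (p \<xi>)" and A: "0 \<le> A"
  shows "symbol b M A k 0 p \<Longrightarrow> \<exists>B\<ge>0. symbol b (- M) B k 0 (\<lambda>\<xi>. inverse (p \<xi>))"
proof (induction k)
  have nz: "p \<xi> \<noteq> 0" if "\<xi> \<noteq> 0" for \<xi>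
    using lower[OF that] C by (smt (verit) japanese_neq_0 mult_pos_pos norm_zero powr_gt_zero)
  have sb: "symbol_bound (- M) (1 / C) 0 (\<lambda>\<xi>. inverse (p \<xi>))" if "symbol_bound M A 0 p"
    unfolding symbol_bound_def
  proof (intro conjI allI impI)
    show "continuous_on (- {0}) (\<lambda>\<xi>. inverse (p \<xi>))"
      using that nz by (auto simp: symbol_bound_def intro!: continuous_intros)
    fix \<xi> :: 'a assume \<xi>: "\<xi> \<noteq> 0"
    have "0 < C * \<langle>\<xi>\<rangle> powr M" using C by simp
    then have "inverse (norm (p \<xi>)) \<le> inverse (C * \<langle>\<xi>\<rangle> powr M)"
      by (rule le_imp_inverse_le[OF lower[OF \<xi>]])
    then show "norm (inverse (p \<xi>)) \<le> 1 / C * \<langle>\<xi>\<rangle> powr - M * norm \<xi> powr - 0"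
      using \<xi> by (simp add: norm_inverse powr_minus divide_inverse mult.commute)
  qed
  {
    case 0
    then show ?case using sb C by (auto intro!: exI[of _ "1 / C"])
  next
    case (Suc k)
    then obtain B where B: "0 \<le> B" "symbol b (- M) B k 0 (\<lambda>\<xi>. inverse (p \<xi>))"
      using symbol_Suc_imp by blast
    from Suc obtain p' where p': "\<forall>\<xi>. \<xi> \<noteq> 0 \<longrightarrow> ((\<lambda>\<tau>. p (\<xi> + \<tau> *\<^sub>R b)) has_vector_derivative p' \<xi>) (at 0)"
      and sp: "symbol b M A k (0 + 1) p'" and bp: "symbol_bound M A 0 p" by auto
    let ?q = "\<lambda>\<xi>. inverse (p \<xi>)"
    \<comment> \<open>The factor -1 counts as a constant symbol, and every product pays 2^k by
      \<open>symbol_mult\<close>; the weights M, -M, -M add up to -M.\<close>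
    define B1 where "B1 = 2 ^ k * norm (- 1 :: complex) * A"
    define B2 where "B2 = 2 ^ k * B1 * B"
    define B3 where "B3 = 2 ^ k * B2 * B"
    have B1: "0 \<le> B1" "symbol b (0 + M) B1 k (0 + (0 + 1)) (\<lambda>\<xi>. - 1 * p' \<xi>)"
      unfolding B1_def by (use A in simp, rule symbol_mult[OF _ A symbol_const sp], simp)
    have B2: "0 \<le> B2" "symbol b (0 + M + - M) B2 k (0 + (0 + 1) + 0) (\<lambda>\<xi>. - 1 * p' \<xi> * ?q \<xi>)"
      unfolding B2_def by (use B B1 in simp, rule symbol_mult[OF B1(1) B(1) B1(2) B(2)])
    have B3: "0 \<le> B3" "symbol b (0 + M + - M + - M) B3 k (0 + (0 + 1) + 0 + 0) (\<lambda>\<xi>. - 1 * p' \<xi> * ?q \<xi> * ?q \<xi>)"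
      unfolding B3_def by (use B B2 in simp, rule symbol_mult[OF B2(1) B(1) B2(2) B(2)])
    define E where "E = max (1 / C) B3"
    have E: "0 \<le> E" "1 / C \<le> E" "B3 \<le> E" using B3 by (auto simp: E_def)
    have "symbol_bound (- M) E 0 ?q" by (rule symbol_bound_mono[OF sb[OF bp] E(2)])
    moreover have "symbol b (- M) E k (0 + 1) (\<lambda>\<xi>. - 1 * p' \<xi> * ?q \<xi> * ?q \<xi>)"
      using symbol_mono[OF B3(2) E(3)] by simp
    moreover have "((\<lambda>\<tau>. ?q (\<xi> + \<tau> *\<^sub>R b)) has_vector_derivative - 1 * p' \<xi> * ?q \<xi> * ?q \<xi>) (at 0)"
      if "\<xi> \<noteq> 0" for \<xi>
    proof -
      have d: "(inverse has_field_derivative - (inverse (p \<xi>) * inverse (p \<xi>))) (at (p (\<xi> + 0 *\<^sub>R b)))"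
        using DERIV_inverse'[OF DERIV_ident nz[OF that]] by simp
      show ?thesis
        using field_vector_diff_chain_at[OF p'[rule_format, OF that] d] by (simp add: o_def mult_ac)
    qed
    ultimately have "symbol b (- M) E (Suc k) 0 ?q" by (rule symbol_SucI)
    then show ?case using E by blast
  }
qed

lemma symbol_sum:
  assumes "finite J" "\<And>j. j \<in> J \<Longrightarrow> \<exists>A\<ge>0. symbol b s A k t (f j)"
  shows "\<exists>A\<ge>0. symbol b s A k t (\<lambda>\<xi>. \<Sum>j\<in>J. f j \<xi>)"
  using assms
proof (induction J)
  case empty
  show ?case by (auto intro!: exI[of _ 0] symbol_zero)
next
  case (insert j J)
  obtain A where "0 \<le> A" "symbol b s A k t (\<lambda>\<xi>. \<Sum>j\<in>J. f j \<xi>)"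
    using insert.IH insert.prems by auto
  moreover obtain B where "0 \<le> B" "symbol b s B k t (f j)" using insert.prems by auto
  ultimately have "symbol b s (B + A) k t (\<lambda>\<xi>. \<Sum>j\<in>insert j J. f j \<xi>)" "0 \<le> B + A"
    using symbol_add[of b s B k t "f j" A] insert.hyps by auto
  then show ?case by blast
qed

text \<open>Finiteness of \<open>Basis\<close> merges the constants of the directions. Uniformity
  over the index set, which may be infinite, has to hold already in each direction.\<close>

lemma symbol_uniform_Basis:
  assumes "\<And>b. b \<in> Basis \<Longrightarrow> \<exists>A. \<forall>i\<in>I. symbol b s A k t (f i)"
  shows "\<exists>A\<ge>0. \<forall>b\<in>Basis. \<forall>i\<in>I. symbol b s A k t (f i :: 'a::euclidean_space \<Rightarrow> complex)"
proof -
  obtain A where A: "\<And>b i. b \<in> Basis \<Longrightarrow> i \<in> I \<Longrightarrow> symbol b s (A b) k t (f i)"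
    using assms by metis
  define B where "B = Max (insert 0 (A ` Basis))"
  have "symbol b s B k t (f i)" if "b \<in> Basis" "i \<in> I" for b i
    by (rule symbol_mono[OF A[OF that]])
      (use that in \<open>auto simp: B_def le_max_iff_disj intro!: disjI2 Max_ge\<close>)
  moreover have "0 \<le> B" by (simp add: B_def)
  ultimately show ?thesis by blast
qed

section \<open>From smooth and homogeneous functions to symbols\<close>

lemma has_vector_derivative_frechet:
  assumes "f differentiable (at \<xi>)"
  shows "((\<lambda>\<tau>. f (\<xi> + \<tau> *\<^sub>R b)) has_vector_derivative frechet_derivative f (at \<xi>) b) (at 0)"
proof -
  let ?L = "frechet_derivative f (at \<xi>)"
  have f: "(f has_derivative ?L) (at (\<xi> + 0 *\<^sub>R b))"
    using assms by (simp add: frechet_derivative_works)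
  have "((\<lambda>\<tau>. \<xi> + \<tau> *\<^sub>R b) has_derivative (\<lambda>\<tau>. \<tau> *\<^sub>R b)) (at 0)"
    by (auto intro!: derivative_eq_intros)
  from has_derivative_compose[OF this f]
  have "((\<lambda>\<tau>. f (\<xi> + \<tau> *\<^sub>R b)) has_derivative (\<lambda>\<tau>. ?L (\<tau> *\<^sub>R b))) (at 0)" .
  moreover have "?L (\<tau> *\<^sub>R b) = \<tau> *\<^sub>R ?L b" for \<tau>
    using assms linear_frechet_derivative linear_scale by blast
  ultimately show ?thesis by (simp add: has_vector_derivative_def)
qed

lemma Ck_on_imp_continuous_on: "Ck_on k S f \<Longrightarrow> continuous_on S f"
  by (cases k) (auto intro!: continuous_at_imp_continuous_on differentiable_imp_continuous_within)

lemma eventually_line_ne_0: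
  fixes \<xi> :: "'a::euclidean_space"
  assumes "\<xi> \<noteq> 0"
  shows "\<forall>\<^sub>F \<tau> in nhds 0. \<xi> + \<tau> *\<^sub>R b \<noteq> 0"
proof -
  have "((\<lambda>\<tau>. \<xi> + \<tau> *\<^sub>R b) \<longlongrightarrow> \<xi> + 0 *\<^sub>R b) (nhds 0)"
    by (intro tendsto_intros filterlim_ident)
  then show ?thesis using assms by (intro tendsto_imp_eventually_ne) auto
qed

text \<open>A derivative of a function homogeneous of degree r is homogeneous of degree r - 1, and
  at every order a homogeneous function is controlled by its maximum on the unit sphere.\<close>

lemma pos_homogeneous_symbol:
  "Ck_on k (- {0}) f \<Longrightarrow> pos_homogeneous r f \<Longrightarrow> b \<in> Basis \<Longrightarrow> \<exists>A. symbol b 0 A k (- r) f"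
proof (induction k arbitrary: f r)
  have *: "\<exists>A. symbol_bound 0 A (- r) f" if "continuous_on (- {0}) f" "pos_homogeneous r f"
    for r and f :: "'a \<Rightarrow> complex"
  proof -
    have "compact (f ` sphere 0 1)"
      by (rule compact_continuous_image[OF continuous_on_subset[OF that(1)]]) auto
    then have "bounded (f ` sphere 0 1)" by (rule compact_imp_bounded)
    then obtain A where "\<forall>y\<in>f ` sphere 0 1. norm y \<le> A" by (auto simp only: bounded_iff)
    then have A: "norm (f \<xi>) \<le> A" if "norm \<xi> = 1" for \<xi> using that by auto
    have "norm (f \<xi>) \<le> A * norm \<xi> powr r" if "\<xi> \<noteq> 0" for \<xi>
    proof -
      have "f \<xi> = f (norm \<xi> *\<^sub>R (\<xi> /\<^sub>R norm \<xi>))" using that by simp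
      also have "\<dots> = complex_of_real (norm \<xi> powr r) * f (\<xi> /\<^sub>R norm \<xi>)"
        using \<open>pos_homogeneous r f\<close> that unfolding pos_homogeneous_def
        by (metis norm_eq_zero scaleR_eq_0_iff inverse_eq_iff_eq inverse_zero zero_less_norm_iff)
      finally have "norm (f \<xi>) = norm \<xi> powr r * norm (f (\<xi> /\<^sub>R norm \<xi>))"
        by (metis abs_of_nonneg norm_mult norm_of_real powr_ge_zero)
      also have "\<dots> \<le> norm \<xi> powr r * A"
        using A[of "\<xi> /\<^sub>R norm \<xi>"] that by (intro mult_left_mono) auto
      finally show ?thesis by (simp add: mult.commute)
    qed
    then show ?thesis using that(1) by (auto simp: symbol_bound_def intro!: exI[of _ A])
  qed
  {
    case 0
    then show ?case using *[of f r] by simp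
  next
    case (Suc k)
    let ?f' = "\<lambda>x. frechet_derivative f (at x) b"
    have diff: "f differentiable (at \<xi>)" if "\<xi> \<noteq> 0" for \<xi>
      using Suc.prems that by auto
    have "pos_homogeneous (r - 1) ?f'"
      unfolding pos_homogeneous_def
    proof (intro allI impI)
      fix t :: real and \<xi> :: 'a assume t: "0 < t" and \<xi>: "\<xi> \<noteq> 0"
      \<comment> \<open>The function f (t (\<xi> + \<tau> b)) of \<tau> is differentiated in two
        ways: by the chain rule, and after pulling out t^r by homogeneity, which is valid for small
        \<tau> since the line then avoids 0. Uniqueness of derivatives compares the results.\<close>
      have "((\<lambda>\<tau>. f (t *\<^sub>R \<xi> + \<tau> *\<^sub>R (t *\<^sub>R b))) has_vector_derivative t *\<^sub>R ?f' (t *\<^sub>R \<xi>)) (at 0)"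
        by (intro has_vector_derivative_scale_dir has_vector_derivative_frechet diff) (use t \<xi> in auto)
      then have 1: "((\<lambda>\<tau>. f (t *\<^sub>R (\<xi> + \<tau> *\<^sub>R b))) has_vector_derivative t *\<^sub>R ?f' (t *\<^sub>R \<xi>)) (at 0)"
        by (simp add: scaleR_add_right mult.commute)
      have 2: "((\<lambda>\<tau>. complex_of_real (t powr r) * f (\<xi> + \<tau> *\<^sub>R b)) has_vector_derivative
          complex_of_real (t powr r) * ?f' \<xi>) (at 0)"
        by (intro has_vector_derivative_mult_right has_vector_derivative_frechet diff \<xi>)
      have "\<forall>\<^sub>F \<tau> in nhds 0. \<xi> + \<tau> *\<^sub>R b \<noteq> 0" by (rule eventually_line_ne_0[OF \<xi>])
      then have ev: "\<forall>\<^sub>F \<tau> in nhds 0. complex_of_real (t powr r) * f (\<xi> + \<tau> *\<^sub>R b) = f (t *\<^sub>R (\<xi> + \<tau> *\<^sub>R b))"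
        by eventually_elim (use Suc.prems(2) t in \<open>auto simp: pos_homogeneous_def\<close>)
      have "((\<lambda>\<tau>. f (t *\<^sub>R (\<xi> + \<tau> *\<^sub>R b))) has_vector_derivative complex_of_real (t powr r) * ?f' \<xi>) (at 0)"
        using 2 by (rule has_vector_derivative_cong_ev[THEN iffD1, rotated 2])
          (use ev eventually_nhds_x_imp_x[OF ev] in \<open>auto elim: eventually_mono\<close>)
      from vector_derivative_unique_at[OF 1 this]
      have "complex_of_real t * ?f' (t *\<^sub>R \<xi>) = complex_of_real (t powr r) * ?f' \<xi>"
        by (simp add: scaleR_conv_of_real)
      then show "?f' (t *\<^sub>R \<xi>) = complex_of_real (t powr (r - 1)) * ?f' \<xi>"
        using t by (simp add: powr_diff field_simps)
    qed
    moreover have "Ck_on k (- {0}) ?f'" using Suc.prems by auto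
    ultimately obtain A where A: "symbol b 0 A k (- (r - 1)) ?f'"
      using Suc.IH[OF _ _ Suc.prems(3)] by blast
    obtain B where B: "symbol_bound 0 B (- r) f"
      using *[OF Ck_on_imp_continuous_on[OF Suc.prems(1)] Suc.prems(2)] by blast
    have "symbol b 0 (max A B) k (- r + 1) ?f'" using symbol_mono[OF A, of "max A B"] by simp
    moreover have "symbol_bound 0 (max A B) (- r) f" by (rule symbol_bound_mono[OF B]) simp
    ultimately show ?case
      using has_vector_derivative_frechet[OF diff] by (auto intro!: exI[of _ ?f'])
  }
qed

lemma test_function_support:
  assumes "test_function f"
  shows "\<exists>R>0. \<forall>\<xi>. R < norm \<xi> \<longrightarrow> f \<xi> = 0"
proof -
  have "bounded (closure {x. f x \<noteq> 0})"
    using assms compact_imp_bounded by (auto simp: test_function_def)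
  then have "bounded {x. f x \<noteq> 0}" using bounded_subset closure_subset by blast
  then obtain R where "R > 0" "\<forall>x\<in>{x. f x \<noteq> 0}. norm x \<le> R" by (auto simp: bounded_pos)
  then show ?thesis by (intro exI[of _ R]) force
qed

lemma bounded_continuous_support:
  fixes f :: "'a::euclidean_space \<Rightarrow> complex"
  assumes "continuous_on UNIV f" "\<And>\<xi>. R < norm \<xi> \<Longrightarrow> f \<xi> = 0"
  shows "\<exists>B\<ge>0. \<forall>\<xi>. norm (f \<xi>) \<le> B"
proof -
  have "compact (f ` cball 0 R)"
    by (rule compact_continuous_image[OF continuous_on_subset[OF assms(1)]]) auto
  then have "bounded (f ` cball 0 R)" by (rule compact_imp_bounded)
  then obtain B where B: "\<forall>y\<in>f ` cball 0 R. norm y \<le> B" by (auto simp only: bounded_iff)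
  have "norm (f \<xi>) \<le> \<bar>B\<bar>" for \<xi>
  proof (cases "norm \<xi> \<le> R")
    case True
    then have "norm (f \<xi>) \<le> B" using B by auto
    then show ?thesis by linarith
  qed (use assms(2) in auto)
  then show ?thesis by (intro exI[of _ "\<bar>B\<bar>"]) auto
qed

lemma frechet_derivative_support:
  fixes f :: "'a::euclidean_space \<Rightarrow> complex"
  assumes "\<And>\<xi>. R < norm \<xi> \<Longrightarrow> f \<xi> = 0" "R < norm \<xi>"
  shows "frechet_derivative f (at \<xi>) b = 0"
proof -
  have "open {x::'a. R < norm x}" by (intro open_Collect_less continuous_intros)
  then have "(f has_derivative (\<lambda>_. 0)) (at \<xi>)"
    by (rule has_derivative_transform_within_open[of "\<lambda>_. 0", rotated])
      (use assms in auto)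
  then show ?thesis using frechet_derivative_at by metis
qed

lemma Ck_imp_dchain:
  assumes "Ck_on k UNIV f" "\<And>\<xi>. R < norm \<xi> \<Longrightarrow> f \<xi> = 0" "b \<in> Basis"
  shows "\<exists>B. dchain UNIV b B k f"
  using assms
proof (induction k arbitrary: f)
  case 0
  then show ?case using bounded_continuous_support[of f R] by auto
next
  case (Suc k)
  obtain B where "dchain UNIV b B k (\<lambda>x. frechet_derivative f (at x) b)"
    using Suc.IH[of "\<lambda>x. frechet_derivative f (at x) b"] Suc.prems
      frechet_derivative_support[of R f _ b] by auto
  then show ?case using Suc.prems has_vector_derivative_frechet[of f _ b]
    by (auto intro!: exI[of _ B] exI[of _ "\<lambda>x. frechet_derivative f (at x) b"])
qed

text \<open>The power of \<open>l\<close> is what the chain rule produces in the induction; \<open>t = 0\<close> is the case of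
  interest.\<close>

lemma scaled_symbol:
  assumes "Ck_on k UNIV f" "0 < R" "\<And>\<xi>. R < norm \<xi> \<Longrightarrow> f \<xi> = 0" "b \<in> Basis" "0 \<le> t"
  shows "\<exists>A. \<forall>l>0. symbol b 0 A k t (\<lambda>\<xi>. complex_of_real (l powr t) * f (l *\<^sub>R \<xi>))"
  using assms
proof (induction k arbitrary: f t)
  have *: "\<exists>A\<ge>0. \<forall>l>0. symbol_bound 0 A t (\<lambda>\<xi>. complex_of_real (l powr t) * f (l *\<^sub>R \<xi>))"
    if f: "continuous_on UNIV f" "\<And>\<xi>. R < norm \<xi> \<Longrightarrow> f \<xi> = 0" and t: "0 \<le> t"
    for t and f :: "'a \<Rightarrow> complex"
  proof -
    obtain B where B: "0 \<le> B" "\<And>\<xi>. norm (f \<xi>) \<le> B"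
      using bounded_continuous_support[OF f] by blast
    have "symbol_bound 0 (B * R powr t) t (\<lambda>\<xi>. complex_of_real (l powr t) * f (l *\<^sub>R \<xi>))"
      if l: "l > 0" for l :: real
      unfolding symbol_bound_def
    proof (intro conjI allI impI)
      show "continuous_on (- {0}) (\<lambda>\<xi>. complex_of_real (l powr t) * f (l *\<^sub>R \<xi>))"
        by (intro continuous_intros continuous_on_compose2[OF f(1)]) auto
      fix \<xi> :: 'a assume \<xi>: "\<xi> \<noteq> 0"
      have "l powr t * norm (f (l *\<^sub>R \<xi>)) \<le> B * R powr t * norm \<xi> powr - t"
      proof (cases "R < norm (l *\<^sub>R \<xi>)")
        case True
        then show ?thesis using f(2) B by simp
      next
        case False
        \<comment> \<open>On the support of the dilated function the factor l^t is at most R^t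
          |\<xi>|^-t; this is what makes the bound independent of l.\<close>
        then have "l \<le> R / norm \<xi>" using l \<xi> by (simp add: field_simps)
        then have "l powr t \<le> (R / norm \<xi>) powr t" using l t by (intro powr_mono2) auto
        also have "\<dots> = R powr t * norm \<xi> powr - t"
          using \<open>0 < R\<close> by (subst powr_divide) (auto simp: powr_minus divide_inverse)
        finally have "l powr t * norm (f (l *\<^sub>R \<xi>)) \<le> (R powr t * norm \<xi> powr - t) * B"
          using B by (intro mult_mono) auto
        then show ?thesis by (simp add: mult_ac)
      qed
      then show "norm (complex_of_real (l powr t) * f (l *\<^sub>R \<xi>)) \<le> B * R powr t * \<langle>\<xi>\<rangle> powr 0 * norm \<xi> powr - t"
        by (simp add: norm_mult)
    qed
    then show ?thesis using B by (intro exI[of _ "B * R powr t"]) auto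
  qed
  {
    case 0
    then show ?case using *[of f t] by auto
  next
    case (Suc k)
    let ?f' = "\<lambda>x. frechet_derivative f (at x) b"
    have diff: "f differentiable (at \<xi>)" for \<xi> using Suc.prems by auto
    obtain A where A: "\<And>l. l > 0 \<Longrightarrow> symbol b 0 A k (t + 1) (\<lambda>\<xi>. complex_of_real (l powr (t + 1)) * ?f' (l *\<^sub>R \<xi>))"
      using Suc.IH[of ?f' "t + 1"] Suc.prems frechet_derivative_support[of R f _ b] by auto
    obtain B where B: "\<And>l. l > 0 \<Longrightarrow> symbol_bound 0 B t (\<lambda>\<xi>. complex_of_real (l powr t) * f (l *\<^sub>R \<xi>))"
      using *[of f t] Ck_on_imp_continuous_on[OF Suc.prems(1)] Suc.prems by blast
    have "symbol b 0 (max A B) (Suc k) t (\<lambda>\<xi>. complex_of_real (l powr t) * f (l *\<^sub>R \<xi>))" if l: "l > 0" for l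
    proof (rule symbol_SucI)
      show "symbol_bound 0 (max A B) t (\<lambda>\<xi>. complex_of_real (l powr t) * f (l *\<^sub>R \<xi>))"
        by (rule symbol_bound_mono[OF B[OF l]]) simp
      show "symbol b 0 (max A B) k (t + 1) (\<lambda>\<xi>. complex_of_real (l powr (t + 1)) * ?f' (l *\<^sub>R \<xi>))"
        by (rule symbol_mono[OF A[OF l]]) simp
      fix \<xi> :: 'a
      have "((\<lambda>\<tau>. f (l *\<^sub>R \<xi> + \<tau> *\<^sub>R (l *\<^sub>R b))) has_vector_derivative l *\<^sub>R ?f' (l *\<^sub>R \<xi>)) (at 0)"
        by (intro has_vector_derivative_scale_dir has_vector_derivative_frechet diff)
      then have "((\<lambda>\<tau>. f (l *\<^sub>R (\<xi> + \<tau> *\<^sub>R b))) has_vector_derivative l *\<^sub>R ?f' (l *\<^sub>R \<xi>)) (at 0)"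
        by (simp add: scaleR_add_right mult.commute)
      then have "((\<lambda>\<tau>. complex_of_real (l powr t) * f (l *\<^sub>R (\<xi> + \<tau> *\<^sub>R b))) has_vector_derivative
          complex_of_real (l powr t) * (l *\<^sub>R ?f' (l *\<^sub>R \<xi>))) (at 0)"
        by (rule has_vector_derivative_mult_right)
      moreover have "complex_of_real (l powr t) * (l *\<^sub>R ?f' (l *\<^sub>R \<xi>)) = complex_of_real (l powr (t + 1)) * ?f' (l *\<^sub>R \<xi>)"
        using l by (simp add: powr_add scaleR_conv_of_real)
      ultimately show "((\<lambda>\<tau>. complex_of_real (l powr t) * f (l *\<^sub>R (\<xi> + \<tau> *\<^sub>R b))) has_vector_derivative
          complex_of_real (l powr (t + 1)) * ?f' (l *\<^sub>R \<xi>)) (at 0)" by simp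
    qed
    then show ?case by blast
  }
qed

text \<open>The derivatives of the phase are bounded but do not decay in \<xi>; a weight of degree
  at least the number of derivatives pays for the powers |\<xi>|^-1 that \<open>symbol\<close>
  demands. The constant depends on x, which is harmless where a single x is considered.\<close>

lemma phase_symbol:
  fixes x b :: "'a::euclidean_space"
  shows "0 \<le> t \<Longrightarrow> t + real k \<le> s \<Longrightarrow>
    \<exists>A\<ge>0. symbol b s A k t (\<lambda>\<xi>. c * fexp \<xi> x)"
proof (induction k arbitrary: t c)
  have *: "symbol_bound s (norm c) t (\<lambda>\<xi>. c * fexp \<xi> x)"
    if "0 \<le> t" "t \<le> s" for t c
    unfolding symbol_bound_def
  proof (intro conjI allI impI)
    show "continuous_on (- {0}) (\<lambda>\<xi>. c * fexp \<xi> x)"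
      by (intro continuous_intros)
    fix \<xi> :: 'a assume \<xi>: "\<xi> \<noteq> 0"
    have "1 \<le> (\<langle>\<xi>\<rangle> / norm \<xi>) powr t"
      using \<xi> that japanese_ge_norm[of \<xi>] by (intro ge_one_powr_ge_zero) auto
    also have "\<dots> = \<langle>\<xi>\<rangle> powr t * norm \<xi> powr - t"
      by (subst powr_divide) (auto simp: powr_minus divide_inverse less_imp_le)
    also have "\<dots> \<le> \<langle>\<xi>\<rangle> powr s * norm \<xi> powr - t"
      using that japanese_ge_1[of \<xi>] by (intro mult_right_mono powr_mono) auto
    finally have "norm c * 1 \<le> norm c * (\<langle>\<xi>\<rangle> powr s * norm \<xi> powr - t)"
      by (intro mult_left_mono) auto
    then show "norm (c * fexp \<xi> x) \<le> norm c * \<langle>\<xi>\<rangle> powr s * norm \<xi> powr - t"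
      by (simp add: norm_mult)
  qed
  {
    case 0
    then show ?case using *[of t c] by (auto intro!: exI[of _ "norm c"])
  next
    case (Suc k)
    obtain A where A: "0 \<le> A" "symbol b s A k (t + 1)
        (\<lambda>\<xi>. (c * - (\<i> * complex_of_real (b \<bullet> x))) * fexp \<xi> x)"
      using Suc.IH[of "t + 1" "c * - (\<i> * complex_of_real (b \<bullet> x))"] Suc.prems by auto
    have "symbol b s (max (norm c) A) (Suc k) t (\<lambda>\<xi>. c * fexp \<xi> x)"
    proof (rule symbol_SucI)
      show "symbol_bound s (max (norm c) A) t (\<lambda>\<xi>. c * fexp \<xi> x)"
        by (rule symbol_bound_mono[OF *]) (use Suc.prems in auto)
      show "symbol b s (max (norm c) A) k (t + 1)
        (\<lambda>\<xi>. (c * - (\<i> * complex_of_real (b \<bullet> x))) * fexp \<xi> x)"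
        by (rule symbol_mono[OF A(2)]) simp
      fix \<xi> :: 'a
      have e: "((\<lambda>z. c * exp (- (\<i> * z))) has_field_derivative c * (fexp \<xi> x * - \<i>))
          (at (complex_of_real ((\<xi> + 0 *\<^sub>R b) \<bullet> x)))"
        by (auto intro!: derivative_eq_intros)
      have "((\<lambda>\<tau>. complex_of_real ((\<xi> + \<tau> *\<^sub>R b) \<bullet> x)) has_vector_derivative complex_of_real (b \<bullet> x)) (at 0)"
        by (auto intro!: derivative_eq_intros simp: inner_add_left)
      from field_vector_diff_chain_at[OF this e]
      show "((\<lambda>\<tau>. c * fexp (\<xi> + \<tau> *\<^sub>R b) x) has_vector_derivative
        (c * - (\<i> * complex_of_real (b \<bullet> x))) * fexp \<xi> x) (at 0)"
        by (simp add: o_def mult_ac)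
    qed
    then show ?case using A by (auto simp: le_max_iff_disj intro!: exI[of _ "max (norm c) A"])
  }
qed

section \<open>Gaussian regularisation and mollification\<close>

lemma std_normal_fourier:
  "integrable lborel (\<lambda>t. complex_of_real (exp (- (t\<^sup>2) / 2)) * exp (- (\<i> * complex_of_real (t * y))))" (is ?A)
  "(\<integral>t. complex_of_real (exp (- (t\<^sup>2) / 2)) * exp (- (\<i> * complex_of_real (t * y))) \<partial>lborel)
     = complex_of_real (sqrt (2 * pi) * exp (- (y\<^sup>2) / 2))" (is ?B)
proof -
  have "integrable lborel (\<lambda>t. sqrt (2 * pi) * std_normal_density t)"
    by (intro integrable_mult_right) (use integrable_std_normal_distribution_moment[of 0] in \<open>auto simp: integrable_density\<close>)
  then have i: "integrable lborel (\<lambda>t. complex_of_real (exp (- (t\<^sup>2) / 2)))"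
    by (intro integrable_of_real) (simp add: std_normal_density_def)
  show ?A
    using integrable_phase[OF i, of "\<lambda>t. t * y"] by (simp add: mult.commute)
  have "char std_normal_distribution (- y) =
      (\<integral>t. std_normal_density t *\<^sub>R exp (\<i> * complex_of_real (- y * t)) \<partial>lborel)"
    unfolding char_def by (subst integral_density) auto
  also have "\<dots> = (\<integral>t. (1 / complex_of_real (sqrt (2 * pi))) *
      (complex_of_real (exp (- (t\<^sup>2) / 2)) * exp (- (\<i> * complex_of_real (t * y)))) \<partial>lborel)"
    by (intro Bochner_Integration.integral_cong)
      (auto simp: std_normal_density_def scaleR_conv_of_real mult_ac)
  also have "\<dots> = (1 / complex_of_real (sqrt (2 * pi))) *
     (\<integral>t. complex_of_real (exp (- (t\<^sup>2) / 2)) * exp (- (\<i> * complex_of_real (t * y))) \<partial>lborel)"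
    by simp
  finally have "(1 / complex_of_real (sqrt (2 * pi))) *
     (\<integral>t. complex_of_real (exp (- (t\<^sup>2) / 2)) * exp (- (\<i> * complex_of_real (t * y))) \<partial>lborel)
     = complex_of_real (exp (- (y\<^sup>2) / 2))"
    by (simp add: char_std_normal_distribution)
  then show ?B
    by (simp add: field_simps)
qed

text \<open>Lebesgue measure on the space is the image of a product of lines under the coordinate
  map, so products over coordinates integrate factor by factor.\<close>

lemma lborel_integral_prod_Basis:
  fixes h :: "'a::euclidean_space \<Rightarrow> real \<Rightarrow> complex"
  assumes int: "\<And>b. b \<in> Basis \<Longrightarrow> integrable lborel (h b)"
  shows "integrable lborel (\<lambda>x. \<Prod>b\<in>Basis. h b (x \<bullet> b))"
    and "(\<integral>x. (\<Prod>b\<in>Basis. h b (x \<bullet> b)) \<partial>lborel) = (\<Prod>b\<in>Basis. \<integral>t. h b t \<partial>lborel)"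
proof -
  interpret product_sigma_finite "\<lambda>_::'a. lborel :: real measure" ..
  have [measurable]: "h b \<in> borel_measurable borel" if "b \<in> Basis" for b
    using borel_measurable_integrable[OF int[OF that]] by simp
  let ?T = "\<lambda>f. \<Sum>b\<in>Basis. f b *\<^sub>R (b :: 'a)"
  let ?H = "\<lambda>x. \<Prod>b\<in>Basis. h b (x \<bullet> b)"
  have T[measurable]: "?T \<in> (\<Pi>\<^sub>M b\<in>Basis. lborel) \<rightarrow>\<^sub>M borel" by measurable
  have H[measurable]: "?H \<in> borel_measurable borel" by measurable
  have eq: "?H (?T f) = (\<Prod>b\<in>Basis. h b (f b))" for f
    by (intro prod.cong) (auto simp: inner_sum_left inner_Basis if_distrib cong: if_cong)
  have 1: "integrable (\<Pi>\<^sub>M b\<in>Basis. lborel) (\<lambda>f. \<Prod>b\<in>Basis. h b (f b))"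
    by (rule product_integrable_prod) (use int in auto)
  show "integrable lborel ?H"
    unfolding lborel_eq[where 'a='a] by (subst integrable_distr_eq[OF T H]) (simp only: eq 1)
  show "(\<integral>x. ?H x \<partial>lborel) = (\<Prod>b\<in>Basis. \<integral>t. h b t \<partial>lborel)"
    unfolding lborel_eq[where 'a='a] integral_distr[OF T H] eq
    by (rule product_integral_prod) (use int in auto)
qed

definition gauss :: "'a::euclidean_space \<Rightarrow> complex" where
  "gauss x = complex_of_real (exp (- ((norm x)\<^sup>2) / 2))"

lemma borel_measurable_gauss [measurable]: "gauss \<in> borel_measurable borel"
  unfolding gauss_def by measurable

lemma gauss_prod:
  "gauss x * fexp x y =
    (\<Prod>b\<in>Basis. complex_of_real (exp (- ((x \<bullet> b)\<^sup>2) / 2)) * exp (- (\<i> * complex_of_real ((x \<bullet> b) * (y \<bullet> b)))))"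
proof -
  have "(norm x)\<^sup>2 = (\<Sum>b\<in>Basis. (x \<bullet> b)\<^sup>2)"
    by (simp add: norm_eq_sqrt_inner euclidean_inner[of x x] sum_nonneg power2_eq_square[symmetric])
  then show ?thesis
    unfolding prod.distrib gauss_def
    by (simp add: euclidean_inner[of x y] exp_sum[symmetric] sum_negf sum_divide_distrib sum_distrib_left
        flip: of_real_prod)
qed

lemma gauss_fourier:
  "integrable lborel (gauss :: 'a::euclidean_space \<Rightarrow> complex)" (is ?A)
  "fourier gauss y = complex_of_real (sqrt (2 * pi) ^ DIM('a)) * gauss (y::'a)" (is ?B)
proof -
  have "integrable lborel (\<lambda>x::'a. gauss x * fexp x 0)"
    unfolding gauss_prod by (intro lborel_integral_prod_Basis std_normal_fourier)
  then show ?A by simp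
  have "fourier gauss y = (\<integral>x. gauss x * fexp x y \<partial>lborel)"
    by (simp add: fourier_lborel mult.commute)
  also have "\<dots> = (\<Prod>b\<in>Basis. complex_of_real (sqrt (2 * pi) * exp (- ((y \<bullet> b)\<^sup>2) / 2)))"
    unfolding gauss_prod
    by (subst lborel_integral_prod_Basis(2)) (use std_normal_fourier in auto)
  also have "\<dots> = complex_of_real (sqrt (2 * pi) ^ DIM('a)) * gauss y"
    using gauss_prod[of y 0] by (simp add: prod.distrib)
  finally show ?B .
qed

lemma fourier_0: "f \<in> borel_measurable borel \<Longrightarrow> fourier f 0 = (\<integral>x. f x \<partial>lborel)"
  by (simp add: fourier_lborel)

lemma gauss_integral: "(\<integral>x. gauss (x::'a::euclidean_space) \<partial>lborel) = complex_of_real (sqrt (2 * pi) ^ DIM('a))"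
  using gauss_fourier(2)[of "0::'a"] fourier_0[of "gauss :: 'a \<Rightarrow> complex"] by (simp add: gauss_def[of 0])

lemma norm_gauss_le: "norm (gauss x) \<le> 1"
  by (simp add: gauss_def)

lemma borel_measurable_fourier [measurable]:
  assumes [measurable]: "f \<in> borel_measurable borel"
  shows "fourier f \<in> borel_measurable borel"
  unfolding fourier_lborel[OF assms] by measurable

lemma lborel_integrable_tensor:
  fixes f :: "'a::euclidean_space \<Rightarrow> complex" and g :: "'b::euclidean_space \<Rightarrow> complex"
  assumes f: "integrable lborel f" and g: "integrable lborel g"
  shows "integrable (lborel \<Otimes>\<^sub>M lborel) (\<lambda>(x, y). f x * g y)"
proof -
  have [measurable]: "f \<in> borel_measurable borel" "g \<in> borel_measurable borel"
    using f g by (auto dest: borel_measurable_integrable)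
  show ?thesis
  proof (rule lborel_pair.Fubini_integrable)
    have "integrable lborel (\<lambda>x. norm (f x) * (\<integral>y. norm (g y) \<partial>lborel))"
      using f by (intro integrable_mult_left integrable_norm)
    then show "integrable lborel (\<lambda>x. \<integral>y. norm (case (x, y) of (x, y) \<Rightarrow> f x * g y) \<partial>lborel)"
      by (simp add: norm_mult)
  qed (use g in auto)
qed

text \<open>Fourier inversion at the origin, the only instance that is needed; it comes from pairing with
  the Gaussians \<open>gauss (e n *\<^sub>R x)\<close>, whose transforms are explicit.\<close>

lemma integral_fourier:
  fixes f :: "'a::euclidean_space \<Rightarrow> complex"
  assumes f: "integrable lborel f" and cont: "continuous_on UNIV f" and bd: "\<And>x. norm (f x) \<le> B"
    and F: "integrable lborel (fourier f)"
  shows "(\<integral>x. fourier f x \<partial>lborel) = complex_of_real ((2 * pi) ^ DIM('a)) * f 0"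
proof -
  define e where "e n = 1 / real (Suc n)" for n
  have e: "e n > 0" "e n \<noteq> 0" for n by (auto simp: e_def)
  have e0: "e \<longlonglongrightarrow> 0" unfolding e_def by (rule LIMSEQ_Suc[OF lim_1_over_n])
  have [measurable]: "f \<in> borel_measurable borel" using cont by (rule borel_measurable_continuous_onI)
  let ?c = "complex_of_real (sqrt (2 * pi) ^ DIM('a))"
  \<comment> \<open>Fubini moves the transform from \<open>f\<close> onto the dilated Gaussian,
    whose transform is concentrated at scale \<open>e n\<close>; rescaling puts that scale into the
    argument of \<open>f\<close>. As \<open>e n\<close> tends to 0, the left side tends to the
    integral of \<open>fourier f\<close> and the right side to a multiple of
    \<open>f 0\<close>.\<close>
  have eq: "(\<integral>z. fourier f z * gauss (e n *\<^sub>R z) \<partial>lborel) = (\<integral>y. f (e n *\<^sub>R y) * (?c * gauss y) \<partial>lborel)" for n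
  proof -
    let ?h = "\<lambda>(z::'a) x. fexp x z * f x * gauss (e n *\<^sub>R z)"
    have ig: "integrable lborel (\<lambda>z::'a. gauss (e n *\<^sub>R z))"
      using lborel_integrable_affine[OF gauss_fourier(1) e(2)[of n], of 0] by simp
    have ifg: "integrable (lborel \<Otimes>\<^sub>M lborel) (\<lambda>(z::'a, x). f x * gauss (e n *\<^sub>R z))"
      using lborel_integrable_tensor[OF ig f] by (simp only: mult.commute[of "f _"])
    have int: "integrable (lborel \<Otimes>\<^sub>M lborel) (\<lambda>(z, x). ?h z x)"
      by (rule Bochner_Integration.integrable_bound[OF ifg]) (auto simp: norm_mult split_beta')
    have "(\<integral>z. fourier f z * gauss (e n *\<^sub>R z) \<partial>lborel) = (\<integral>z. \<integral>x. ?h z x \<partial>lborel \<partial>lborel)"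
      by (simp add: fourier_lborel)
    also have "\<dots> = (\<integral>x. \<integral>z. ?h z x \<partial>lborel \<partial>lborel)"
      by (rule lborel_pair.Fubini_integral[OF int, symmetric])
    also have "\<dots> = (\<integral>x. f x * fourier (\<lambda>z. gauss (e n *\<^sub>R z)) x \<partial>lborel)"
      by (intro Bochner_Integration.integral_cong)
        (auto simp: fourier_lborel inner_commute mult_ac)
    also have "\<dots> = (\<integral>x. f x * ((1 / \<bar>e n\<bar> ^ DIM('a)) *\<^sub>R (?c * gauss (x /\<^sub>R e n))) \<partial>lborel)"
    proof (intro Bochner_Integration.integral_cong refl arg_cong2[of _ _ _ _ "(*)"])
      fix x :: 'a
      have "fourier (\<lambda>z. gauss (e n *\<^sub>R z)) x =
          (\<integral>z. fexp (0 + e n *\<^sub>R z) (x /\<^sub>R e n) * gauss (0 + e n *\<^sub>R z) \<partial>lborel)"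
      proof -
        have "(0 + e n *\<^sub>R z) \<bullet> (x /\<^sub>R e n) = z \<bullet> x" for z
          using e(2)[of n] by simp
        then show ?thesis by (simp only: fourier_lborel measurable add_0 ) (simp add: fourier_lborel)
      qed
      also have "\<dots> = (1 / \<bar>e n\<bar> ^ DIM('a)) *\<^sub>R fourier gauss (x /\<^sub>R e n)"
        by (subst lborel_integral_affine[of "\<lambda>w. fexp w (x /\<^sub>R e n) * gauss w"])
          (use e in \<open>auto simp: fourier_lborel\<close>)
      finally show "fourier (\<lambda>z. gauss (e n *\<^sub>R z)) x = (1 / \<bar>e n\<bar> ^ DIM('a)) *\<^sub>R (?c * gauss (x /\<^sub>R e n))"
        by (simp add: gauss_fourier)
    qed
    also have "\<dots> = (1 / \<bar>e n\<bar> ^ DIM('a)) *\<^sub>R (\<integral>x. f x * (?c * gauss (x /\<^sub>R e n)) \<partial>lborel)"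
      by (simp add: scaleR_conv_of_real mult_ac)
    also have "\<dots> = (\<integral>y. f (e n *\<^sub>R y) * (?c * gauss y) \<partial>lborel)"
      using lborel_integral_affine[of "\<lambda>x. f x * (?c * gauss (x /\<^sub>R e n))" "e n" 0] e by simp
    finally show ?thesis .
  qed
  have "(\<lambda>n. \<integral>z. fourier f z * gauss (e n *\<^sub>R z) \<partial>lborel) \<longlonglongrightarrow> (\<integral>z. fourier f z * gauss (0::'a) \<partial>lborel)"
  proof (rule integral_dominated_convergence[where w = "\<lambda>z. norm (fourier f z)"])
    show "AE z in lborel. (\<lambda>n. fourier f z * gauss (e n *\<^sub>R z)) \<longlonglongrightarrow> fourier f z * gauss (0::'a)"
    proof (rule AE_I2)
      fix z :: 'a
      have "(\<lambda>n. fourier f z * gauss (e n *\<^sub>R z)) \<longlonglongrightarrow> fourier f z * gauss (0 *\<^sub>R z)"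
        unfolding gauss_def by (intro tendsto_intros e0) auto
      then show "(\<lambda>n. fourier f z * gauss (e n *\<^sub>R z)) \<longlonglongrightarrow> fourier f z * gauss (0::'a)" by simp
    qed
    show "AE z in lborel. norm (fourier f z * gauss (e n *\<^sub>R z)) \<le> norm (fourier f z)" for n
      by (intro AE_I2) (simp add: norm_mult mult_left_le norm_gauss_le)
    show "integrable lborel (\<lambda>z. norm (fourier f z))" using F by simp
  qed measurable
  moreover have "(\<lambda>n. \<integral>y. f (e n *\<^sub>R y) * (?c * gauss y) \<partial>lborel) \<longlonglongrightarrow> (\<integral>y. f 0 * (?c * gauss (y::'a)) \<partial>lborel)"
  proof (rule integral_dominated_convergence[where w = "\<lambda>y. B * (norm ?c * norm (gauss y))"])
    show "AE y in lborel. (\<lambda>n. f (e n *\<^sub>R y) * (?c * gauss y)) \<longlonglongrightarrow> f 0 * (?c * gauss y)"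
    proof (rule AE_I2)
      fix y :: 'a
      have "(\<lambda>n. e n *\<^sub>R y) \<longlonglongrightarrow> 0 *\<^sub>R y" by (intro tendsto_intros e0)
      then have "(\<lambda>n. f (e n *\<^sub>R y)) \<longlonglongrightarrow> f 0"
        by (intro continuous_on_tendsto_compose[OF cont]) auto
      then show "(\<lambda>n. f (e n *\<^sub>R y) * (?c * gauss y)) \<longlonglongrightarrow> f 0 * (?c * gauss y)"
        by (intro tendsto_intros)
    qed
    show "AE y in lborel. norm (f (e n *\<^sub>R y) * (?c * gauss y)) \<le> B * (norm ?c * norm (gauss y))" for n
      unfolding norm_mult by (intro AE_I2 mult_right_mono bd mult_nonneg_nonneg norm_ge_zero)
    show "integrable lborel (\<lambda>y::'a. B * (norm ?c * norm (gauss y)))"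
      by (intro integrable_mult_right integrable_norm gauss_fourier)
  qed measurable
  ultimately have "(\<integral>z. fourier f z * gauss (0::'a) \<partial>lborel) = (\<integral>y. f 0 * (?c * gauss (y::'a)) \<partial>lborel)"
    unfolding eq by (rule LIMSEQ_unique)
  also have "\<dots> = f 0 * (?c * ?c)"
    by (simp only: integral_mult_right_zero gauss_integral)
  also have "?c * ?c = complex_of_real ((2 * pi) ^ DIM('a))"
  proof -
    have "sqrt (2 * pi) ^ DIM('a) * sqrt (2 * pi) ^ DIM('a) = (2 * pi) ^ DIM('a)"
      unfolding power_mult_distrib[symmetric] by simp
    then show ?thesis by (metis of_real_mult)
  qed
  finally show ?thesis by (simp add: gauss_def mult.commute)
qed

section \<open>Rapidly decreasing functions\<close>

definition rapid :: "('a::euclidean_space \<Rightarrow> complex) \<Rightarrow> bool" where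
  "rapid \<Theta> \<longleftrightarrow> \<Theta> \<in> borel_measurable borel \<and> (\<forall>n. \<exists>C\<ge>0. \<forall>z. norm (\<Theta> z) \<le> C * \<langle>z\<rangle> powr - real n)"

lemma rapid_measurable: "rapid \<Theta> \<Longrightarrow> \<Theta> \<in> borel_measurable borel"
  by (simp add: rapid_def)

lemma rapid_bound:
  assumes "rapid \<Theta>"
  shows "\<exists>C\<ge>0. \<forall>z. norm (\<Theta> z) \<le> C * \<langle>z\<rangle> powr - L"
proof -
  obtain n where n: "L \<le> real n" using real_arch_simple by blast
  obtain C where C: "0 \<le> C" "\<And>z. norm (\<Theta> z) \<le> C * \<langle>z\<rangle> powr - real n"
    using assms unfolding rapid_def by blast
  have "norm (\<Theta> z) \<le> C * \<langle>z\<rangle> powr - L" for z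
  proof -
    have "C * \<langle>z\<rangle> powr - real n \<le> C * \<langle>z\<rangle> powr - L"
      using n C(1) japanese_ge_1[of z] by (intro mult_left_mono powr_mono) auto
    then show ?thesis using C(2)[of z] by linarith
  qed
  then show ?thesis using C(1) by blast
qed

lemma rapid_integrable_weight:
  fixes \<Theta> :: "'a::euclidean_space \<Rightarrow> complex"
  assumes "rapid \<Theta>"
  shows "integrable lborel (\<lambda>z. \<langle>z\<rangle> powr L * norm (\<Theta> z))"
proof -
  note [measurable] = rapid_measurable[OF assms]
  obtain C where C: "0 \<le> C" "\<And>z. norm (\<Theta> z) \<le> C * \<langle>z\<rangle> powr - (L + (real DIM('a) + 1))"
    using rapid_bound[OF assms] by blast
  have "integrable lborel (\<lambda>z::'a. \<langle>z\<rangle> powr - (real DIM('a) + 1))"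
    by (rule integrable_japanese) simp
  then have "integrable lborel (\<lambda>z::'a. C * \<langle>z\<rangle> powr - (real DIM('a) + 1))"
    by (rule integrable_mult_right)
  then show ?thesis
  proof (rule Bochner_Integration.integrable_bound)
    show "AE z in lborel. norm (\<langle>z\<rangle> powr L * norm (\<Theta> z)) \<le> norm (C * \<langle>z::'a\<rangle> powr - (real DIM('a) + 1))"
    proof (rule AE_I2)
      fix z :: 'a
      have "\<langle>z\<rangle> powr L * norm (\<Theta> z) \<le> \<langle>z\<rangle> powr L * (C * \<langle>z\<rangle> powr - (L + (real DIM('a) + 1)))"
        by (intro mult_left_mono C) auto
      also have "\<dots> = C * (\<langle>z\<rangle> powr L * \<langle>z\<rangle> powr - (L + (real DIM('a) + 1)))" by simp
      also have "\<dots> = C * \<langle>z\<rangle> powr - (real DIM('a) + 1)"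
        unfolding powr_add[symmetric] by (simp add: algebra_simps)
      finally show "norm (\<langle>z\<rangle> powr L * norm (\<Theta> z)) \<le> norm (C * \<langle>z\<rangle> powr - (real DIM('a) + 1))"
        using C(1) by (simp add: abs_mult)
    qed
  qed measurable
qed

lemma rapid_integrable: "rapid \<Theta> \<Longrightarrow> integrable lborel \<Theta>"
  using rapid_integrable_weight[of \<Theta> 0] rapid_measurable[of \<Theta>]
  by (simp add: integrable_norm_iff)

lemma rapid_reflect:
  assumes "rapid \<Theta>" shows "rapid (\<lambda>z. c * \<Theta> (- z))"
proof -
  note [measurable] = rapid_measurable[OF assms]
  have "\<exists>C\<ge>0. \<forall>z. norm (c * \<Theta> (- z)) \<le> C * \<langle>z\<rangle> powr - real n" for n
  proof -
    obtain C where C: "0 \<le> C" "\<And>z. norm (\<Theta> z) \<le> C * \<langle>z\<rangle> powr - real n"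
      using assms unfolding rapid_def by blast
    have "norm (c * \<Theta> (- z)) \<le> (norm c * C) * \<langle>z\<rangle> powr - real n" for z
      using mult_left_mono[OF C(2)[of "- z"], of "norm c"] by (simp add: norm_mult mult.assoc)
    then show ?thesis using C(1) by (intro exI[of _ "norm c * C"]) auto
  qed
  then show ?thesis by (auto simp: rapid_def)
qed

lemma continuous_compact_support_integrable:
  fixes f :: "'a::euclidean_space \<Rightarrow> complex"
  assumes "continuous_on UNIV f" "\<And>\<xi>. R < norm \<xi> \<Longrightarrow> f \<xi> = 0"
  shows "integrable lborel f"
proof -
  have "integrable lborel (\<lambda>x. indicator (cball 0 R) x *\<^sub>R f x)"
    by (rule borel_integrable_compact) (auto intro: continuous_on_subset[OF assms(1)])
  moreover have "(\<lambda>x. indicator (cball 0 R) x *\<^sub>R f x) = f"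
    using assms(2) by (force simp: indicator_def not_le)
  ultimately show ?thesis by simp
qed

lemma rapid_fourier:
  assumes "test_function f"
  shows "rapid (fourier f)"
proof -
  obtain R where R: "R > 0" "\<And>\<xi>. R < norm \<xi> \<Longrightarrow> f \<xi> = 0" using test_function_support[OF assms] by blast
  have Ck: "Ck_on k UNIV f" for k using assms by (auto simp: test_function_def smooth_on_def)
  have cont: "continuous_on UNIV f" using Ck_on_imp_continuous_on[OF Ck[of 0]] .
  have int: "integrable lborel f" by (rule continuous_compact_support_integrable[OF cont R(2)])
  have "f \<in> borel_measurable borel" using borel_measurable_integrable[OF int] by simp
  moreover have "\<exists>C\<ge>0. \<forall>x. norm (fourier f x) \<le> C * \<langle>x\<rangle> powr - real n" for n
    by (rule fourier_decay[OF int R(2)]) (use Ck_imp_dchain[OF Ck R(2)] in auto)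
  ultimately show ?thesis by (auto simp: rapid_def)
qed

lemma integral_fourier_test_function:
  assumes "test_function (f :: 'a::euclidean_space \<Rightarrow> complex)"
  shows "(\<integral>x. fourier f x \<partial>lborel) = complex_of_real ((2 * pi) ^ DIM('a)) * f 0"
proof -
  obtain R where R: "R > 0" "\<And>\<xi>. R < norm \<xi> \<Longrightarrow> f \<xi> = 0" using test_function_support[OF assms] by blast
  have "Ck_on 0 UNIV f" using assms unfolding test_function_def smooth_on_def by blast
  then have cont: "continuous_on UNIV f" by simp
  obtain B where "\<And>x. norm (f x) \<le> B"
    using bounded_continuous_support[OF cont R(2)] by blast
  then show ?thesis
    by (intro integral_fourier[OF continuous_compact_support_integrable[OF cont R(2)] cont]
      rapid_integrable rapid_fourier assms)
qed

text \<open>The scale \<kappa> acts on the argument of \<open>g\<close> and leaves the kernel fixed,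
  so \<kappa> = 0 is meaningful and gives \<open>g\<close> times the mass of the kernel. Convergence
  of mollifications thereby becomes continuity at \<kappa> = 0.\<close>

definition mollify :: "('a::euclidean_space \<Rightarrow> complex) \<Rightarrow> real \<Rightarrow> ('a \<Rightarrow> complex) \<Rightarrow> 'a \<Rightarrow> complex" where
  "mollify \<Theta> \<kappa> g x = (\<integral>z. \<Theta> z * g (x - \<kappa> *\<^sub>R z) \<partial>lborel)"

lemma integrable_mollify:
  fixes \<Theta> g :: "'a::euclidean_space \<Rightarrow> complex"
  assumes "integrable lborel \<Theta>" "\<And>x. norm (g x) \<le> B" and [measurable]: "g \<in> borel_measurable borel"
  shows "integrable lborel (\<lambda>z. \<Theta> z * g (x - \<kappa> *\<^sub>R z))"
proof -
  have [measurable]: "\<Theta> \<in> borel_measurable borel" using borel_measurable_integrable[OF assms(1)] by simp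
  have "integrable lborel (\<lambda>z. B * norm (\<Theta> z))" using assms(1) by auto
  then show ?thesis
  proof (rule Bochner_Integration.integrable_bound)
    show "AE z in lborel. norm (\<Theta> z * g (x - \<kappa> *\<^sub>R z)) \<le> norm (B * norm (\<Theta> z))"
    proof (rule AE_I2)
      fix z :: 'a
      have "norm (\<Theta> z) * norm (g (x - \<kappa> *\<^sub>R z)) \<le> norm (\<Theta> z) * B"
        by (intro mult_left_mono assms) auto
      then have "norm (\<Theta> z * g (x - \<kappa> *\<^sub>R z)) \<le> B * norm (\<Theta> z)"
        by (simp add: norm_mult mult.commute)
      then show "norm (\<Theta> z * g (x - \<kappa> *\<^sub>R z)) \<le> norm (B * norm (\<Theta> z))"
        by (simp add: abs_mult) (smt (verit) norm_ge_zero mult_nonneg_nonneg abs_ge_self mult_right_mono)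
    qed
  qed measurable
qed

text \<open>Peetre's inequality moves the weight from x - \<kappa> z to x; the resulting factor in z
  is integrable against a rapid kernel, and \<kappa> \<le> 1 makes it uniform in \<kappa>.\<close>

lemma mollify_bound:
  fixes \<Theta> :: "'a::euclidean_space \<Rightarrow> complex"
  assumes \<Theta>: "rapid \<Theta>" and L: "0 \<le> L"
  shows "\<exists>C\<ge>0. \<forall>A g \<kappa> x. 0 \<le> \<kappa> \<longrightarrow> \<kappa> \<le> 1 \<longrightarrow> g \<in> borel_measurable borel \<longrightarrow>
    (\<forall>x. norm (g x) \<le> A * \<langle>x\<rangle> powr - L) \<longrightarrow> norm (mollify \<Theta> \<kappa> g x) \<le> C * A * \<langle>x\<rangle> powr - L"
proof -
  define C where "C = 2 powr L * (\<integral>z. \<langle>z\<rangle> powr L * norm (\<Theta> z) \<partial>lborel)"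
  have "norm (mollify \<Theta> \<kappa> g x) \<le> C * A * \<langle>x\<rangle> powr - L"
    if \<kappa>: "0 \<le> \<kappa>" "\<kappa> \<le> 1" and [measurable]: "g \<in> borel_measurable borel"
      and g: "\<And>x. norm (g x) \<le> A * \<langle>x\<rangle> powr - L" for A g \<kappa> x
  proof -
    have "0 \<le> A * \<langle>0::'a\<rangle> powr - L" using g[of 0] norm_ge_zero order_trans by blast
    then have A: "0 \<le> A" by (simp add: japanese_def)
    have "norm (mollify \<Theta> \<kappa> g x) \<le> (\<integral>z. (2 powr L * A * \<langle>x\<rangle> powr - L) * (\<langle>z\<rangle> powr L * norm (\<Theta> z)) \<partial>lborel)"
      unfolding mollify_def
    proof (rule Bochner_Integration.integral_norm_bound_integral)
      show "integrable lborel (\<lambda>z. \<Theta> z * g (x - \<kappa> *\<^sub>R z))"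
      proof (rule integrable_mollify[OF rapid_integrable[OF \<Theta>]])
        show "norm (g x) \<le> A" for x by (rule norm_le_of_weight[OF g L])
      qed measurable
      show "integrable lborel (\<lambda>z. (2 powr L * A * \<langle>x\<rangle> powr - L) * (\<langle>z\<rangle> powr L * norm (\<Theta> z)))"
        by (intro integrable_mult_right rapid_integrable_weight \<Theta>)
      fix z :: 'a
      have "\<langle>x - \<kappa> *\<^sub>R z\<rangle> powr - L \<le> 2 powr L * \<langle>\<kappa> *\<^sub>R z\<rangle> powr L * \<langle>x\<rangle> powr - L"
        by (rule japanese_powr_shift[OF L])
      also have "\<dots> \<le> 2 powr L * \<langle>z\<rangle> powr L * \<langle>x\<rangle> powr - L"
        using \<kappa> L by (intro mult_right_mono mult_left_mono powr_mono2 japanese_mono)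
          (auto simp: mult_left_le_one_le less_imp_le)
      finally have *: "\<langle>x - \<kappa> *\<^sub>R z\<rangle> powr - L \<le> (2 powr L * \<langle>z\<rangle> powr L) * \<langle>x\<rangle> powr - L" .
      have "norm (\<Theta> z * g (x - \<kappa> *\<^sub>R z)) \<le> norm (\<Theta> z) * (A * \<langle>x - \<kappa> *\<^sub>R z\<rangle> powr - L)"
        unfolding norm_mult by (intro mult_left_mono g) auto
      also have "\<dots> \<le> norm (\<Theta> z) * (A * ((2 powr L * \<langle>z\<rangle> powr L) * \<langle>x\<rangle> powr - L))"
        by (intro mult_left_mono * A) auto
      finally show "norm (\<Theta> z * g (x - \<kappa> *\<^sub>R z)) \<le> (2 powr L * A * \<langle>x\<rangle> powr - L) * (\<langle>z\<rangle> powr L * norm (\<Theta> z))"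
        by (simp add: mult_ac)
    qed
    also have "\<dots> = C * A * \<langle>x\<rangle> powr - L" unfolding C_def by (subst integral_mult_right_zero) (simp only: mult_ac)
    finally show ?thesis .
  qed
  moreover have "0 \<le> C" by (auto simp: C_def)
  ultimately show ?thesis by blast
qed

text \<open>Letting x and \<kappa> vary together gives both continuity in x and the limit \<kappa>
  \<rightarrow> 0 from one dominated convergence.\<close>

lemma tendsto_mollify:
  fixes \<Theta> :: "'a::euclidean_space \<Rightarrow> complex"
  assumes \<Theta>: "integrable lborel \<Theta>" and g: "continuous_on UNIV g" "\<And>x. norm (g x) \<le> B"
    and X: "X \<longlonglongrightarrow> x" and \<kappa>: "\<kappa> \<longlonglongrightarrow> \<kappa>\<^sub>0"
  shows "(\<lambda>n. mollify \<Theta> (\<kappa> n) g (X n)) \<longlonglongrightarrow> mollify \<Theta> \<kappa>\<^sub>0 g x"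
  unfolding mollify_def
proof (rule integral_dominated_convergence[where w = "\<lambda>z. norm (\<Theta> z) * B"])
  have [measurable]: "\<Theta> \<in> borel_measurable borel" using borel_measurable_integrable[OF \<Theta>] by simp
  have [measurable]: "g \<in> borel_measurable borel" using g(1) by (rule borel_measurable_continuous_onI)
  show "(\<lambda>z. \<Theta> z * g (x - \<kappa>\<^sub>0 *\<^sub>R z)) \<in> borel_measurable lborel"
    "(\<lambda>z. \<Theta> z * g (X n - \<kappa> n *\<^sub>R z)) \<in> borel_measurable lborel" for n by measurable
  show "integrable lborel (\<lambda>z. norm (\<Theta> z) * B)" using \<Theta> by auto
  show "AE z in lborel. norm (\<Theta> z * g (X n - \<kappa> n *\<^sub>R z)) \<le> norm (\<Theta> z) * B" for n
    by (auto simp: norm_mult intro!: mult_left_mono g(2))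
  show "AE z in lborel. (\<lambda>n. \<Theta> z * g (X n - \<kappa> n *\<^sub>R z)) \<longlonglongrightarrow> \<Theta> z * g (x - \<kappa>\<^sub>0 *\<^sub>R z)"
    by (intro AE_I2 tendsto_intros continuous_on_tendsto_compose[OF g(1)] X \<kappa>) auto
qed

lemma continuous_on_mollify:
  fixes \<Theta> :: "'a::euclidean_space \<Rightarrow> complex"
  assumes \<Theta>: "integrable lborel \<Theta>" and g: "continuous_on UNIV g" "\<And>x. norm (g x) \<le> B"
  shows "continuous_on UNIV (mollify \<Theta> \<kappa> g)"
  by (rule continuous_on_sequentiallyI) (rule tendsto_mollify[OF assms], auto)

lemma mollify_0: "mollify \<Theta> 0 g x = (\<integral>z. \<Theta> z \<partial>lborel) * g x"
  by (simp add: mollify_def)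

section \<open>Derivatives of mollifications and Fourier transforms\<close>

lemma has_vector_derivative_zero_on_open:
  fixes f :: "'a::euclidean_space \<Rightarrow> complex"
  assumes "open S" "\<xi> \<in> S" "\<And>x. x \<in> S \<Longrightarrow> f x = 0"
  shows "((\<lambda>\<tau>. f (\<xi> + \<tau> *\<^sub>R b)) has_vector_derivative 0) (at 0)"
proof -
  have "((\<lambda>\<tau>. \<xi> + \<tau> *\<^sub>R b) \<longlongrightarrow> \<xi> + 0 *\<^sub>R b) (nhds 0)"
    by (intro tendsto_intros filterlim_ident)
  from topological_tendstoD[OF this assms(1)] assms(2)
  have "\<forall>\<^sub>F \<tau> in nhds 0. \<xi> + \<tau> *\<^sub>R b \<in> S" by simp
  then have ev: "\<forall>\<^sub>F \<tau> in nhds 0. 0 = f (\<xi> + \<tau> *\<^sub>R b)"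
    by eventually_elim (simp add: assms(3))
  have "((\<lambda>\<tau>::real. 0::complex) has_vector_derivative 0) (at 0)" by simp
  then show ?thesis
    by (rule has_vector_derivative_cong_ev[THEN iffD1, rotated 2])
      (use ev eventually_nhds_x_imp_x[OF ev] in \<open>auto elim: eventually_mono\<close>)
qed

lemma symbol_cong_off_0:
  assumes eq: "\<And>\<xi>. \<xi> \<noteq> 0 \<Longrightarrow> f \<xi> = g \<xi>" and f: "symbol b s A k t f"
  shows "symbol b s A k t g"
proof -
  have bd: "symbol_bound s A t g" if "symbol_bound s A t f"
  proof -
    have "continuous_on (- {0}) g"
      using that continuous_on_cong[of "- {0}" "- {0}" f g] eq by (auto simp: symbol_bound_def)
    then show ?thesis using that eq by (auto simp: symbol_bound_def)
  qed
  show ?thesis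
  proof (cases k)
    case 0
    then show ?thesis using bd f by simp
  next
    case (Suc n)
    then obtain f' where f': "\<forall>\<xi>. \<xi> \<noteq> 0 \<longrightarrow> ((\<lambda>\<tau>. f (\<xi> + \<tau> *\<^sub>R b)) has_vector_derivative f' \<xi>) (at 0)"
      and sf: "symbol b s A n (t + 1) f'" "symbol_bound s A t f" using f by auto
    show ?thesis unfolding Suc
    proof (rule symbol_SucI[OF bd[OF sf(2)] sf(1)])
      fix \<xi> :: 'a assume \<xi>: "\<xi> \<noteq> 0"
      have ev: "\<forall>\<^sub>F \<tau> in nhds 0. f (\<xi> + \<tau> *\<^sub>R b) = g (\<xi> + \<tau> *\<^sub>R b)"
        using eventually_line_ne_0[OF \<xi>, of b] by eventually_elim (simp add: eq)
      from f'[rule_format, OF \<xi>]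
      show "((\<lambda>\<tau>. g (\<xi> + \<tau> *\<^sub>R b)) has_vector_derivative f' \<xi>) (at 0)"
        by (rule has_vector_derivative_cong_ev[THEN iffD1, rotated 2])
          (use ev eventually_nhds_x_imp_x[OF ev] in \<open>auto elim: eventually_mono\<close>)
    qed
  qed
qed

definition supported_in_shell :: "real \<Rightarrow> real \<Rightarrow> ('a::euclidean_space \<Rightarrow> complex) \<Rightarrow> bool" where
  "supported_in_shell \<rho> R f \<longleftrightarrow> (\<forall>\<xi>. norm \<xi> < \<rho> \<or> R < norm \<xi> \<longrightarrow> f \<xi> = 0)"

lemma shell_symbol_continuous:
  fixes f :: "'a::euclidean_space \<Rightarrow> complex"
  assumes "supported_in_shell \<rho> R f" "0 < \<rho>" "continuous_on (- {0}) f"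
  shows "continuous_on UNIV f"
proof -
  have "continuous_on (- {0} \<union> ball 0 \<rho>) f"
  proof (rule continuous_on_open_Un)
    show "continuous_on (ball 0 \<rho>) f"
      using continuous_on_cong[of "ball 0 \<rho>" "ball 0 \<rho>" f "\<lambda>_. 0"] assms(1)
      by (auto simp: supported_in_shell_def)
  qed (use assms in auto)
  moreover have "- {0} \<union> ball 0 \<rho> = (UNIV :: 'a set)" using assms(2) by auto
  ultimately show ?thesis by simp
qed

text \<open>The witness inside \<open>symbol\<close> is arbitrary at 0, so it is reset to 0 there;
  off the shell, uniqueness of derivatives forces it to vanish. The outcome is a derivative at every
  point, supported in the same shell.\<close>

lemma shell_symbol_derivative:
  fixes f :: "'a::euclidean_space \<Rightarrow> complex"
  assumes f: "supported_in_shell \<rho> R f" and \<rho>: "0 < \<rho>" and sym: "symbol b s A (Suc k) t f"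
  obtains g where "supported_in_shell \<rho> R g" "symbol b s A k (t + 1) g"
    "\<And>\<xi>. ((\<lambda>\<tau>. f (\<xi> + \<tau> *\<^sub>R b)) has_vector_derivative g \<xi>) (at 0)"
proof -
  obtain f' where f': "\<And>\<xi>. \<xi> \<noteq> 0 \<Longrightarrow> ((\<lambda>\<tau>. f (\<xi> + \<tau> *\<^sub>R b)) has_vector_derivative f' \<xi>) (at 0)"
    and sf: "symbol b s A k (t + 1) f'" using sym by auto
  have zero: "((\<lambda>\<tau>. f (\<xi> + \<tau> *\<^sub>R b)) has_vector_derivative 0) (at 0)"
    if "norm \<xi> < \<rho> \<or> R < norm \<xi>" for \<xi>
  proof -
    have "open ({x::'a. norm x < \<rho>} \<union> {x. R < norm x})"
      by (intro open_Un open_Collect_less continuous_intros)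
    then show ?thesis
      by (rule has_vector_derivative_zero_on_open) (use that f in \<open>auto simp: supported_in_shell_def\<close>)
  qed
  define g where "g \<xi> = (if \<xi> = 0 then 0 else f' \<xi>)" for \<xi>
  have "((\<lambda>\<tau>. f (\<xi> + \<tau> *\<^sub>R b)) has_vector_derivative g \<xi>) (at 0)" for \<xi>
    using f' zero[of 0] \<rho> by (cases "\<xi> = 0") (auto simp: g_def)
  moreover have "g \<xi> = 0" if "norm \<xi> < \<rho> \<or> R < norm \<xi>" for \<xi>
    using vector_derivative_unique_at[OF calculation zero[OF that]] .
  then have "supported_in_shell \<rho> R g" by (auto simp: supported_in_shell_def)
  moreover have "symbol b s A k (t + 1) g"
    by (rule symbol_cong_off_0[OF _ sf]) (simp add: g_def)
  ultimately show ?thesis using that by blast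
qed

lemma shell_symbol_bounded:
  fixes f :: "'a::euclidean_space \<Rightarrow> complex"
  assumes "supported_in_shell \<rho> R f" "0 < \<rho>" "symbol b s A k t f"
  shows "\<exists>B\<ge>0. \<forall>\<xi>. norm (f \<xi>) \<le> B * \<langle>\<xi>\<rangle> powr - L"
proof -
  have c: "continuous_on UNIV f"
    using shell_symbol_continuous[OF assms(1,2)] symbol_imp_bound[OF assms(3)] by (simp add: symbol_bound_def)
  have "continuous_on UNIV (\<lambda>\<xi>. complex_of_real (\<langle>\<xi>\<rangle> powr L) * f \<xi>)"
    using c by (intro continuous_intros) auto
  moreover have "complex_of_real (\<langle>\<xi>\<rangle> powr L) * f \<xi> = 0" if "R < norm \<xi>" for \<xi>
    using assms(1) that by (simp add: supported_in_shell_def)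
  ultimately obtain B where B: "0 \<le> B" "\<And>\<xi>. norm (complex_of_real (\<langle>\<xi>\<rangle> powr L) * f \<xi>) \<le> B"
    using bounded_continuous_support[of _ R] by blast
  have "norm (f \<xi>) \<le> B * \<langle>\<xi>\<rangle> powr - L" for \<xi>
    using B(2)[of \<xi>] by (simp add: norm_mult powr_minus field_simps)
  then show ?thesis using B(1) by blast
qed

lemma has_vector_derivative_quadratic:
  fixes h :: "real \<Rightarrow> 'b::real_normed_vector"
  assumes "\<And>\<tau>. norm (h \<tau> - h 0 - \<tau> *\<^sub>R D) \<le> K * \<tau>\<^sup>2"
  shows "(h has_vector_derivative D) (at 0)"
  unfolding has_vector_derivative_def has_derivative_at
proof (intro conjI)
  show "bounded_linear (\<lambda>x. x *\<^sub>R D)" by (rule bounded_linear_scaleR_left)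
  have "((\<lambda>\<tau>::real. \<bar>K\<bar> * \<bar>\<tau>\<bar>) \<longlongrightarrow> \<bar>K\<bar> * \<bar>0\<bar>) (at 0)" by (intro tendsto_intros)
  then have lim: "((\<lambda>\<tau>::real. \<bar>K\<bar> * \<bar>\<tau>\<bar>) \<longlongrightarrow> 0) (at 0)" by simp
  show "(\<lambda>\<tau>. norm (h (0 + \<tau>) - h 0 - \<tau> *\<^sub>R D) / norm \<tau>) \<midarrow>0\<rightarrow> 0"
  proof (rule tendsto_sandwich[OF _ _ tendsto_const lim])
    show "\<forall>\<^sub>F \<tau> in at 0. norm (h (0 + \<tau>) - h 0 - \<tau> *\<^sub>R D) / norm \<tau> \<le> \<bar>K\<bar> * \<bar>\<tau>\<bar>"
      unfolding eventually_at_filter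
    proof (intro always_eventually allI impI)
      fix \<tau> :: real assume "\<tau> \<noteq> 0"
      have "norm (h \<tau> - h 0 - \<tau> *\<^sub>R D) \<le> \<bar>K\<bar> * \<tau>\<^sup>2"
        by (rule order_trans[OF assms]) (auto intro: mult_right_mono)
      also have "\<bar>K\<bar> * \<tau>\<^sup>2 = \<bar>K\<bar> * \<bar>\<tau>\<bar> * \<bar>\<tau>\<bar>"
        by (simp add: power2_eq_square)
      finally show "norm (h (0 + \<tau>) - h 0 - \<tau> *\<^sub>R D) / norm \<tau> \<le> \<bar>K\<bar> * \<bar>\<tau>\<bar>"
        using \<open>\<tau> \<noteq> 0\<close> by (simp add: divide_le_eq)
    qed
  qed (auto intro!: always_eventually)
qed

text \<open>The remainder is uniform in \<xi>, which justifies differentiating a mollification under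
  the integral sign.\<close>

lemma taylor_line:
  fixes f :: "'a::real_normed_vector \<Rightarrow> complex"
  assumes f1: "\<And>\<xi>. ((\<lambda>\<tau>. f (\<xi> + \<tau> *\<^sub>R b)) has_vector_derivative f1 \<xi>) (at 0)"
    and f2: "\<And>\<xi>. ((\<lambda>\<tau>. f1 (\<xi> + \<tau> *\<^sub>R b)) has_vector_derivative f2 \<xi>) (at 0)"
    and K: "\<And>\<xi>. norm (f2 \<xi>) \<le> K"
  shows "norm (f (\<xi> + \<tau> *\<^sub>R b) - f \<xi> - \<tau> *\<^sub>R f1 \<xi>) \<le> K * \<tau>\<^sup>2"
proof -
  have d1: "((\<lambda>\<tau>. f (\<xi> + \<tau> *\<^sub>R b)) has_vector_derivative f1 (\<xi> + \<tau> *\<^sub>R b)) (at \<tau> within S)" for \<tau> S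
    by (rule has_vector_derivative_at_within, rule has_vector_derivative_line[OF f1])
  have d2: "((\<lambda>\<tau>. f1 (\<xi> + \<tau> *\<^sub>R b)) has_vector_derivative f2 (\<xi> + \<tau> *\<^sub>R b)) (at \<tau> within S)" for \<tau> S
    by (rule has_vector_derivative_at_within, rule has_vector_derivative_line[OF f2])
  have lip: "norm (f1 (\<xi> + y *\<^sub>R b) - f1 (\<xi> + 0 *\<^sub>R b)) \<le> K * norm (y - 0)" for y
    by (rule differentiable_bound[of UNIV _ "\<lambda>\<tau> h. h *\<^sub>R f2 (\<xi> + \<tau> *\<^sub>R b)"])
      (use d2 K in \<open>auto simp: has_vector_derivative_def intro!: onorm_le mult_left_mono
         simp: mult.commute[of K]\<close>)
  have K0: "0 \<le> K" using K[of 0] norm_ge_zero order_trans by blast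
  have "norm (f (\<xi> + \<tau> *\<^sub>R b) - f (\<xi> + 0 *\<^sub>R b) - (\<tau> - 0) *\<^sub>R f1 (\<xi> + 0 *\<^sub>R b)) \<le> norm (\<tau> - 0) * (K * \<bar>\<tau>\<bar>)"
  proof (rule vector_differentiable_bound_linearization[where f' = "\<lambda>\<tau>. f1 (\<xi> + \<tau> *\<^sub>R b)"
        and S = "closed_segment 0 \<tau>"])
    fix y assume "y \<in> closed_segment 0 \<tau>"
    then have "\<bar>y\<bar> \<le> \<bar>\<tau>\<bar>" by (auto simp: closed_segment_eq_real_ivl split: if_splits)
    then show "norm (f1 (\<xi> + y *\<^sub>R b) - f1 (\<xi> + 0 *\<^sub>R b)) \<le> K * \<bar>\<tau>\<bar>"
      using lip[of y] mult_left_mono[OF \<open>\<bar>y\<bar> \<le> \<bar>\<tau>\<bar>\<close> K0] by simp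
  qed (auto intro: d1)
  then show ?thesis by (simp add: power2_eq_square mult_ac)
qed

text \<open>The derivative of a mollification is the mollification of the derivative; the spare
  orders of \<open>f\<close> supply the second derivative that bounds the Taylor remainder. Since
  \<open>f\<close> lives on a shell and the kernel is rapid, every weight -L is reached, with
  constants independent of \<kappa>.\<close>

lemma symbol_mollify:
  fixes \<Theta> :: "'a::euclidean_space \<Rightarrow> complex"
  assumes \<Theta>: "rapid \<Theta>" and \<rho>: "0 < \<rho>" and L: "0 \<le> L"
  shows "supported_in_shell \<rho> R f \<Longrightarrow> symbol b s A (k + 2) t\<^sub>0 f \<Longrightarrow> 0 \<le> t \<Longrightarrow>
    \<exists>B\<ge>0. \<forall>\<kappa>\<in>{0..1}. symbol b (- L) B k t (mollify \<Theta> \<kappa> f)"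
proof (induction k arbitrary: f t t\<^sub>0)
  have *: "\<exists>B\<ge>0. \<forall>\<kappa>\<in>{0..1}. symbol_bound (- L) B t (mollify \<Theta> \<kappa> f)"
    if f: "supported_in_shell \<rho> R f" "symbol b s A k t\<^sub>0 f" and t: "0 \<le> t" for f t\<^sub>0 t k
  proof -
    have c: "continuous_on UNIV f"
      using shell_symbol_continuous[OF f(1) \<rho>] symbol_imp_bound[OF f(2)] by (simp add: symbol_bound_def)
    \<comment> \<open>Decay L + t rather than L: the surplus \<langle>\<xi>\<rangle>^-t is spent on
      |\<xi>|^-t.\<close>
    obtain B where B: "0 \<le> B" "\<And>\<xi>. norm (f \<xi>) \<le> B * \<langle>\<xi>\<rangle> powr - (L + t)"
      using shell_symbol_bounded[OF f(1) \<rho> f(2)] by blast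
    obtain B0 where B0: "\<And>\<xi>. norm (f \<xi>) \<le> B0 * \<langle>\<xi>\<rangle> powr - 0"
      using shell_symbol_bounded[OF f(1) \<rho> f(2)] by blast
    have "0 \<le> L + t" using L t by simp
    from mollify_bound[OF \<Theta> this] obtain C where C: "0 \<le> C"
      "\<And>A g \<kappa> x. 0 \<le> \<kappa> \<Longrightarrow> \<kappa> \<le> 1 \<Longrightarrow> g \<in> borel_measurable borel \<Longrightarrow>
       (\<forall>x. norm (g x) \<le> A * \<langle>x\<rangle> powr - (L + t)) \<Longrightarrow> norm (mollify \<Theta> \<kappa> g x) \<le> C * A * \<langle>x\<rangle> powr - (L + t)"
      by blast
    have "symbol_bound (- L) (C * B) t (mollify \<Theta> \<kappa> f)" if \<kappa>: "\<kappa> \<in> {0..1}" for \<kappa>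
      unfolding symbol_bound_def
    proof (intro conjI allI impI)
      show "continuous_on (- {0}) (mollify \<Theta> \<kappa> f)"
        by (rule continuous_on_subset[OF continuous_on_mollify[OF rapid_integrable[OF \<Theta>] c, of B0]])
          (use B0 in auto)
      fix \<xi> :: 'a assume \<xi>: "\<xi> \<noteq> 0"
      have "norm (mollify \<Theta> \<kappa> f \<xi>) \<le> C * B * \<langle>\<xi>\<rangle> powr - (L + t)"
        by (rule C(2)) (use \<kappa> B borel_measurable_continuous_onI[OF c] in auto)
      also have "\<langle>\<xi>\<rangle> powr - (L + t) = \<langle>\<xi>\<rangle> powr - L * \<langle>\<xi>\<rangle> powr - t" by (simp flip: powr_add)
      also have "C * B * \<dots> \<le> C * B * (\<langle>\<xi>\<rangle> powr - L * norm \<xi> powr - t)"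
        using \<xi> B(1) C(1) t japanese_ge_norm[of \<xi>] by (intro mult_left_mono powr_minus_antimono) auto
      finally show "norm (mollify \<Theta> \<kappa> f \<xi>) \<le> C * B * \<langle>\<xi>\<rangle> powr - L * norm \<xi> powr - t"
        by (simp add: mult.assoc)
    qed
    then show ?thesis using B(1) C(1) by (intro exI[of _ "C * B"]) auto
  qed
  {
    case 0
    then show ?case using *[of f "0 + 2" t\<^sub>0 t] by (simp only: symbol.simps)
  next
    case (Suc k)
    have sym: "symbol b s A (Suc (Suc (Suc k))) t\<^sub>0 f" using Suc.prems(2) by simp
    obtain f1 where f1: "supported_in_shell \<rho> R f1" "symbol b s A (Suc (Suc k)) (t\<^sub>0 + 1) f1"
      "\<And>\<xi>. ((\<lambda>\<tau>. f (\<xi> + \<tau> *\<^sub>R b)) has_vector_derivative f1 \<xi>) (at 0)"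
      using shell_symbol_derivative[OF Suc.prems(1) \<rho> sym] by blast
    obtain f2 where f2: "supported_in_shell \<rho> R f2" "symbol b s A (Suc k) (t\<^sub>0 + 1 + 1) f2"
      "\<And>\<xi>. ((\<lambda>\<tau>. f1 (\<xi> + \<tau> *\<^sub>R b)) has_vector_derivative f2 \<xi>) (at 0)"
      using shell_symbol_derivative[OF f1(1) \<rho> f1(2)] by blast
    obtain K where K: "0 \<le> K" "\<And>\<xi>. norm (f2 \<xi>) \<le> K * \<langle>\<xi>\<rangle> powr - 0"
      using shell_symbol_bounded[OF f2(1) \<rho> f2(2)] by blast
    obtain B1 where B1: "0 \<le> B1" "\<And>\<xi>. norm (f1 \<xi>) \<le> B1 * \<langle>\<xi>\<rangle> powr - 0"
      using shell_symbol_bounded[OF f1(1) \<rho> f1(2)] by blast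
    obtain B0 where B0: "0 \<le> B0" "\<And>\<xi>. norm (f \<xi>) \<le> B0 * \<langle>\<xi>\<rangle> powr - 0"
      using shell_symbol_bounded[OF Suc.prems(1) \<rho> sym] by blast
    have [measurable]: "f \<in> borel_measurable borel" "f1 \<in> borel_measurable borel"
      using shell_symbol_continuous[OF Suc.prems(1) \<rho>] symbol_imp_bound[OF sym]
        shell_symbol_continuous[OF f1(1) \<rho>] symbol_imp_bound[OF f1(2)]
      by (auto simp: symbol_bound_def intro: borel_measurable_continuous_onI)
    have i\<Theta>: "integrable lborel \<Theta>" by (rule rapid_integrable[OF \<Theta>])
    define I where "I = (\<integral>z. norm (\<Theta> z) \<partial>lborel)"
    obtain E1 where E1: "0 \<le> E1" "\<And>\<kappa>. \<kappa> \<in> {0..1} \<Longrightarrow> symbol b (- L) E1 k (t + 1) (mollify \<Theta> \<kappa> f1)"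
      using Suc.IH[OF f1(1), of "t\<^sub>0 + 1" "t + 1"] f1(2) Suc.prems(3) by auto
    obtain E0 where E0: "0 \<le> E0" "\<And>\<kappa>. \<kappa> \<in> {0..1} \<Longrightarrow> symbol_bound (- L) E0 t (mollify \<Theta> \<kappa> f)"
      using *[OF Suc.prems] by blast
    have "symbol b (- L) (max E0 E1) (Suc k) t (mollify \<Theta> \<kappa> f)" if \<kappa>: "\<kappa> \<in> {0..1}" for \<kappa>
    proof (rule symbol_SucI)
      show "symbol_bound (- L) (max E0 E1) t (mollify \<Theta> \<kappa> f)"
        by (rule symbol_bound_mono[OF E0(2)[OF \<kappa>]]) simp
      show "symbol b (- L) (max E0 E1) k (t + 1) (mollify \<Theta> \<kappa> f1)"
        by (rule symbol_mono[OF E1(2)[OF \<kappa>]]) simp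
      fix \<xi> :: 'a
      show "((\<lambda>\<tau>. mollify \<Theta> \<kappa> f (\<xi> + \<tau> *\<^sub>R b)) has_vector_derivative mollify \<Theta> \<kappa> f1 \<xi>) (at 0)"
      proof (rule has_vector_derivative_quadratic[where K = "I * K"])
        fix \<tau> :: real
        have i: "integrable lborel (\<lambda>z. \<Theta> z * f (x - \<kappa> *\<^sub>R z))" for x
          by (rule integrable_mollify[OF i\<Theta>, of _ B0]) (use B0(2) in auto)
        have i1: "integrable lborel (\<lambda>z. \<Theta> z * f1 (x - \<kappa> *\<^sub>R z))" for x
          by (rule integrable_mollify[OF i\<Theta>, of _ B1]) (use B1(2) in auto)
        let ?d = "\<lambda>z. \<Theta> z * (f (\<xi> + \<tau> *\<^sub>R b - \<kappa> *\<^sub>R z) - f (\<xi> - \<kappa> *\<^sub>R z) - \<tau> *\<^sub>R f1 (\<xi> - \<kappa> *\<^sub>R z))"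
        have d: "?d = (\<lambda>z. \<Theta> z * f (\<xi> + \<tau> *\<^sub>R b - \<kappa> *\<^sub>R z) - \<Theta> z * f (\<xi> - \<kappa> *\<^sub>R z) -
            \<tau> *\<^sub>R (\<Theta> z * f1 (\<xi> - \<kappa> *\<^sub>R z)))"
          by (simp add: algebra_simps)
        have id: "integrable lborel ?d"
          unfolding d by (intro Bochner_Integration.integrable_diff integrable_scaleR_right i i1)
        have "mollify \<Theta> \<kappa> f (\<xi> + \<tau> *\<^sub>R b) - mollify \<Theta> \<kappa> f (\<xi> + 0 *\<^sub>R b) - \<tau> *\<^sub>R mollify \<Theta> \<kappa> f1 \<xi> =
            (\<integral>z. ?d z \<partial>lborel)"
          unfolding d mollify_def
          by (subst Bochner_Integration.integral_diff, intro Bochner_Integration.integrable_diff i, intro integrable_scaleR_right i1,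
             subst Bochner_Integration.integral_diff) (auto simp: i)
        also have "norm \<dots> \<le> (\<integral>z. norm (\<Theta> z) * (K * \<tau>\<^sup>2) \<partial>lborel)"
        proof (rule Bochner_Integration.integral_norm_bound_integral[OF id])
          show "integrable lborel (\<lambda>z. norm (\<Theta> z) * (K * \<tau>\<^sup>2))" using i\<Theta> by auto
          fix z
          have "norm (f (\<xi> - \<kappa> *\<^sub>R z + \<tau> *\<^sub>R b) - f (\<xi> - \<kappa> *\<^sub>R z) - \<tau> *\<^sub>R f1 (\<xi> - \<kappa> *\<^sub>R z)) \<le> K * \<tau>\<^sup>2"
            by (rule taylor_line[OF f1(3) f2(3)]) (use K(2) in auto)
          then show "norm (?d z) \<le> norm (\<Theta> z) * (K * \<tau>\<^sup>2)"
            unfolding norm_mult by (intro mult_left_mono) (auto simp: algebra_simps)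
        qed
        also have "\<dots> = I * K * \<tau>\<^sup>2" by (simp add: I_def)
        finally show "norm (mollify \<Theta> \<kappa> f (\<xi> + \<tau> *\<^sub>R b) - mollify \<Theta> \<kappa> f (\<xi> + 0 *\<^sub>R b) - \<tau> *\<^sub>R mollify \<Theta> \<kappa> f1 \<xi>)
            \<le> I * K * \<tau>\<^sup>2" .
      qed
    qed
    then show ?case using E0(1) by (intro exI[of _ "max E0 E1"]) auto
  }
qed

section \<open>Products, dilations and Fourier transforms of smooth functions\<close>

lemma frechet_derivative_eqI: "(f has_derivative f') (at x) \<Longrightarrow> frechet_derivative f (at x) = f'"
  using frechet_derivative_at by metis

lemma Ck_on_add:
  fixes f g :: "'a::euclidean_space \<Rightarrow> complex"
  shows "Ck_on k UNIV f \<Longrightarrow> Ck_on k UNIV g \<Longrightarrow> Ck_on k UNIV (\<lambda>x. f x + g x)"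
proof (induction k arbitrary: f g)
  case 0
  then show ?case by (auto intro: continuous_intros)
next
  case (Suc k)
  have "frechet_derivative (\<lambda>x. f x + g x) (at x) b = frechet_derivative f (at x) b + frechet_derivative g (at x) b" for x b
  proof -
    have "((\<lambda>x. f x + g x) has_derivative (\<lambda>h. frechet_derivative f (at x) h + frechet_derivative g (at x) h)) (at x)"
      using Suc.prems by (intro has_derivative_add) (auto simp: frechet_derivative_works[symmetric])
    from frechet_derivative_eqI[OF this] show ?thesis by simp
  qed
  then show ?case using Suc by auto
qed

lemma Ck_on_mult:
  fixes f g :: "'a::euclidean_space \<Rightarrow> complex"
  shows "Ck_on k UNIV f \<Longrightarrow> Ck_on k UNIV g \<Longrightarrow> Ck_on k UNIV (\<lambda>x. f x * g x)"
proof (induction k arbitrary: f g)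
  case 0
  then show ?case by (auto intro: continuous_intros)
next
  case (Suc k)
  \<comment> \<open>The product rule also contains \<open>f\<close> and \<open>g\<close>
    undifferentiated, so the induction has to know both at the lower order.\<close>
  have low: "Ck_on k UNIV f \<and> Ck_on k UNIV g"
  proof -
    have "Ck_on k UNIV h" if "Ck_on (Suc k) UNIV h" for k and h :: "'a \<Rightarrow> complex"
      using that
    proof (induction k arbitrary: h)
      case 0
      then show ?case using Ck_on_imp_continuous_on[of "Suc 0" UNIV h] by simp
    next
      case (Suc k)
      then show ?case by (simp only: Ck_on.simps) blast
    qed
    then show ?thesis using Suc.prems by blast
  qed
  have "frechet_derivative (\<lambda>x. f x * g x) (at x) b = f x * frechet_derivative g (at x) b + frechet_derivative f (at x) b * g x" for x b
  proof -
    have "((\<lambda>x. f x * g x) has_derivative (\<lambda>h. f x * frechet_derivative g (at x) h + frechet_derivative f (at x) h * g x)) (at x)"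
      using Suc.prems by (intro has_derivative_mult) (auto simp: frechet_derivative_works[symmetric])
    from frechet_derivative_eqI[OF this] show ?thesis by simp
  qed
  then show ?case using Suc low by (auto intro!: Ck_on_add)
qed

text \<open>The factor \<open>a\<close> absorbs the \<open>c\<close> that the chain rule produces at
  each order.\<close>

lemma Ck_on_scale:
  fixes f :: "'a::euclidean_space \<Rightarrow> complex"
  shows "Ck_on k UNIV f \<Longrightarrow> Ck_on k UNIV (\<lambda>x. a * f (c *\<^sub>R x))"
proof (induction k arbitrary: f a)
  case 0
  then show ?case by (auto intro!: continuous_intros continuous_on_compose2[of UNIV f])
next
  case (Suc k)
  have d: "((\<lambda>x. a * f (c *\<^sub>R x)) has_derivative (\<lambda>h. a * frechet_derivative f (at (c *\<^sub>R x)) (c *\<^sub>R h))) (at x)" for x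
  proof -
    have "(f has_derivative frechet_derivative f (at (c *\<^sub>R x))) (at (c *\<^sub>R x))"
      using Suc.prems by (auto simp: frechet_derivative_works[symmetric])
    moreover have "((\<lambda>x. c *\<^sub>R x) has_derivative (\<lambda>h. c *\<^sub>R h)) (at x)"
      by (auto intro!: derivative_eq_intros)
    ultimately show ?thesis
      by (intro has_derivative_mult_right) (rule has_derivative_compose[of "\<lambda>x. c *\<^sub>R x"])
  qed
  have "frechet_derivative (\<lambda>x. a * f (c *\<^sub>R x)) (at x) b = (a * complex_of_real c) * frechet_derivative f (at (c *\<^sub>R x)) b" for x b
  proof -
    have "linear (frechet_derivative f (at (c *\<^sub>R x)))"
      using Suc.prems by (intro linear_frechet_derivative) auto
    then show ?thesis
      by (simp add: frechet_derivative_eqI[OF d] linear_scale scaleR_conv_of_real)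
  qed
  moreover have "Ck_on k UNIV (\<lambda>x. (a * complex_of_real c) * frechet_derivative f (at (c *\<^sub>R x)) b)" if "b \<in> Basis" for b
    using Suc.IH[of "\<lambda>x. frechet_derivative f (at x) b"] Suc.prems that by simp
  moreover have "(\<lambda>x. a * f (c *\<^sub>R x)) differentiable (at x)" for x
    using d unfolding differentiable_def by blast
  ultimately show ?case by simp
qed

lemma exp_quadratic: "norm (exp (- (\<i> * complex_of_real s)) - 1 + \<i> * complex_of_real s) \<le> s\<^sup>2"
proof -
  have "norm (iexp (- s) - (\<Sum>k \<le> 1. (\<i> * complex_of_real (- s)) ^ k / fact k)) \<le> \<bar>- s\<bar> ^ Suc 1 / fact (Suc 1)"
    by (rule iexp_approx1)
  then have "norm (exp (- (\<i> * complex_of_real s)) - 1 + \<i> * complex_of_real s) \<le> s\<^sup>2 / 2"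
    by (simp add: algebra_simps power2_eq_square)
  then show ?thesis by (rule order_trans) simp
qed

text \<open>Compact support bounds |\<xi> \<bullet> h| by R |h|, so the quadratic remainder of the
  exponential integrates to a multiple of |h|^2.\<close>

lemma has_derivative_fourier:
  fixes f :: "'a::euclidean_space \<Rightarrow> complex"
  assumes f: "integrable lborel f" and supp: "\<And>\<xi>. R < norm \<xi> \<Longrightarrow> f \<xi> = 0"
  shows "(fourier f has_derivative (\<lambda>h. fourier (\<lambda>\<xi>. - (\<i> * complex_of_real (\<xi> \<bullet> h)) * f \<xi>) x)) (at x)"
proof -
  have [measurable]: "f \<in> borel_measurable borel" using borel_measurable_integrable[OF f] by simp
  have im: "integrable lborel (\<lambda>\<xi>. - (\<i> * complex_of_real (\<xi> \<bullet> h)) * f \<xi>)" for h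
  proof (rule Bochner_Integration.integrable_bound[of _ "\<lambda>\<xi>. (R * norm h) * norm (f \<xi>)"])
    show "integrable lborel (\<lambda>\<xi>. (R * norm h) * norm (f \<xi>))" using f by auto
    show "AE \<xi> in lborel. norm (- (\<i> * complex_of_real (\<xi> \<bullet> h)) * f \<xi>) \<le> norm ((R * norm h) * norm (f \<xi>))"
    proof (rule AE_I2)
      fix \<xi>
      show "norm (- (\<i> * complex_of_real (\<xi> \<bullet> h)) * f \<xi>) \<le> norm ((R * norm h) * norm (f \<xi>))"
      proof (cases "R < norm \<xi>")
        case False
        have "\<bar>\<xi> \<bullet> h\<bar> \<le> norm \<xi> * norm h" by (rule Cauchy_Schwarz_ineq2)
        also have "\<dots> \<le> \<bar>R * norm h\<bar>" using False by (auto simp: abs_mult intro!: mult_right_mono)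
        finally show ?thesis by (simp add: norm_mult abs_mult mult_right_mono)
      qed (simp add: supp)
    qed
  qed measurable
  define J where "J = (\<integral>\<xi>. R\<^sup>2 * norm (f \<xi>) \<partial>lborel)"
  have est: "norm (fourier f (x + h) - fourier f x - fourier (\<lambda>\<xi>. - (\<i> * complex_of_real (\<xi> \<bullet> h)) * f \<xi>) x) \<le> J * (norm h)\<^sup>2" for h
  proof -
    let ?e = "\<lambda>\<xi> y. fexp \<xi> y"
    let ?d = "\<lambda>\<xi>. ?e \<xi> (x + h) * f \<xi> - ?e \<xi> x * f \<xi> - ?e \<xi> x * (- (\<i> * complex_of_real (\<xi> \<bullet> h)) * f \<xi>)"
    have i: "integrable lborel (\<lambda>\<xi>. ?e \<xi> y * f \<xi>)" for y by (rule integrable_phase[OF f]) measurable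
    have i2: "integrable lborel (\<lambda>\<xi>. ?e \<xi> x * (- (\<i> * complex_of_real (\<xi> \<bullet> h)) * f \<xi>))"
      by (rule integrable_phase[OF im]) measurable
    have m: "(\<lambda>\<xi>. - (\<i> * complex_of_real (\<xi> \<bullet> h)) * f \<xi>) \<in> borel_measurable borel" by measurable
    have "fourier f (x + h) - fourier f x - fourier (\<lambda>\<xi>. - (\<i> * complex_of_real (\<xi> \<bullet> h)) * f \<xi>) x = (\<integral>\<xi>. ?d \<xi> \<partial>lborel)"
      using i i2 by (simp only: fourier_lborel[OF m] fourier_lborel[OF \<open>f \<in> borel_measurable borel\<close>]
          Bochner_Integration.integral_diff Bochner_Integration.integrable_diff)
    also have "norm \<dots> \<le> (\<integral>\<xi>. R\<^sup>2 * norm (f \<xi>) * (norm h)\<^sup>2 \<partial>lborel)"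
    proof (rule Bochner_Integration.integral_norm_bound_integral)
      show "integrable lborel ?d" using i i2 by (intro Bochner_Integration.integrable_diff)
      show "integrable lborel (\<lambda>\<xi>. R\<^sup>2 * norm (f \<xi>) * (norm h)\<^sup>2)" using f by auto
      fix \<xi> :: 'a
      show "norm (?d \<xi>) \<le> R\<^sup>2 * norm (f \<xi>) * (norm h)\<^sup>2"
      proof (cases "R < norm \<xi>")
        case True
        then show ?thesis by (simp add: supp)
      next
        case False
        have "?e \<xi> (x + h) = ?e \<xi> x * ?e \<xi> h"
          by (simp add: inner_add_right ring_distribs flip: exp_add)
        then have "?d \<xi> = ?e \<xi> x * f \<xi> * (?e \<xi> h - 1 + \<i> * complex_of_real (\<xi> \<bullet> h))"
          by (simp add: algebra_simps)
        then have "norm (?d \<xi>) = norm (f \<xi>) * norm (?e \<xi> h - 1 + \<i> * complex_of_real (\<xi> \<bullet> h))"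
          by (simp add: norm_mult)
        also have "\<dots> \<le> norm (f \<xi>) * (\<xi> \<bullet> h)\<^sup>2"
          by (intro mult_left_mono exp_quadratic) auto
        also have "\<dots> \<le> norm (f \<xi>) * (R * norm h)\<^sup>2"
        proof (intro mult_left_mono norm_ge_zero)
          have "\<bar>\<xi> \<bullet> h\<bar> \<le> norm \<xi> * norm h" by (rule Cauchy_Schwarz_ineq2)
          also have "\<dots> \<le> R * norm h" using False by (auto intro!: mult_right_mono)
          finally show "(\<xi> \<bullet> h)\<^sup>2 \<le> (R * norm h)\<^sup>2" by (metis abs_ge_zero power2_abs power_mono)
        qed
        finally show ?thesis by (simp add: power_mult_distrib mult_ac)
      qed
    qed
    also have "\<dots> = J * (norm h)\<^sup>2" by (simp add: J_def)
    finally show ?thesis .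
  qed
  have lin: "linear (\<lambda>h. fourier (\<lambda>\<xi>. - (\<i> * complex_of_real (\<xi> \<bullet> h)) * f \<xi>) x)"
  proof (rule linearI)
    fix h k :: 'a and r :: real
    let ?m = "\<lambda>h \<xi>. - (\<i> * complex_of_real (\<xi> \<bullet> h)) * f \<xi>"
    have i: "integrable lborel (\<lambda>\<xi>. fexp \<xi> x * ?m h \<xi>)" for h
      by (rule integrable_phase[OF im]) measurable
    have e: "fourier (?m h) x = (\<integral>\<xi>. fexp \<xi> x * ?m h \<xi> \<partial>lborel)" for h
      by (rule fourier_lborel) measurable
    have "fourier (?m (h + k)) x = (\<integral>\<xi>. fexp \<xi> x * ?m h \<xi> +
        fexp \<xi> x * ?m k \<xi> \<partial>lborel)"
      unfolding e by (intro Bochner_Integration.integral_cong) (auto simp: inner_add_right algebra_simps)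
    also have "\<dots> = fourier (?m h) x + fourier (?m k) x"
      unfolding e by (rule Bochner_Integration.integral_add[OF i i])
    finally show "fourier (?m (h + k)) x = fourier (?m h) x + fourier (?m k) x" .
    have "fourier (?m (r *\<^sub>R h)) x = (\<integral>\<xi>. r *\<^sub>R (fexp \<xi> x * ?m h \<xi>) \<partial>lborel)"
      unfolding e by (intro Bochner_Integration.integral_cong) (auto simp: scaleR_conv_of_real mult_ac)
    then show "fourier (?m (r *\<^sub>R h)) x = r *\<^sub>R fourier (?m h) x"
      unfolding e by simp
  qed
  show ?thesis
    unfolding has_derivative_at
  proof (intro conjI)
    show "bounded_linear (\<lambda>h. fourier (\<lambda>\<xi>. - (\<i> * complex_of_real (\<xi> \<bullet> h)) * f \<xi>) x)"
      using lin by (simp add: linear_conv_bounded_linear)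
    have "((\<lambda>h::'a. \<bar>J\<bar> * norm h) \<longlongrightarrow> \<bar>J\<bar> * norm (0::'a)) (at 0)" by (intro tendsto_intros)
    then have lim: "((\<lambda>h::'a. \<bar>J\<bar> * norm h) \<longlongrightarrow> 0) (at 0)" by simp
    show "(\<lambda>h. norm (fourier f (x + h) - fourier f x - fourier (\<lambda>\<xi>. - (\<i> * complex_of_real (\<xi> \<bullet> h)) * f \<xi>) x) / norm h) \<midarrow>0\<rightarrow> 0"
    proof (rule tendsto_sandwich[OF _ _ tendsto_const lim])
      show "\<forall>\<^sub>F h in at 0. norm (fourier f (x + h) - fourier f x - fourier (\<lambda>\<xi>. - (\<i> * complex_of_real (\<xi> \<bullet> h)) * f \<xi>) x) / norm h \<le> \<bar>J\<bar> * norm h"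
        unfolding eventually_at_filter
      proof (intro always_eventually allI impI)
        fix h :: 'a assume "h \<noteq> 0"
        have "J * (norm h)\<^sup>2 \<le> \<bar>J\<bar> * (norm h)\<^sup>2" by (intro mult_right_mono) auto
        then have "J * (norm h)\<^sup>2 \<le> \<bar>J\<bar> * norm h * norm h"
          by (simp add: power2_eq_square mult.assoc)
        then show "norm (fourier f (x + h) - fourier f x - fourier (\<lambda>\<xi>. - (\<i> * complex_of_real (\<xi> \<bullet> h)) * f \<xi>) x) / norm h \<le> \<bar>J\<bar> * norm h"
          using \<open>h \<noteq> 0\<close> est[of h] by (simp add: divide_le_eq)
      qed
    qed (auto intro!: always_eventually)
  qed
qed

text \<open>Differentiation multiplies \<open>f\<close> by a linear function and keeps its support,
  so continuity of \<open>f\<close> gives all orders. This is what makes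
  \<open>\<eta> (\<kappa> *\<^sub>R x) * fourier f x\<close> a test function.\<close>

lemma Ck_on_fourier:
  fixes f :: "'a::euclidean_space \<Rightarrow> complex"
  assumes "continuous_on UNIV f" "\<And>\<xi>. R < norm \<xi> \<Longrightarrow> f \<xi> = 0"
  shows "Ck_on k UNIV (fourier f)"
  using assms
proof (induction k arbitrary: f)
  have d: "(fourier f has_derivative (\<lambda>h. fourier (\<lambda>\<xi>. - (\<i> * complex_of_real (\<xi> \<bullet> h)) * f \<xi>) x)) (at x)"
    if "continuous_on UNIV f" "\<And>\<xi>. R < norm \<xi> \<Longrightarrow> f \<xi> = 0" for f :: "'a \<Rightarrow> complex" and x
    using that by (intro has_derivative_fourier continuous_compact_support_integrable) auto
  {
    case 0
    have "isCont (fourier f) x" for x using has_derivative_continuous[OF d[OF 0]] .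
    then show ?case by (simp add: continuous_at_imp_continuous_on)
  next
    case (Suc k)
    have "Ck_on k UNIV (fourier (\<lambda>\<xi>. - (\<i> * complex_of_real (\<xi> \<bullet> b)) * f \<xi>))" for b
      using Suc.prems by (intro Suc.IH) (auto intro!: continuous_intros)
    then show ?case
      using d[OF Suc.prems] by (auto simp: frechet_derivative_eqI[OF d[OF Suc.prems]] differentiable_def)
  }
qed

section \<open>Fourier transforms of integrable symbols\<close>

text \<open>On the support the bracket lies between 1 and 1 + R, so any two weights are comparable;
  derivatives inherit the support by uniqueness.\<close>

lemma symbol_compact_support:
  fixes f :: "'a::euclidean_space \<Rightarrow> complex"
  assumes A: "0 \<le> A" and R: "0 < R"
  shows "symbol b s A k t f \<Longrightarrow> (\<And>\<xi>. R < norm \<xi> \<Longrightarrow> f \<xi> = 0) \<Longrightarrow>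
    symbol b s' (A * (1 + R) powr \<bar>s - s'\<bar>) k t f"
proof (induction k arbitrary: f t)
  let ?D = "(1 + R) powr \<bar>s - s'\<bar>"
  have *: "symbol_bound s' (A * ?D) t f"
    if f: "symbol_bound s A t f" "\<And>\<xi>. R < norm \<xi> \<Longrightarrow> f \<xi> = 0" for f :: "'a \<Rightarrow> complex" and t
    unfolding symbol_bound_def
  proof (intro conjI allI impI)
    show "continuous_on (- {0}) f" using f by (simp add: symbol_bound_def)
    fix \<xi> :: 'a assume \<xi>: "\<xi> \<noteq> 0"
    show "norm (f \<xi>) \<le> A * ?D * \<langle>\<xi>\<rangle> powr s' * norm \<xi> powr - t"
    proof (cases "R < norm \<xi>")
      case True
      then show ?thesis using f A by simp
    next
      case False
      have "\<langle>\<xi>\<rangle> powr s = \<langle>\<xi>\<rangle> powr (s - s') * \<langle>\<xi>\<rangle> powr s'" by (simp flip: powr_add)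
      also have "\<langle>\<xi>\<rangle> powr (s - s') \<le> \<langle>\<xi>\<rangle> powr \<bar>s - s'\<bar>"
        using japanese_ge_1[of \<xi>] by (intro powr_mono) auto
      also have "\<dots> \<le> ?D"
        using japanese_le[of \<xi>] False by (intro powr_mono2) (auto simp: less_imp_le)
      finally have le: "\<langle>\<xi>\<rangle> powr s \<le> ?D * \<langle>\<xi>\<rangle> powr s'" by (simp add: mult_right_mono)
      have "norm (f \<xi>) \<le> A * \<langle>\<xi>\<rangle> powr s * norm \<xi> powr - t"
        using f \<xi> by (simp add: symbol_bound_def)
      also have "\<dots> \<le> A * (?D * \<langle>\<xi>\<rangle> powr s') * norm \<xi> powr - t"
        using A le by (intro mult_left_mono mult_right_mono) auto
      finally show ?thesis by (simp add: mult.assoc)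
    qed
  qed
  {
    case 0
    then show ?case using * by simp
  next
    case (Suc k)
    then obtain f' where f': "\<And>\<xi>. \<xi> \<noteq> 0 \<Longrightarrow> ((\<lambda>\<tau>. f (\<xi> + \<tau> *\<^sub>R b)) has_vector_derivative f' \<xi>) (at 0)"
      and sf: "symbol b s A k (t + 1) f'" and bf: "symbol_bound s A t f" by auto
    have supp: "f' \<xi> = 0" if "R < norm \<xi>" for \<xi>
    proof -
      have "open {x::'a. R < norm x}" by (intro open_Collect_less continuous_intros)
      then have "((\<lambda>\<tau>. f (\<xi> + \<tau> *\<^sub>R b)) has_vector_derivative 0) (at 0)"
        by (rule has_vector_derivative_zero_on_open) (use that Suc.prems in auto)
      moreover have "\<xi> \<noteq> 0" using that R by auto
      ultimately show ?thesis using vector_derivative_unique_at[OF f'] by blast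
    qed
    show ?case
      by (rule symbol_SucI[OF *[OF bf Suc.prems(2)] Suc.IH[OF sf supp] f'])
  }
qed

lemma borel_measurable_off_0:
  fixes f :: "'a::euclidean_space \<Rightarrow> complex"
  assumes "continuous_on (- {0}) f"
  shows "f \<in> borel_measurable borel"
proof -
  have "(\<lambda>x. if x \<in> - {0} then f x else f 0) \<in> borel_measurable borel"
    by (rule borel_measurable_continuous_on_if) (use assms in auto)
  moreover have "(\<lambda>x. if x \<in> - {0} then f x else f 0) = f" by auto
  ultimately show ?thesis by simp
qed

lemma symbol_measurable: "symbol b s A k t f \<Longrightarrow> f \<in> borel_measurable borel"
  using borel_measurable_off_0 symbol_imp_bound unfolding symbol_bound_def by blast

lemma symbol_decay_integrable:
  fixes f :: "'a::euclidean_space \<Rightarrow> complex"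
  assumes "symbol b (- (real DIM('a) + 1)) A k 0 f" "0 \<le> A"
  shows "integrable lborel f"
    and "(\<integral>x. norm (f x) \<partial>lborel) \<le> A * (\<integral>x. \<langle>x::'a\<rangle> powr - (real DIM('a) + 1) \<partial>lborel)"
proof -
  have [measurable]: "f \<in> borel_measurable borel" by (rule symbol_measurable[OF assms(1)])
  let ?w = "\<lambda>x::'a. \<langle>x\<rangle> powr - (real DIM('a) + 1)"
  have w: "integrable lborel ?w" by (rule integrable_japanese) simp
  have le: "AE x in lborel. norm (f x) \<le> A * ?w x"
  proof -
    have "AE x in lborel. x \<noteq> (0::'a)" by (rule AE_lborel_singleton)
    then show ?thesis
      by eventually_elim (use symbol_imp_bound[OF assms(1)] in \<open>simp add: symbol_bound_def\<close>)
  qed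
  show f: "integrable lborel f"
    by (rule Bochner_Integration.integrable_bound[OF integrable_mult_right[OF w, of A]])
      (use le assms(2) in \<open>auto elim!: eventually_mono\<close>)
  have "(\<integral>x. norm (f x) \<partial>lborel) \<le> (\<integral>x. A * ?w x \<partial>lborel)"
    by (intro integral_mono_AE integrable_norm f integrable_mult_right w le)
  then show "(\<integral>x. norm (f x) \<partial>lborel) \<le> A * (\<integral>x. \<langle>x::'a\<rangle> powr - (real DIM('a) + 1) \<partial>lborel)" by simp
qed

lemma symbol_weaken:
  fixes f :: "'a::euclidean_space \<Rightarrow> complex"
  assumes "symbol b s A k t f" "0 \<le> A" "s \<le> s'"
  shows "symbol b s' A k t f"
proof -
  have "symbol b s' (A * 1) k (t + 0) f"
    by (rule symbol_reweight[OF _ assms(2,1)]) (use assms(3) japanese_ge_1 in \<open>auto intro: powr_mono\<close>)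
  then show ?thesis by simp
qed

text \<open>For |x| > 1 this is the case r = 0 of \<open>fourier_kernel_bound\<close>; for |x| \<le>
  1 the L1 norm is used, which the weight -(d + 1) bounds linearly in \<open>A\<close>.\<close>

lemma fourier_symbol_bound:
  "\<exists>C\<ge>0. \<forall>A\<ge>0. \<forall>f. (\<forall>b\<in>Basis. symbol b (- (real DIM('a) + 1)) A (Suc DIM('a)) 0 f) \<longrightarrow>
    (\<forall>x::'a::euclidean_space. norm (fourier f x) \<le> C * A * \<langle>x\<rangle> powr - real DIM('a))"
proof -
  define d where "d = real DIM('a)"
  define I where "I = (\<integral>x. \<langle>x::'a\<rangle> powr - (real DIM('a) + 1) \<partial>lborel)"
  have I: "0 \<le> I" by (simp add: I_def)
  have "0 < real DIM('a)" by simp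
  from fourier_kernel_bound[OF order_refl this] obtain C where C: "0 \<le> C"
    "\<And>A f x. 0 \<le> A \<Longrightarrow> integrable lborel f \<Longrightarrow> (\<forall>b\<in>Basis. symbol b 0 A (Suc DIM('a)) 0 f) \<Longrightarrow>
      x \<noteq> (0::'a) \<Longrightarrow> norm (fourier f x) \<le> C * A * norm x powr (0 - d)"
    unfolding d_def by (elim exE conjE) blast
  define E where "E = 2 powr d * (C + I)"
  have "norm (fourier f x) \<le> E * A * \<langle>x\<rangle> powr - d"
    if A: "0 \<le> A" and sym: "\<forall>b\<in>Basis. symbol b (- (real DIM('a) + 1)) A (Suc DIM('a)) 0 f" for A f and x :: 'a
  proof -
    obtain b :: 'a where "b \<in> Basis" using nonempty_Basis by blast
    note int = symbol_decay_integrable[OF sym[rule_format, OF this] A]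
    have sym0: "\<forall>b\<in>Basis. symbol b 0 A (Suc DIM('a)) 0 f"
      using sym symbol_weaken[OF _ A] by (metis add_nonneg_nonneg neg_le_0_iff_le of_nat_0_le_iff zero_le_one)
    have d0: "0 \<le> d" by (simp add: d_def)
    note low = one_le_japanese_powr[OF _ d0, of x] and high = norm_powr_le_japanese[OF _ d0, of x]
    have nn: "0 \<le> C * A * (2 powr d * \<langle>x\<rangle> powr - d)" "0 \<le> A * I * (2 powr d * \<langle>x\<rangle> powr - d)"
      using C(1) A I by auto
    have sum: "E * A * \<langle>x\<rangle> powr - d = C * A * (2 powr d * \<langle>x\<rangle> powr - d) + A * I * (2 powr d * \<langle>x\<rangle> powr - d)"
      by (simp add: E_def algebra_simps)
    show ?thesis
    proof (cases "norm x \<le> 1")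
      case True
      have "norm (fourier f x) \<le> A * I * 1"
        using norm_fourier_le[OF int(1), of x] int(2) by (simp add: I_def)
      also have "\<dots> \<le> A * I * (2 powr d * \<langle>x\<rangle> powr - d)"
        using A I low[OF True] by (intro mult_left_mono) auto
      finally show ?thesis using sum nn by linarith
    next
      case False
      then have "norm (fourier f x) \<le> C * A * norm x powr - d"
        using C(2)[OF A int(1) sym0, of x] False by (cases "x = 0") auto
      also have "\<dots> \<le> C * A * (2 powr d * \<langle>x\<rangle> powr - d)"
        using A C(1) high False by (intro mult_left_mono) auto
      finally show ?thesis using sum nn by linarith
    qed
  qed
  moreover have "0 \<le> E" using C(1) I by (simp add: E_def)
  ultimately show ?thesis unfolding d_def by blast
qed

section \<open>Cutoffs, convolutions and their transposes\<close>

lemma inv_fourier_lborel: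
  fixes g :: "'a::euclidean_space \<Rightarrow> complex"
  assumes [measurable]: "g \<in> borel_measurable borel"
  shows "inv_fourier g x = complex_of_real (1 / (2 * pi) ^ DIM('a)) *
    (\<integral>\<xi>. exp (\<i> * complex_of_real (x \<bullet> \<xi>)) * g \<xi> \<partial>lborel)"
  unfolding inv_fourier_def by (subst integral_completion) auto

lemma inv_fourier_conv_fourier:
  fixes g :: "'a::euclidean_space \<Rightarrow> complex"
  assumes "g \<in> borel_measurable borel"
  shows "inv_fourier g x = complex_of_real (1 / (2 * pi) ^ DIM('a)) * fourier g (- x)"
  by (simp add: inv_fourier_lborel[OF assms] fourier_lborel[OF assms] inner_commute)

lemma lborel_integrable_tensor_bound:
  fixes h :: "'a::euclidean_space \<Rightarrow> 'b::euclidean_space \<Rightarrow> complex"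
  assumes "integrable lborel f" "integrable lborel g"
    and [measurable]: "(\<lambda>(x, y). h x y) \<in> borel_measurable (borel \<Otimes>\<^sub>M borel)"
    and "\<And>x y. norm (h x y) \<le> norm (f x :: complex) * norm (g y :: complex)"
  shows "integrable (lborel \<Otimes>\<^sub>M lborel) (\<lambda>(x, y). h x y)"
proof (rule Bochner_Integration.integrable_bound[OF lborel_integrable_tensor[OF assms(1,2)]])
  have "sets (lborel \<Otimes>\<^sub>M lborel :: ('a \<times> 'b) measure) = sets (borel \<Otimes>\<^sub>M borel)"
    by (intro sets_pair_measure_cong) auto
  then show "(\<lambda>(x, y). h x y) \<in> borel_measurable (lborel \<Otimes>\<^sub>M lborel)"
    using measurable_cong_sets assms(3) by blast
qed (use assms(4) in \<open>auto simp: norm_mult\<close>)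

text \<open>A wide cutoff on one side of the transform is a convolution at scale \<kappa> with the
  inverse transform of \<eta> on the other. Both sides are the same double integral, up to the order
  of integration and a dilation.\<close>

lemma inv_fourier_cutoff:
  fixes \<eta> f :: "'a::euclidean_space \<Rightarrow> complex"
  assumes \<eta>: "integrable lborel \<eta>" and f: "integrable lborel f" and \<kappa>: "0 < \<kappa>"
  shows "inv_fourier (\<lambda>x. \<eta> (\<kappa> *\<^sub>R x) * fourier f x) \<xi> =
    mollify (\<lambda>z. complex_of_real (1 / (2 * pi) ^ DIM('a)) * fourier \<eta> (- z)) \<kappa> f \<xi>"
proof -
  have [measurable]: "\<eta> \<in> borel_measurable borel" "f \<in> borel_measurable borel"
    using assms by (auto dest: borel_measurable_integrable)
  let ?c = "complex_of_real (1 / (2 * pi) ^ DIM('a))"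
  let ?h = "\<lambda>x y. exp (\<i> * complex_of_real (\<xi> \<bullet> x)) * \<eta> (\<kappa> *\<^sub>R x) * (fexp y x * f y)"
  have \<eta>\<kappa>: "integrable lborel (\<lambda>x. \<eta> (\<kappa> *\<^sub>R x))"
    using lborel_integrable_affine[OF \<eta>, of \<kappa> 0] \<kappa> by simp
  have int: "integrable (lborel \<Otimes>\<^sub>M lborel) (\<lambda>(x, y). ?h x y)"
    by (rule lborel_integrable_tensor_bound[OF \<eta>\<kappa> f]) (auto simp: norm_mult)
  have "inv_fourier (\<lambda>x. \<eta> (\<kappa> *\<^sub>R x) * fourier f x) \<xi> = ?c * (\<integral>x. \<integral>y. ?h x y \<partial>lborel \<partial>lborel)"
    by (simp add: inv_fourier_lborel fourier_lborel mult.assoc)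
  also have "(\<integral>x. \<integral>y. ?h x y \<partial>lborel \<partial>lborel) = (\<integral>y. \<integral>x. ?h x y \<partial>lborel \<partial>lborel)"
    by (rule lborel_pair.Fubini_integral[OF int, symmetric])
  also have "\<dots> = (\<integral>y. (1 / \<kappa> ^ DIM('a)) *\<^sub>R (fourier \<eta> ((y - \<xi>) /\<^sub>R \<kappa>) * f y) \<partial>lborel)"
  proof (intro Bochner_Integration.integral_cong refl)
    fix y :: 'a
    let ?e = "\<lambda>w. fexp w ((y - \<xi>) /\<^sub>R \<kappa>) * \<eta> w"
    have "(\<integral>x. ?h x y \<partial>lborel) = (\<integral>x. ?e (0 + \<kappa> *\<^sub>R x) * f y \<partial>lborel)"
    proof (intro Bochner_Integration.integral_cong refl)
      fix x :: 'a
      have "exp (\<i> * complex_of_real (\<xi> \<bullet> x)) * fexp y x =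
          fexp (0 + \<kappa> *\<^sub>R x) ((y - \<xi>) /\<^sub>R \<kappa>)"
      proof -
        have "(0 + \<kappa> *\<^sub>R x) \<bullet> ((y - \<xi>) /\<^sub>R \<kappa>) = y \<bullet> x - \<xi> \<bullet> x"
          using \<kappa> by (simp add: inner_diff_right inner_commute)
        then show ?thesis
          by (simp only: exp_add[symmetric]) (simp add: algebra_simps)
      qed
      then show "?h x y = ?e (0 + \<kappa> *\<^sub>R x) * f y" by (simp add: mult_ac)
    qed
    also have "\<dots> = (\<integral>x. ?e (0 + \<kappa> *\<^sub>R x) \<partial>lborel) * f y" by simp
    also have "(\<integral>x. ?e (0 + \<kappa> *\<^sub>R x) \<partial>lborel) = (1 / \<bar>\<kappa>\<bar> ^ DIM('a)) *\<^sub>R (\<integral>x. ?e x \<partial>lborel)"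
      by (rule lborel_integral_affine) (use \<kappa> in auto)
    also have "(\<integral>x. ?e x \<partial>lborel) = fourier \<eta> ((y - \<xi>) /\<^sub>R \<kappa>)" by (simp add: fourier_lborel)
    finally show "(\<integral>x. ?h x y \<partial>lborel) = (1 / \<kappa> ^ DIM('a)) *\<^sub>R (fourier \<eta> ((y - \<xi>) /\<^sub>R \<kappa>) * f y)"
      using \<kappa> by simp
  qed
  also have "\<dots> = (1 / \<kappa> ^ DIM('a)) *\<^sub>R (\<integral>y. fourier \<eta> ((y - \<xi>) /\<^sub>R \<kappa>) * f y \<partial>lborel)" by simp
  also have "\<dots> = (\<integral>z. fourier \<eta> (- z) * f (\<xi> - \<kappa> *\<^sub>R z) \<partial>lborel)"
    using lborel_integral_affine[of "\<lambda>y. fourier \<eta> ((y - \<xi>) /\<^sub>R \<kappa>) * f y" "- \<kappa>" \<xi>] \<kappa> by simp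
  finally show ?thesis by (simp add: mollify_def mult.assoc)
qed

text \<open>Transposing a convolution with the inverse transform of \<open>a\<close> gives
  multiplication by \<open>a\<close> on the inverse transform of \<phi>. It moves the low-frequency
  part of p(D) from u onto the test function.\<close>

lemma fourier_convolve_inv_fourier:
  fixes a \<phi> :: "'a::euclidean_space \<Rightarrow> complex"
  assumes a: "integrable lborel a" and \<phi>: "integrable lborel \<phi>"
  shows "(\<integral>x. inv_fourier a (x - y) * \<phi> x \<partial>lborel) = fourier (\<lambda>\<xi>. a \<xi> * inv_fourier \<phi> \<xi>) y"
proof -
  have [measurable]: "a \<in> borel_measurable borel" "\<phi> \<in> borel_measurable borel"
    using assms by (auto dest: borel_measurable_integrable)
  let ?c = "complex_of_real (1 / (2 * pi) ^ DIM('a))"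
  have m[measurable]: "inv_fourier \<phi> \<in> borel_measurable borel"
    unfolding inv_fourier_conv_fourier[OF \<open>\<phi> \<in> borel_measurable borel\<close>] by measurable
  let ?h = "\<lambda>x \<xi>. exp (\<i> * complex_of_real ((x - y) \<bullet> \<xi>)) * a \<xi> * \<phi> x"
  have int: "integrable (lborel \<Otimes>\<^sub>M lborel) (\<lambda>(x, \<xi>). ?h x \<xi>)"
    by (rule lborel_integrable_tensor_bound[OF \<phi> a]) (auto simp: norm_mult)
  have "(\<integral>x. inv_fourier a (x - y) * \<phi> x \<partial>lborel) = ?c * (\<integral>x. \<integral>\<xi>. ?h x \<xi> \<partial>lborel \<partial>lborel)"
  proof -
    have "inv_fourier a (x - y) * \<phi> x = ?c * (\<integral>\<xi>. ?h x \<xi> \<partial>lborel)" for x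
      by (simp add: inv_fourier_lborel)
    then show ?thesis by simp
  qed
  also have "(\<integral>x. \<integral>\<xi>. ?h x \<xi> \<partial>lborel \<partial>lborel) = (\<integral>\<xi>. \<integral>x. ?h x \<xi> \<partial>lborel \<partial>lborel)"
    by (rule lborel_pair.Fubini_integral[OF int, symmetric])
  also have "?c * \<dots> = (\<integral>\<xi>. fexp \<xi> y * (a \<xi> * inv_fourier \<phi> \<xi>) \<partial>lborel)"
  proof -
    have "?c * (\<integral>x. ?h x \<xi> \<partial>lborel) = fexp \<xi> y * (a \<xi> * inv_fourier \<phi> \<xi>)" for \<xi>
    proof -
      have "?h x \<xi> = (fexp \<xi> y * a \<xi>) * (exp (\<i> * complex_of_real (\<xi> \<bullet> x)) * \<phi> x)" for x
      proof -
        have "exp (\<i> * complex_of_real ((x - y) \<bullet> \<xi>)) =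
           fexp \<xi> y * exp (\<i> * complex_of_real (\<xi> \<bullet> x))"
          by (simp add: inner_diff_left inner_commute algebra_simps flip: exp_add)
        then show ?thesis by (simp add: mult_ac)
      qed
      then have "(\<integral>x. ?h x \<xi> \<partial>lborel) = (fexp \<xi> y * a \<xi>) *
          (\<integral>x. exp (\<i> * complex_of_real (\<xi> \<bullet> x)) * \<phi> x \<partial>lborel)"
        by (simp only: integral_mult_right_zero)
      then show ?thesis by (simp add: inv_fourier_lborel mult_ac)
    qed
    then show ?thesis by (simp flip: integral_mult_right_zero)
  qed
  also have "\<dots> = fourier (\<lambda>\<xi>. a \<xi> * inv_fourier \<phi> \<xi>) y"
    by (simp add: fourier_lborel)
  finally show ?thesis .
qed

section \<open>Extension of the equation to functions with Fourier transform off the origin\<close>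

lemma integrable_weighted_mult:
  fixes f g :: "'a::euclidean_space \<Rightarrow> complex"
  assumes [measurable]: "f \<in> borel_measurable borel" "g \<in> borel_measurable borel"
    and f: "\<And>x. norm (f x) \<le> A * \<langle>x\<rangle> powr - s" and g: "\<And>x. norm (g x) \<le> B * \<langle>x\<rangle> powr - t"
    and st: "real DIM('a) < s + t"
  shows "integrable lborel (\<lambda>x. f x * g x)" "\<And>x. norm (f x * g x) \<le> A * B * \<langle>x\<rangle> powr - (s + t)"
proof -
  show *: "norm (f x * g x) \<le> A * B * \<langle>x\<rangle> powr - (s + t)" for x
  proof -
    have "norm (f x * g x) \<le> (A * \<langle>x\<rangle> powr - s) * (B * \<langle>x\<rangle> powr - t)"
      unfolding norm_mult using f[of x] g[of x] by (intro mult_mono) (auto intro: order_trans[OF norm_ge_zero])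
    also have "\<dots> = A * B * (\<langle>x\<rangle> powr - s * \<langle>x\<rangle> powr - t)" by simp
    finally show ?thesis by (simp add: powr_add[symmetric])
  qed
  show "integrable lborel (\<lambda>x. f x * g x)"
  proof (rule Bochner_Integration.integrable_bound[OF integrable_mult_right[OF integrable_japanese[OF st], of "A * B"]])
    show "AE x in lborel. norm (f x * g x) \<le> norm (A * B * \<langle>x\<rangle> powr - (s + t))"
      using order_trans[OF * abs_ge_self] by auto
  qed measurable
qed

lemma dist_of_lborel:
  assumes "f \<in> borel_measurable borel" "\<phi> \<in> borel_measurable borel"
  shows "dist_of f \<phi> = (\<integral>x. f x * \<phi> x \<partial>lborel)"
  unfolding dist_of_def by (rule integral_completion) (use assms in measurable)

lemma convolve_lborel:
  fixes f :: "'a::euclidean_space \<Rightarrow> complex"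
  assumes [measurable]: "f \<in> borel_measurable borel" "g \<in> borel_measurable borel"
  shows "convolve f g x = (\<integral>y. f (x - y) * g y \<partial>lborel)"
  unfolding convolve_def by (rule integral_completion) measurable

section \<open>Test functions and their symbol estimates\<close>

lemma test_function_scale:
  fixes \<eta> :: "'a::euclidean_space \<Rightarrow> complex"
  assumes \<eta>: "test_function \<eta>" and \<kappa>: "0 < \<kappa>"
  shows "test_function (\<lambda>x. \<eta> (\<kappa> *\<^sub>R x))"
proof -
  obtain r where r: "r > 0" "\<And>\<xi>. r < norm \<xi> \<Longrightarrow> \<eta> \<xi> = 0" using test_function_support[OF \<eta>] by blast
  have z: "\<eta> (\<kappa> *\<^sub>R x) = 0" if "r / \<kappa> < norm x" for x
    using r(2)[of "\<kappa> *\<^sub>R x"] that \<kappa> by (simp add: field_simps)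
  have "Ck_on k UNIV (\<lambda>x. 1 * \<eta> (\<kappa> *\<^sub>R x))" for k
    using \<eta> by (intro Ck_on_scale) (auto simp: test_function_def smooth_on_def)
  moreover have "{x. \<eta> (\<kappa> *\<^sub>R x) \<noteq> 0} \<subseteq> cball 0 (r / \<kappa>)"
    using z by (force simp: not_less)
  then have "bounded {x. \<eta> (\<kappa> *\<^sub>R x) \<noteq> 0}"
    using bounded_cball bounded_subset by blast
  then have "compact (closure {x. \<eta> (\<kappa> *\<^sub>R x) \<noteq> 0})" by simp
  ultimately show ?thesis
    by (simp add: test_function_def smooth_on_def)
qed

lemma test_function_mult:
  fixes \<eta> g :: "'a::euclidean_space \<Rightarrow> complex"
  assumes \<eta>: "test_function \<eta>" and g: "\<And>k. Ck_on k UNIV g"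
  shows "test_function (\<lambda>x. \<eta> x * g x)"
proof -
  have "bounded (closure {x. \<eta> x \<noteq> 0})"
    using \<eta> by (intro compact_imp_bounded) (simp add: test_function_def)
  then have "bounded {x. \<eta> x * g x \<noteq> 0}"
    by (rule bounded_subset) (use closure_subset in force)
  then have "compact (closure {x. \<eta> x * g x \<noteq> 0})" by simp
  moreover have "Ck_on k UNIV (\<lambda>x. \<eta> x * g x)" for k
    using \<eta> g by (intro Ck_on_mult) (auto simp: test_function_def smooth_on_def)
  ultimately show ?thesis by (simp add: test_function_def smooth_on_def)
qed

lemma test_function_continuous: "test_function \<eta> \<Longrightarrow> continuous_on UNIV \<eta>"
  unfolding test_function_def smooth_on_def using Ck_on_imp_continuous_on by blast

lemma test_function_integrable: "test_function \<eta> \<Longrightarrow> integrable lborel \<eta>"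
  using continuous_compact_support_integrable[OF test_function_continuous] test_function_support by blast

lemma test_function_bounded: "test_function \<eta> \<Longrightarrow> \<exists>B\<ge>0. \<forall>\<xi>. norm (\<eta> \<xi>) \<le> B"
  using bounded_continuous_support[OF test_function_continuous] test_function_support by blast

text \<open>Symbol bounds of order 0 are invariant under dilation; this is the source of all
  uniformity in the truncation parameters.\<close>

lemma test_function_scaled_symbol:
  assumes "test_function \<eta>"
  shows "\<exists>A\<ge>0. \<forall>b\<in>Basis. \<forall>l\<in>{0<..}. symbol b 0 A k 0 (\<lambda>\<xi>. \<eta> (l *\<^sub>R \<xi>))"
proof (rule symbol_uniform_Basis)
  fix b :: 'a assume b: "b \<in> Basis"
  obtain R where R: "R > 0" "\<And>\<xi>. R < norm \<xi> \<Longrightarrow> \<eta> \<xi> = 0" using test_function_support[OF assms] by blast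
  have "Ck_on k UNIV \<eta>" using assms by (auto simp: test_function_def smooth_on_def)
  from scaled_symbol[OF this R(1) R(2) b order_refl]
  show "\<exists>A. \<forall>l\<in>{0<..}. symbol b 0 A k 0 (\<lambda>\<xi>. \<eta> (l *\<^sub>R \<xi>))" by auto
qed

lemma test_function_symbol:
  assumes "test_function \<eta>"
  shows "\<exists>A\<ge>0. \<forall>b\<in>Basis. symbol b s A k 0 \<eta>"
proof -
  obtain R where R: "R > 0" "\<And>\<xi>. R < norm \<xi> \<Longrightarrow> \<eta> \<xi> = 0" using test_function_support[OF assms] by blast
  obtain A where A': "0 \<le> A" "\<forall>b\<in>Basis. \<forall>l\<in>{0<..}. symbol b 0 A k 0 (\<lambda>\<xi>. \<eta> (l *\<^sub>R \<xi>))"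
    using test_function_scaled_symbol[OF assms, of k] by (elim exE conjE)
  have A: "0 \<le> A" "symbol b 0 A k 0 \<eta>" if "b \<in> Basis" for b
    using A'(1) bspec[OF bspec[OF A'(2) that], of 1] by auto
  have "symbol b s (A * (1 + R) powr \<bar>0 - s\<bar>) k 0 \<eta>" if "b \<in> Basis" for b
    by (rule symbol_compact_support[OF A'(1) R(1) A(2)[OF that] R(2)])
  then show ?thesis using A'(1) by (intro exI[of _ "A * (1 + R) powr \<bar>0 - s\<bar>"]) auto
qed

text \<open>One round of the bootstrap as a linear problem p(D)u = v: the nonlinearity enters only
  through the decay rate \<open>s\<close> of \<open>v\<close>. The rate \<open>\<epsilon>\<close> of
  \<open>u\<close> makes its pairings with functions of size \<langle>x\<rangle>^-d converge
  absolutely.\<close>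

locale elliptic_equation =
  fixes p \<eta> u v :: "'a::euclidean_space \<Rightarrow> complex" and M c Bu \<epsilon> Bv s :: real
  assumes M: "0 < M" and c: "0 < c"
    and p_lower: "\<And>\<xi>. \<xi> \<noteq> 0 \<Longrightarrow> c * \<langle>\<xi>\<rangle> powr M \<le> norm (p \<xi>)"
    and p_symbol: "\<And>k. \<exists>A\<ge>0. \<forall>b\<in>Basis. symbol b M A k 0 p"
    and \<eta>: "test_function \<eta>" and \<eta>_0: "\<forall>\<^sub>F \<xi> in nhds 0. \<eta> \<xi> = 1"
    and u_measurable [measurable]: "u \<in> borel_measurable borel"
    and u_bound: "\<And>x. norm (u x) \<le> Bu * \<langle>x\<rangle> powr - \<epsilon>" and \<epsilon>: "0 < \<epsilon>"
    and v_measurable [measurable]: "v \<in> borel_measurable borel"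
    and v_bound: "\<And>x. norm (v x) \<le> Bv * \<langle>x\<rangle> powr - s" and s: "0 < s"
    and equation: "\<And>\<phi>. test_function \<phi> \<Longrightarrow> fourier_multiplier \<eta> p u \<phi> = dist_of v \<phi>"
begin

section \<open>The low-frequency kernel and the tested equation\<close>

lemma Basis_ex: obtains b :: 'a where "b \<in> Basis"
  using nonempty_Basis by blast

lemma p_measurable [measurable]: "p \<in> borel_measurable borel"
proof -
  obtain b :: 'a where "b \<in> Basis" by (rule Basis_ex)
  then show ?thesis using p_symbol[of 0] symbol_measurable by blast
qed

lemma \<eta>_measurable [measurable]: "\<eta> \<in> borel_measurable borel"
  using borel_measurable_continuous_onI[OF test_function_continuous[OF \<eta>]] .

lemma \<eta>_at_0: "\<eta> 0 = 1"
  using eventually_nhds_x_imp_x[OF \<eta>_0] .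

definition kernel :: "'a \<Rightarrow> complex" where "kernel = inv_fourier (\<lambda>\<xi>. \<eta> \<xi> * p \<xi>)"

lemma \<eta>p_symbol: "\<exists>A\<ge>0. \<forall>b\<in>Basis. symbol b (- (real DIM('a) + 1)) A k 0 (\<lambda>\<xi>. \<eta> \<xi> * p \<xi>)"
proof -
  \<comment> \<open>Compact support allows any weight for \<eta>; this one beats the growth M of
    \<open>p\<close> and leaves the integrable weight -(d + 1).\<close>
  obtain A where A: "0 \<le> A" "\<And>b. b \<in> Basis \<Longrightarrow> symbol b (- (real DIM('a) + 1) - M) A k 0 \<eta>"
    using test_function_symbol[OF \<eta>] by blast
  obtain B where B: "0 \<le> B" "\<And>b. b \<in> Basis \<Longrightarrow> symbol b M B k 0 p"
    using p_symbol by blast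
  have "symbol b (- (real DIM('a) + 1)) (2 ^ k * A * B) k 0 (\<lambda>\<xi>. \<eta> \<xi> * p \<xi>)" if "b \<in> Basis" for b
    using symbol_mult[OF A(1) B(1) A(2)[OF that] B(2)[OF that]] by simp
  then show ?thesis using A(1) B(1) by (intro exI[of _ "2 ^ k * A * B"]) auto
qed

lemma \<eta>p_integrable: "integrable lborel (\<lambda>\<xi>. \<eta> \<xi> * p \<xi>)"
proof -
  obtain b :: 'a where "b \<in> Basis" by (rule Basis_ex)
  then show ?thesis using \<eta>p_symbol[of 0] symbol_decay_integrable(1) by blast
qed

lemma kernel_measurable [measurable]: "kernel \<in> borel_measurable borel"
proof -
  have "kernel = (\<lambda>x. complex_of_real (1 / (2 * pi) ^ DIM('a)) * fourier (\<lambda>\<xi>. \<eta> \<xi> * p \<xi>) (- x))"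
    unfolding kernel_def by (rule ext, rule inv_fourier_conv_fourier) measurable
  also have "\<dots> \<in> borel_measurable borel" by measurable
  finally show ?thesis .
qed

lemma kernel_bound: "\<exists>C\<ge>0. \<forall>x. norm (kernel x) \<le> C * \<langle>x\<rangle> powr - real DIM('a)"
proof -
  obtain C where C: "0 \<le> C" "\<And>A f x. 0 \<le> A \<Longrightarrow>
      (\<forall>b\<in>Basis. symbol b (- (real DIM('a) + 1)) A (Suc DIM('a)) 0 f) \<Longrightarrow>
    norm (fourier f (x::'a)) \<le> C * A * \<langle>x\<rangle> powr - real DIM('a)"
    using fourier_symbol_bound by blast
  obtain A where A: "0 \<le> A" "\<forall>b\<in>Basis. symbol b (- (real DIM('a) + 1)) A (Suc DIM('a)) 0 (\<lambda>\<xi>. \<eta> \<xi> * p \<xi>)"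
    using \<eta>p_symbol by blast
  define e where "e = 1 / (2 * pi) ^ DIM('a)"
  have e: "0 \<le> e" by (simp add: e_def)
  have "norm (kernel x) \<le> e * (C * A) * \<langle>x\<rangle> powr - real DIM('a)" for x
  proof -
    have "kernel x = complex_of_real e * fourier (\<lambda>\<xi>. \<eta> \<xi> * p \<xi>) (- x)"
      unfolding kernel_def e_def by (rule inv_fourier_conv_fourier) measurable
    then show ?thesis
      using mult_left_mono[OF C(2)[OF A, of "- x"] e] e by (simp add: norm_mult mult.assoc)
  qed
  then show ?thesis using A C(1) e by (intro exI[of _ "e * (C * A)"]) auto
qed

lemma convolution_pairing:
  assumes \<phi>: "continuous_on UNIV \<phi>" "\<And>x. R < norm x \<Longrightarrow> \<phi> x = 0"
  shows "dist_of (convolve kernel u) \<phi> = (\<integral>y. u y * fourier (\<lambda>\<xi>. \<eta> \<xi> * p \<xi> * inv_fourier \<phi> \<xi>) y \<partial>lborel)"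
proof -
  define d where "d = real DIM('a)"
  have [measurable]: "\<phi> \<in> borel_measurable borel" using \<phi>(1) by (rule borel_measurable_continuous_onI)
  have i\<phi>: "integrable lborel \<phi>" using continuous_compact_support_integrable[OF \<phi>] .
  have conv: "convolve kernel u x = (\<integral>y. kernel (x - y) * u y \<partial>lborel)" for x
    by (rule convolve_lborel) measurable
  have [measurable]: "convolve kernel u \<in> borel_measurable borel"
    unfolding conv by measurable
  obtain C where C: "0 \<le> C" "\<And>x. norm (kernel x) \<le> C * \<langle>x\<rangle> powr - d"
    using kernel_bound unfolding d_def by blast
  \<comment> \<open>Peetre's inequality separates the variables for Fubini: the decay of the kernel
    moves from x - y to y, where together with the decay of \<open>u\<close> it is integrable, and
    the growth in x is absorbed by the compact support of \<phi>.\<close>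
  let ?f = "\<lambda>x. complex_of_real (C * \<langle>x\<rangle> powr d) * \<phi> x"
  let ?g = "\<lambda>y::'a. complex_of_real (2 powr d * Bu * \<langle>y\<rangle> powr - (d + \<epsilon>))"
  have "continuous_on UNIV ?f" using \<phi>(1) by (intro continuous_intros) auto
  then have f: "integrable lborel ?f"
    using continuous_compact_support_integrable[of ?f R] \<phi>(2) by auto
  have g: "integrable lborel ?g"
    by (intro integrable_of_real integrable_mult_right integrable_japanese) (use \<epsilon> in \<open>simp add: d_def\<close>)
  have int: "integrable (lborel \<Otimes>\<^sub>M lborel) (\<lambda>(x, y). kernel (x - y) * u y * \<phi> x)"
  proof (rule lborel_integrable_tensor_bound[OF f g])
    fix x y :: 'a
    have le: "\<langle>x - y\<rangle> powr - d \<le> 2 powr d * \<langle>x\<rangle> powr d * \<langle>y\<rangle> powr - d"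
      using japanese_powr_shift[of d y x] by (simp add: japanese_minus_commute d_def)
    have "norm (kernel (x - y) * u y) \<le> (C * \<langle>x - y\<rangle> powr - d) * (Bu * \<langle>y\<rangle> powr - \<epsilon>)"
      unfolding norm_mult using C by (intro mult_mono u_bound) auto
    also have "\<dots> \<le> (C * (2 powr d * \<langle>x\<rangle> powr d * \<langle>y\<rangle> powr - d)) * (Bu * \<langle>y\<rangle> powr - \<epsilon>)"
      using C(1) le order_trans[OF norm_ge_zero u_bound[of y]] by (intro mult_left_mono mult_right_mono) auto
    also have "\<dots> = (C * \<langle>x\<rangle> powr d) * (2 powr d * Bu * (\<langle>y\<rangle> powr - d * \<langle>y\<rangle> powr - \<epsilon>))"
      by (simp add: mult_ac)
    also have "\<dots> \<le> norm (C * \<langle>x\<rangle> powr d) * norm (2 powr d * Bu * \<langle>y\<rangle> powr - (d + \<epsilon>))"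
      by (simp add: powr_add[symmetric] flip: abs_mult)
    finally have "norm (kernel (x - y) * u y) * norm (\<phi> x) \<le>
        norm (C * \<langle>x\<rangle> powr d) * norm (2 powr d * Bu * \<langle>y\<rangle> powr - (d + \<epsilon>)) * norm (\<phi> x)"
      by (rule mult_right_mono) simp
    then show "norm (kernel (x - y) * u y * \<phi> x) \<le> norm (?f x) * norm (?g y)"
      unfolding norm_mult norm_of_real real_norm_def by (simp only: mult_ac)
  qed measurable
  have "dist_of (convolve kernel u) \<phi> = (\<integral>x. \<integral>y. kernel (x - y) * u y * \<phi> x \<partial>lborel \<partial>lborel)"
    by (subst dist_of_lborel) (auto simp: conv)
  also have "\<dots> = (\<integral>y. \<integral>x. kernel (x - y) * u y * \<phi> x \<partial>lborel \<partial>lborel)"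
    by (rule lborel_pair.Fubini_integral[OF int, symmetric])
  also have "\<dots> = (\<integral>y. u y * fourier (\<lambda>\<xi>. \<eta> \<xi> * p \<xi> * inv_fourier \<phi> \<xi>) y \<partial>lborel)"
  proof (intro Bochner_Integration.integral_cong refl)
    fix y :: 'a
    have "(\<integral>x. kernel (x - y) * u y * \<phi> x \<partial>lborel) = u y * (\<integral>x. kernel (x - y) * \<phi> x \<partial>lborel)"
      by (simp add: mult_ac flip: integral_mult_right_zero)
    then show "(\<integral>x. kernel (x - y) * u y * \<phi> x \<partial>lborel) = u y * fourier (\<lambda>\<xi>. \<eta> \<xi> * p \<xi> * inv_fourier \<phi> \<xi>) y"
      unfolding kernel_def by (simp add: fourier_convolve_inv_fourier[OF \<eta>p_integrable i\<phi>])
  qed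
  finally show ?thesis .
qed

text \<open>The two halves of p(D)u recombine: the convolution contributes exactly the term \<eta> p
  g that (1 - \<eta>) p g lacks. The decay of \<open>g\<close> makes p g a symbol of weight -(d +
  1), so its transform is of size \<langle>x\<rangle>^-d and each half can be paired with
  \<open>u\<close> separately.\<close>

lemma multiplier_pairing:
  assumes \<phi>: "test_function \<phi>"
    and g: "\<And>\<xi>. inv_fourier \<phi> \<xi> = g \<xi>"
    and g_sym: "0 \<le> A" "\<forall>b\<in>Basis. symbol b (- (M + real DIM('a) + 1)) A (Suc DIM('a)) 0 g"
  shows "(\<integral>x. u x * fourier (\<lambda>\<xi>. p \<xi> * g \<xi>) x \<partial>lborel) = (\<integral>x. v x * \<phi> x \<partial>lborel)"
proof -
  define d where "d = real DIM('a)"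
  define N where "N = Suc DIM('a)"
  obtain b :: 'a where b: "b \<in> Basis" by (rule Basis_ex)
  obtain C where C: "0 \<le> C" "\<And>A f x. 0 \<le> A \<Longrightarrow>
      (\<forall>b\<in>Basis. symbol b (- (d + 1)) A N 0 f) \<Longrightarrow>
    norm (fourier f (x::'a)) \<le> C * A * \<langle>x\<rangle> powr - d"
    using fourier_symbol_bound unfolding d_def N_def by blast
  obtain B where B: "0 \<le> B" "\<And>b. b \<in> Basis \<Longrightarrow> symbol b M B N 0 p" using p_symbol by blast
  obtain E where E: "0 \<le> E" "\<And>b. b \<in> Basis \<Longrightarrow> symbol b 0 E N 0 \<eta>" using test_function_symbol[OF \<eta>] by blast
  have [measurable]: "g \<in> borel_measurable borel" "\<phi> \<in> borel_measurable borel"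
    using symbol_measurable g_sym(2) b borel_measurable_continuous_onI[OF test_function_continuous[OF \<phi>]] by blast+
  define B1 where "B1 = 2 ^ N * B * A"
  define B2 where "B2 = 2 ^ N * E * B1"
  have B12: "0 \<le> B1" "0 \<le> B2" using B(1) E(1) g_sym(1) by (auto simp: B1_def B2_def)
  have pg: "\<forall>b\<in>Basis. symbol b (- (d + 1)) B1 N 0 (\<lambda>\<xi>. p \<xi> * g \<xi>)"
  proof
    fix b :: 'a assume b: "b \<in> Basis"
    have "symbol b (M + - (M + real DIM('a) + 1)) (2 ^ N * B * A) N (0 + 0) (\<lambda>\<xi>. p \<xi> * g \<xi>)"
      by (rule symbol_mult[OF B(1) g_sym(1) B(2)[OF b]]) (use g_sym(2) b in \<open>auto simp: N_def\<close>)
    moreover have "M + - (M + real DIM('a) + 1) = - (d + 1)" by (simp add: d_def)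
    ultimately show "symbol b (- (d + 1)) B1 N 0 (\<lambda>\<xi>. p \<xi> * g \<xi>)" by (simp add: B1_def)
  qed
  have \<eta>pg: "\<forall>b\<in>Basis. symbol b (- (d + 1)) B2 N 0 (\<lambda>\<xi>. \<eta> \<xi> * (p \<xi> * g \<xi>))"
  proof
    fix b :: 'a assume b: "b \<in> Basis"
    have "symbol b (0 + - (d + 1)) (2 ^ N * E * B1) N (0 + 0) (\<lambda>\<xi>. \<eta> \<xi> * (p \<xi> * g \<xi>))"
      by (rule symbol_mult[OF E(1) B12(1) E(2)[OF b]]) (use pg b in auto)
    then show "symbol b (- (d + 1)) B2 N 0 (\<lambda>\<xi>. \<eta> \<xi> * (p \<xi> * g \<xi>))" by (simp add: B2_def)
  qed
  have ipg: "integrable lborel (\<lambda>\<xi>. p \<xi> * g \<xi>)" "integrable lborel (\<lambda>\<xi>. \<eta> \<xi> * (p \<xi> * g \<xi>))"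
    using symbol_decay_integrable(1)[OF pg[rule_format, OF b, unfolded d_def] B12(1)]
      symbol_decay_integrable(1)[OF \<eta>pg[rule_format, OF b, unfolded d_def] B12(2)] by auto
  let ?f1 = "fourier (\<lambda>\<xi>. p \<xi> * g \<xi>)" and ?f2 = "fourier (\<lambda>\<xi>. \<eta> \<xi> * (p \<xi> * g \<xi>))"
  have fb: "norm (?f1 x) \<le> C * B1 * \<langle>x\<rangle> powr - d" "norm (?f2 x) \<le> C * B2 * \<langle>x\<rangle> powr - d" for x
    using C(2) B12 pg \<eta>pg by blast+
  have i1: "integrable lborel (\<lambda>x. u x * ?f1 x)"
    by (rule integrable_weighted_mult(1)[OF _ _ u_bound fb(1)]) (use \<epsilon> in \<open>auto simp: d_def\<close>)
  have i2: "integrable lborel (\<lambda>x. u x * ?f2 x)"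
    by (rule integrable_weighted_mult(1)[OF _ _ u_bound fb(2)]) (use \<epsilon> in \<open>auto simp: d_def\<close>)
  have split: "fourier (\<lambda>\<xi>. (1 - \<eta> \<xi>) * p \<xi> * g \<xi>) x = ?f1 x - ?f2 x" for x
    using fourier_diff[OF ipg, of x] by (simp add: algebra_simps)
  obtain R where R: "\<And>x. R < norm x \<Longrightarrow> \<phi> x = 0" using test_function_support[OF \<phi>] by blast
  have "fourier_multiplier \<eta> p u \<phi> = dist_of (convolve kernel u) \<phi> +
      dist_of u (fourier (\<lambda>\<xi>. (1 - \<eta> \<xi>) * p \<xi> * g \<xi>))"
    by (simp add: fourier_multiplier_def kernel_def dist_inv_fourier_def dist_mult_def dist_fourier_def g)
  also have "dist_of (convolve kernel u) \<phi> = (\<integral>x. u x * ?f2 x \<partial>lborel)"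
    using convolution_pairing[OF test_function_continuous[OF \<phi>] R] by (simp add: g mult.assoc)
  also have "dist_of u (fourier (\<lambda>\<xi>. (1 - \<eta> \<xi>) * p \<xi> * g \<xi>)) =
      (\<integral>x. u x * ?f1 x - u x * ?f2 x \<partial>lborel)"
    by (subst dist_of_lborel) (auto simp: split right_diff_distrib)
  also have "\<dots> = (\<integral>x. u x * ?f1 x \<partial>lborel) - (\<integral>x. u x * ?f2 x \<partial>lborel)"
    by (rule Bochner_Integration.integral_diff[OF i1 i2])
  finally have "fourier_multiplier \<eta> p u \<phi> = (\<integral>x. u x * ?f1 x \<partial>lborel)" by simp
  moreover have "dist_of v \<phi> = (\<integral>x. v x * \<phi> x \<partial>lborel)" by (rule dist_of_lborel) measurable
  ultimately show ?thesis using equation[OF \<phi>] by simp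
qed

text \<open>The inverse Fourier transform of \<eta>. As \<eta> 0 = 1 it has mass one, and its
  dilates form an approximate identity.\<close>

definition inverse_kernel :: "'a \<Rightarrow> complex" where
  "inverse_kernel z = complex_of_real (1 / (2 * pi) ^ DIM('a)) * fourier \<eta> (- z)"

lemma rapid_inverse_kernel: "rapid inverse_kernel"
  unfolding inverse_kernel_def[abs_def] by (intro rapid_reflect rapid_fourier \<eta>)

lemma integral_inverse_kernel: "(\<integral>z. inverse_kernel z \<partial>lborel) = 1"
proof -
  have [measurable]: "fourier \<eta> \<in> borel_measurable borel" by measurable
  have "(\<integral>z. fourier \<eta> (- z) \<partial>lborel) = (\<integral>z. fourier \<eta> z \<partial>lborel)"
    using lborel_integral_reflect[of "fourier \<eta>" 0] by simp
  then show ?thesis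
    by (simp add: inverse_kernel_def integral_fourier_test_function[OF \<eta>] \<eta>_at_0)
qed

text \<open>\<open>fourier f\<close> is approximated by the test functions \<open>\<eta> (\<kappa> *\<^sub>R x) * fourier f x\<close>, that is, \<open>f\<close> by
  its mollifications, which satisfy symbol estimates uniformly in \<open>\<kappa>\<close>.\<close>

lemma shell_pairing:
  assumes shell: "supported_in_shell \<rho> R f" "0 < \<rho>"
    and sym: "\<And>b. b \<in> Basis \<Longrightarrow> \<exists>A\<ge>0. symbol b t A (Suc DIM('a) + 2) 0 f"
  shows "(\<integral>x. u x * fourier (\<lambda>\<xi>. p \<xi> * f \<xi>) x \<partial>lborel) = (\<integral>x. v x * fourier f x \<partial>lborel)"
proof -
  define d where "d = real DIM('a)"
  define N where "N = Suc DIM('a)"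
  \<comment> \<open>The decay required by \<open>multiplier_pairing\<close>: it compensates the
    growth M of \<open>p\<close> and leaves an integrable weight.\<close>
  define L where "L = M + d + 1"
  have L: "0 \<le> L" using M by (simp add: L_def d_def)
  obtain b0 :: 'a where b0: "b0 \<in> Basis" by (rule Basis_ex)
  obtain A0 where "symbol b0 t A0 (N + 2) 0 f" using sym[OF b0] by (auto simp: N_def)
  note sym0 = this
  have cont: "continuous_on UNIV f"
    using shell_symbol_continuous[OF shell] symbol_imp_bound[OF sym0] by (simp add: symbol_bound_def)
  have supp: "f \<xi> = 0" if "R < norm \<xi>" for \<xi> using shell(1) that by (simp add: supported_in_shell_def)
  have if': "integrable lborel f" by (rule continuous_compact_support_integrable[OF cont supp])
  have [measurable]: "f \<in> borel_measurable borel" using borel_measurable_continuous_onI[OF cont] .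
  obtain Bf where Bf: "\<And>\<xi>. norm (f \<xi>) \<le> Bf" using bounded_continuous_support[OF cont supp] by blast
  obtain C where C: "0 \<le> C" "\<And>A f x. 0 \<le> A \<Longrightarrow>
      (\<forall>b\<in>Basis. symbol b (- (d + 1)) A N 0 f) \<Longrightarrow>
    norm (fourier f (x::'a)) \<le> C * A * \<langle>x\<rangle> powr - d"
    using fourier_symbol_bound unfolding d_def N_def by blast
  obtain B where B: "0 \<le> B" "\<And>b. b \<in> Basis \<Longrightarrow> symbol b M B N 0 p" using p_symbol by blast
  obtain B\<eta> where B\<eta>: "0 \<le> B\<eta>" "\<And>\<xi>. norm (\<eta> \<xi>) \<le> B\<eta>" using test_function_bounded[OF \<eta>] by blast
  define \<kappa> where "\<kappa> n = 1 / real (Suc n)" for n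
  have \<kappa>: "0 < \<kappa> n" "\<kappa> n \<in> {0..1}" for n by (auto simp: \<kappa>_def)
  have \<kappa>0: "\<kappa> \<longlonglongrightarrow> 0" unfolding \<kappa>_def by (rule LIMSEQ_Suc[OF lim_1_over_n])
  define g where "g n = mollify inverse_kernel (\<kappa> n) f" for n
  define \<phi> where "\<phi> n x = \<eta> (\<kappa> n *\<^sub>R x) * fourier f x" for n x
  have "\<exists>A\<ge>0. \<forall>b\<in>Basis. \<forall>n\<in>UNIV. symbol b (- L) A N 0 (g n)"
  proof (rule symbol_uniform_Basis)
    fix b :: 'a assume "b \<in> Basis"
    then obtain A where A: "symbol b t A (N + 2) 0 f" using sym unfolding N_def by blast
    show "\<exists>A. \<forall>n\<in>UNIV. symbol b (- L) A N 0 (g n)"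
      using symbol_mollify[OF rapid_inverse_kernel shell(2) L shell(1) A order_refl] \<kappa> unfolding g_def by blast
  qed
  then obtain A where A: "0 \<le> A" "\<And>n. \<forall>b\<in>Basis. symbol b (- L) A N 0 (g n)" by auto
  have g_inv: "inv_fourier (\<phi> n) \<xi> = g n \<xi>" for n \<xi>
    unfolding g_def \<phi>_def inverse_kernel_def[abs_def]
    by (rule inv_fourier_cutoff[OF test_function_integrable[OF \<eta>] if' \<kappa>(1)])
  have \<phi>: "test_function (\<phi> n)" for n
    unfolding \<phi>_def by (intro test_function_mult test_function_scale \<eta> \<kappa>(1) Ck_on_fourier[OF cont supp])
  have eq: "(\<integral>x. u x * fourier (\<lambda>\<xi>. p \<xi> * g n \<xi>) x \<partial>lborel) = (\<integral>x. v x * \<phi> n x \<partial>lborel)" for n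
    by (rule multiplier_pairing[OF \<phi> g_inv A(1)]) (use A(2)[of n] in \<open>simp add: L_def d_def N_def\<close>)
  define B1 where "B1 = 2 ^ N * B * A"
  have B1: "0 \<le> B1" using B(1) A(1) by (simp add: B1_def)
  have pg: "\<forall>b\<in>Basis. symbol b (- (d + 1)) B1 N 0 (\<lambda>\<xi>. p \<xi> * g n \<xi>)" for n
  proof
    fix b :: 'a assume b: "b \<in> Basis"
    have "symbol b (M + - L) (2 ^ N * B * A) N (0 + 0) (\<lambda>\<xi>. p \<xi> * g n \<xi>)"
      by (rule symbol_mult[OF B(1) A(1) B(2)[OF b]]) (use A(2) b in auto)
    then show "symbol b (- (d + 1)) B1 N 0 (\<lambda>\<xi>. p \<xi> * g n \<xi>)" by (simp add: B1_def L_def)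
  qed
  have [measurable]: "g n \<in> borel_measurable borel" for n using symbol_measurable A(2) b0 by blast
  have fb: "norm (fourier (\<lambda>\<xi>. p \<xi> * g n \<xi>) x) \<le> C * B1 * \<langle>x\<rangle> powr - d" for n x
    using C(2) B1 pg by blast
  have g_lim: "(\<lambda>n. g n \<xi>) \<longlonglongrightarrow> f \<xi>" for \<xi>
    using tendsto_mollify[OF rapid_integrable[OF rapid_inverse_kernel] cont Bf tendsto_const \<kappa>0, of \<xi>]
    by (simp add: g_def mollify_0 integral_inverse_kernel)
  have f_lim: "(\<lambda>n. fourier (\<lambda>\<xi>. p \<xi> * g n \<xi>) x) \<longlonglongrightarrow> fourier (\<lambda>\<xi>. p \<xi> * f \<xi>) x" for x
  proof -
    have e: "fourier (\<lambda>\<xi>. p \<xi> * h \<xi>) x = (\<integral>\<xi>. fexp \<xi> x * (p \<xi> * h \<xi>) \<partial>lborel)"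
      if [measurable]: "h \<in> borel_measurable borel" for h
      by (rule fourier_lborel) measurable
    have "(\<lambda>n. \<integral>\<xi>. fexp \<xi> x * (p \<xi> * g n \<xi>) \<partial>lborel)
      \<longlonglongrightarrow> (\<integral>\<xi>. fexp \<xi> x * (p \<xi> * f \<xi>) \<partial>lborel)"
    proof (rule integral_dominated_convergence[where w = "\<lambda>\<xi>. B1 * \<langle>\<xi>\<rangle> powr - (d + 1)"])
      show "integrable lborel (\<lambda>\<xi>::'a. B1 * \<langle>\<xi>\<rangle> powr - (d + 1))"
        by (intro integrable_mult_right integrable_japanese) (simp add: d_def)
      show "AE \<xi> in lborel. (\<lambda>n. fexp \<xi> x * (p \<xi> * g n \<xi>))
          \<longlonglongrightarrow> fexp \<xi> x * (p \<xi> * f \<xi>)"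
        by (intro AE_I2 tendsto_intros g_lim)
      show "AE \<xi> in lborel. norm (fexp \<xi> x * (p \<xi> * g n \<xi>)) \<le> B1 * \<langle>\<xi>\<rangle> powr - (d + 1)" for n
      proof -
        have "AE \<xi> in lborel. \<xi> \<noteq> (0::'a)" by (rule AE_lborel_singleton)
        then show ?thesis
        proof eventually_elim
          case (elim \<xi>)
          have "norm (fexp \<xi> x * (p \<xi> * g n \<xi>)) = norm (p \<xi> * g n \<xi>)"
            by (simp add: norm_mult)
          then show ?case
            using symbol_imp_bound[OF pg[rule_format, OF b0, of n]] elim by (simp add: symbol_bound_def)
        qed
      qed
    qed measurable
    then show ?thesis by (simp add: e)
  qed
  \<comment> \<open>The transforms are bounded by a multiple of \<langle>x\<rangle>^-d uniformly in
    n, because the symbol constant of the mollifications is; the decay of \<open>u\<close> adds the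
    \<epsilon> that makes the majorant integrable.\<close>
  have "(\<lambda>n. \<integral>x. u x * fourier (\<lambda>\<xi>. p \<xi> * g n \<xi>) x \<partial>lborel) \<longlonglongrightarrow> (\<integral>x. u x * fourier (\<lambda>\<xi>. p \<xi> * f \<xi>) x \<partial>lborel)"
  proof (rule integral_dominated_convergence[where w = "\<lambda>x. Bu * (C * B1) * \<langle>x\<rangle> powr - (\<epsilon> + d)"])
    show "integrable lborel (\<lambda>x::'a. Bu * (C * B1) * \<langle>x\<rangle> powr - (\<epsilon> + d))"
      by (intro integrable_mult_right integrable_japanese) (use \<epsilon> in \<open>simp add: d_def\<close>)
    show "AE x in lborel. (\<lambda>n. u x * fourier (\<lambda>\<xi>. p \<xi> * g n \<xi>) x) \<longlonglongrightarrow> u x * fourier (\<lambda>\<xi>. p \<xi> * f \<xi>) x"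
      by (intro AE_I2 tendsto_intros f_lim)
    show "AE x in lborel. norm (u x * fourier (\<lambda>\<xi>. p \<xi> * g n \<xi>) x) \<le> Bu * (C * B1) * \<langle>x\<rangle> powr - (\<epsilon> + d)" for n
      by (rule AE_I2, rule integrable_weighted_mult(2)[OF _ _ u_bound fb]) (use \<epsilon> in \<open>auto simp: d_def\<close>)
  qed measurable
  moreover have "(\<lambda>n. \<integral>x. v x * \<phi> n x \<partial>lborel) \<longlonglongrightarrow> (\<integral>x. v x * fourier f x \<partial>lborel)"
  proof -
    \<comment> \<open>A one-point index type reduces \<open>symbol_uniform_Basis\<close> to
      uniformity over the directions.\<close>
    have "\<exists>A\<ge>0. \<forall>b\<in>Basis. \<forall>n\<in>UNIV. symbol b (- (d + 1)) A N 0 ((\<lambda>_::unit. f) n)"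
    proof (rule symbol_uniform_Basis)
      fix b :: 'a assume b: "b \<in> Basis"
      have 2: "N + 2 = Suc (Suc N)" by simp
      obtain A where A: "0 \<le> A" "symbol b t A N 0 f"
        using sym[OF b] symbol_Suc_imp unfolding N_def[symmetric] 2 by metis
      have "symbol b (- (d + 1)) (A * (1 + max 1 R) powr \<bar>t - - (d + 1)\<bar>) N 0 f"
        by (rule symbol_compact_support[OF A(1) _ A(2)]) (use supp in auto)
      then show "\<exists>A. \<forall>n\<in>UNIV. symbol b (- (d + 1)) A N 0 f" by blast
    qed
    then obtain A where A: "0 \<le> A" "\<forall>b\<in>Basis. symbol b (- (d + 1)) A N 0 f" by auto
    have ff: "norm (fourier f x) \<le> C * A * \<langle>x\<rangle> powr - d" for x by (rule C(2)[OF A])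
    have \<phi>b: "norm (\<phi> n x) \<le> B\<eta> * (C * A) * \<langle>x\<rangle> powr - d" for n x
      unfolding \<phi>_def norm_mult using mult_mono[OF B\<eta>(2) ff B\<eta>(1) norm_ge_zero] by (simp add: mult.assoc)
    have [measurable]: "\<phi> n \<in> borel_measurable borel" for n unfolding \<phi>_def by measurable
    show ?thesis
    proof (rule integral_dominated_convergence[where w = "\<lambda>x. Bv * (B\<eta> * (C * A)) * \<langle>x\<rangle> powr - (s + d)"])
      show "integrable lborel (\<lambda>x::'a. Bv * (B\<eta> * (C * A)) * \<langle>x\<rangle> powr - (s + d))"
        by (intro integrable_mult_right integrable_japanese) (use s in \<open>simp add: d_def\<close>)
      show "AE x in lborel. (\<lambda>n. v x * \<phi> n x) \<longlonglongrightarrow> v x * fourier f x"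
      proof (rule AE_I2)
        fix x :: 'a
        have "(\<lambda>n. \<kappa> n *\<^sub>R x) \<longlonglongrightarrow> 0 *\<^sub>R x" by (intro tendsto_intros \<kappa>0)
        then have "(\<lambda>n. \<eta> (\<kappa> n *\<^sub>R x)) \<longlonglongrightarrow> \<eta> 0"
          by (intro continuous_on_tendsto_compose[OF test_function_continuous[OF \<eta>]]) auto
        then have "(\<lambda>n. v x * (\<eta> (\<kappa> n *\<^sub>R x) * fourier f x)) \<longlonglongrightarrow> v x * (\<eta> 0 * fourier f x)"
          by (intro tendsto_intros)
        then show "(\<lambda>n. v x * \<phi> n x) \<longlonglongrightarrow> v x * fourier f x" by (simp add: \<phi>_def \<eta>_at_0)
      qed
      show "AE x in lborel. norm (v x * \<phi> n x) \<le> Bv * (B\<eta> * (C * A)) * \<langle>x\<rangle> powr - (s + d)" for n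
        by (rule AE_I2, rule integrable_weighted_mult(2)[OF _ _ v_bound \<phi>b]) (use s in \<open>auto simp: d_def\<close>)
    qed measurable
  qed
  ultimately show ?thesis unfolding eq by (rule LIMSEQ_unique)
qed

end

section \<open>Convolution with the kernel and duality\<close>

text \<open>Put y = x - a. For |y| < 1 the brackets of x and a are comparable, and r > 0 makes the
  kernel integrable at the origin. For |y| \<ge> 1 the larger of \<langle>x\<rangle> and
  \<langle>y\<rangle> dominates \<langle>a\<rangle> up to a factor and pays for
  \<langle>a\<rangle>^-t; that the rest is still integrable uses t \<le> d and t < s.\<close>

lemma kernel_convolution:
  assumes r: "0 < r" "r < real DIM('a)" and t: "0 < t" "t \<le> real DIM('a)" "t < s"
  shows "\<exists>C\<ge>0. \<forall>a::'a::euclidean_space.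
    (\<integral>\<^sup>+x. ennreal (\<langle>x\<rangle> powr - s * min (norm (x - a) powr - real DIM('a)) (norm (x - a) powr (r - real DIM('a)))) \<partial>lborel)
      \<le> ennreal (C * \<langle>a\<rangle> powr - t)"
proof -
  define d where "d = real DIM('a)"
  \<comment> \<open>This gap turns the borderline weight d into the integrable weight d + e.\<close>
  define e where "e = s - t"
  have e: "0 < e" using t by (simp add: e_def)
  define k where "k y = min (norm y powr - d) (norm y powr (r - d))" for y :: 'a
  have [measurable]: "k \<in> borel_measurable borel" unfolding k_def by measurable
  let ?h1 = "\<lambda>y::'a. ennreal (norm y powr - (d - r)) * indicator (ball 0 1) y"
  let ?h2 = "\<lambda>y::'a. ennreal (\<langle>y\<rangle> powr - (d + e))"
  have [measurable]: "ball (0::'a) 1 \<in> sets borel" by simp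
  have m1[measurable]: "?h1 \<in> borel_measurable borel" and m2[measurable]: "?h2 \<in> borel_measurable borel"
    by measurable
  define I where "I = (\<integral>\<^sup>+y. ?h1 y + ?h2 y \<partial>lborel) + (\<integral>\<^sup>+y. ?h2 y \<partial>lborel)"
  have "0 \<le> d - r" "d - r < real DIM('a)" using r by (auto simp: d_def)
  from nn_integral_powr_near[OF this] obtain C where
    C: "\<forall>R>0::real. (\<integral>\<^sup>+x. ennreal (norm (x::'a) powr - (d - r)) *
      indicator (ball 0 R) x \<partial>lborel) \<le> ennreal (C * R powr (real DIM('a) - (d - r)))"
    by (elim exE conjE)
  have "(\<integral>\<^sup>+y. ?h1 y \<partial>lborel) < \<infinity>"
    by (rule le_less_trans[OF C[rule_format, OF zero_less_one]]) simp
  moreover have "(\<integral>\<^sup>+y. ?h2 y \<partial>lborel) < \<infinity>"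
    using integrable_japanese[of "d + e", where 'a='a] e by (simp add: integrable_iff_bounded d_def)
  ultimately have "I < \<infinity>"
    unfolding I_def by (subst nn_integral_add) (auto simp: less_top[symmetric] ennreal_add_eq_top)
  then obtain J where J: "0 \<le> J" "I = ennreal J" by (cases I) auto
  \<comment> \<open>The factor 4^t comes from bounding \<langle>a\<rangle> by four times another
    bracket, the factor 2^d from replacing |y| by \<langle>y\<rangle> when |y| \<ge> 1.\<close>
  define D where "D = 4 powr t * 2 powr d"
  have D: "4 powr t \<le> D" "0 \<le> D" using ge_one_powr_ge_zero[of 2 d] by (auto simp: D_def d_def)
  have pt: "ennreal (\<langle>x\<rangle> powr - s * k (x - a)) \<le> ennreal (D * \<langle>a\<rangle> powr - t) * ((?h1 (x - a) + ?h2 (x - a)) + ?h2 x)"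
    for x a :: 'a
  proof -
    define y where "y = x - a"
    have a: "a = x + - y" by (simp add: y_def)
    have le1: "\<langle>a\<rangle> \<le> 2 * \<langle>x\<rangle> * \<langle>y\<rangle>" using japanese_add[of x "- y"] a by simp
    have le2: "\<langle>a\<rangle> \<le> 2 * \<langle>x\<rangle> + 2 * \<langle>y\<rangle>"
      using japanese_le[of a] norm_triangle_ineq4[of x y] a japanese_ge_norm[of x] japanese_ge_norm[of y]
        japanese_ge_1[of x] japanese_ge_1[of y] by simp
    have inv: "\<langle>a\<rangle> powr t * \<langle>a\<rangle> powr - t = 1" by (simp add: powr_minus)
    show ?thesis
    proof (cases "norm y < 1")
      case True
      have "\<langle>y\<rangle> \<le> 2" using japanese_le[of y] True by linarith
      then have "\<langle>x\<rangle> * \<langle>y\<rangle> \<le> \<langle>x\<rangle> * 2" by (intro mult_left_mono) (auto simp: less_imp_le)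
      then have "\<langle>a\<rangle> \<le> 4 * \<langle>x\<rangle>" using le1 by linarith
      then have "(4 * \<langle>x\<rangle>) powr - t \<le> \<langle>a\<rangle> powr - t" using t by (intro powr_minus_antimono) auto
      then have "\<langle>x\<rangle> powr - t \<le> 4 powr t * \<langle>a\<rangle> powr - t"
        by (simp add: powr_mult powr_minus field_simps)
      moreover have "\<langle>x\<rangle> powr - s \<le> \<langle>x\<rangle> powr - t" using t japanese_ge_1[of x] by (intro powr_mono) auto
      ultimately have "\<langle>x\<rangle> powr - s \<le> 4 powr t * \<langle>a\<rangle> powr - t" by linarith
      also have "\<dots> \<le> D * \<langle>a\<rangle> powr - t" using D by (intro mult_right_mono) auto
      finally have "\<langle>x\<rangle> powr - s * k y \<le> (D * \<langle>a\<rangle> powr - t) * norm y powr - (d - r)"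
        using D by (intro mult_mono) (auto simp: k_def)
      then have "ennreal (\<langle>x\<rangle> powr - s * k y) \<le> ennreal (D * \<langle>a\<rangle> powr - t) * ?h1 y"
        using True D by (simp add: ennreal_mult[symmetric] ennreal_leI)
      also have "\<dots> \<le> ennreal (D * \<langle>a\<rangle> powr - t) * ((?h1 y + ?h2 y) + ?h2 x)"
        by (intro mult_left_mono) (auto simp: add.assoc)
      finally show ?thesis by (simp add: y_def)
    next
      case False
      then have "norm y powr - d \<le> 2 powr d * \<langle>y\<rangle> powr - d"
        by (intro norm_powr_le_japanese) (auto simp: d_def)
      then have ky: "k y \<le> 2 powr d * \<langle>y\<rangle> powr - d" by (simp add: k_def)
      define m where "m = max \<langle>x\<rangle> \<langle>y\<rangle>"
      have m: "0 < m" by (simp add: m_def less_max_iff_disj)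
      have "\<langle>a\<rangle> \<le> 4 * m" using le2 by (simp add: m_def)
      then have "(4 * m) powr - t \<le> \<langle>a\<rangle> powr - t" using t by (intro powr_minus_antimono) auto
      then have am: "1 \<le> 4 powr t * \<langle>a\<rangle> powr - t * m powr t"
        using m by (simp add: powr_mult powr_minus field_simps)
      \<comment> \<open>Decay left in the larger bracket is weakened to decay in the smaller one, so
        that all of it sits in one variable: in x if \<langle>x\<rangle> \<le> \<langle>y\<rangle>,
        by t \<le> d, and in y otherwise, by t < s.\<close>
      have main: "m powr t * (\<langle>x\<rangle> powr - s * \<langle>y\<rangle> powr - d) \<le> \<langle>y\<rangle> powr - (d + e) + \<langle>x\<rangle> powr - (d + e)"
      proof (cases "\<langle>x\<rangle> \<le> \<langle>y\<rangle>")
        case True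
        have "\<langle>y\<rangle> powr t * (\<langle>x\<rangle> powr - s * \<langle>y\<rangle> powr - d) = \<langle>x\<rangle> powr - s * (\<langle>y\<rangle> powr t * \<langle>y\<rangle> powr - d)" by simp
        also have "\<langle>y\<rangle> powr t * \<langle>y\<rangle> powr - d = \<langle>y\<rangle> powr - (d - t)" by (simp flip: powr_add)
        also have "\<langle>x\<rangle> powr - s * \<dots> \<le> \<langle>x\<rangle> powr - s * \<langle>x\<rangle> powr - (d - t)"
          using True t by (intro mult_left_mono powr_minus_antimono) (auto simp: d_def)
        also have "\<dots> = \<langle>x\<rangle> powr - (d + e)" unfolding powr_add[symmetric] by (simp add: e_def algebra_simps)
        finally show ?thesis using True by (simp add: m_def max_absorb2 add_increasing)
      next
        case False
        then have le: "\<langle>y\<rangle> \<le> \<langle>x\<rangle>" by simp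
        have "\<langle>x\<rangle> powr t * (\<langle>x\<rangle> powr - s * \<langle>y\<rangle> powr - d) = (\<langle>x\<rangle> powr t * \<langle>x\<rangle> powr - s) * \<langle>y\<rangle> powr - d" by simp
        also have "\<langle>x\<rangle> powr t * \<langle>x\<rangle> powr - s = \<langle>x\<rangle> powr - e" unfolding powr_add[symmetric] by (simp add: e_def)
        also have "\<langle>x\<rangle> powr - e * \<langle>y\<rangle> powr - d \<le> \<langle>y\<rangle> powr - e * \<langle>y\<rangle> powr - d"
          using le e by (intro mult_right_mono powr_minus_antimono) auto
        also have "\<dots> = \<langle>y\<rangle> powr - (d + e)" unfolding powr_add[symmetric] by (simp add: algebra_simps)
        finally show ?thesis using le by (simp add: m_def max_absorb1 add_increasing2)
      qed
      have "\<langle>x\<rangle> powr - s * k y \<le> \<langle>x\<rangle> powr - s * (2 powr d * \<langle>y\<rangle> powr - d) * 1"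
        using ky by (simp add: mult_left_mono)
      also have "\<dots> \<le> \<langle>x\<rangle> powr - s * (2 powr d * \<langle>y\<rangle> powr - d) * (4 powr t * \<langle>a\<rangle> powr - t * m powr t)"
        by (intro mult_left_mono am) auto
      also have "\<dots> = (D * \<langle>a\<rangle> powr - t) * (m powr t * (\<langle>x\<rangle> powr - s * \<langle>y\<rangle> powr - d))"
        by (simp add: D_def mult_ac)
      also have "\<dots> \<le> (D * \<langle>a\<rangle> powr - t) * (\<langle>y\<rangle> powr - (d + e) + \<langle>x\<rangle> powr - (d + e))"
        using D by (intro mult_left_mono main) auto
      finally have "ennreal (\<langle>x\<rangle> powr - s * k y) \<le> ennreal ((D * \<langle>a\<rangle> powr - t) * (\<langle>y\<rangle> powr - (d + e) + \<langle>x\<rangle> powr - (d + e)))"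
        by (rule ennreal_leI)
      also have "\<dots> = ennreal (D * \<langle>a\<rangle> powr - t) * (?h2 y + ?h2 x)"
        using D by (simp add: ennreal_mult)
      also have "\<dots> \<le> ennreal (D * \<langle>a\<rangle> powr - t) * ((?h1 y + ?h2 y) + ?h2 x)"
        by (intro mult_left_mono add_right_mono) auto
      finally show ?thesis by (simp add: y_def)
    qed
  qed
  have "(\<integral>\<^sup>+x. ennreal (\<langle>x\<rangle> powr - s * k (x - a)) \<partial>lborel) \<le> ennreal (D * J * \<langle>a\<rangle> powr - t)" for a
  proof -
    have "(\<integral>\<^sup>+x. ennreal (\<langle>x\<rangle> powr - s * k (x - a)) \<partial>lborel) \<le>
        (\<integral>\<^sup>+x. ennreal (D * \<langle>a\<rangle> powr - t) * ((?h1 (x - a) + ?h2 (x - a)) + ?h2 x) \<partial>lborel)"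
      by (intro nn_integral_mono pt)
    also have "\<dots> = ennreal (D * \<langle>a\<rangle> powr - t) * (\<integral>\<^sup>+x. (?h1 (x - a) + ?h2 (x - a)) + ?h2 x \<partial>lborel)"
      by (rule nn_integral_cmult) measurable
    also have "(\<integral>\<^sup>+x. (?h1 (x - a) + ?h2 (x - a)) + ?h2 x \<partial>lborel) =
        (\<integral>\<^sup>+x. ?h1 (x - a) + ?h2 (x - a) \<partial>lborel) + (\<integral>\<^sup>+x. ?h2 x \<partial>lborel)"
      by (rule nn_integral_add) measurable
    also have "(\<integral>\<^sup>+x. ?h1 (x - a) + ?h2 (x - a) \<partial>lborel) = (\<integral>\<^sup>+y. ?h1 y + ?h2 y \<partial>lborel)"
    proof -
      have "(\<lambda>y. ?h1 y + ?h2 y) \<in> borel_measurable borel" by measurable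
      from lborel_nn_integral_shift[OF this, of "- a"] show ?thesis by simp
    qed
    also have "ennreal (D * \<langle>a\<rangle> powr - t) * (\<dots> + (\<integral>\<^sup>+x. ?h2 x \<partial>lborel)) = ennreal (D * J * \<langle>a\<rangle> powr - t)"
      unfolding I_def[symmetric] J(2) using D J(1) by (simp add: ennreal_mult[symmetric] mult_ac)
    finally show ?thesis .
  qed
  moreover have "0 \<le> D * J" using D J by simp
  ultimately show ?thesis unfolding k_def d_def by blast
qed

text \<open>Testing with the conjugate phase of \<open>u\<close> on the set where |u| > W gives an
  integral of |u| at most that of W over this set, so the set is null. The phase is merely
  measurable and has to be approximated by continuous functions of compact support.\<close>

lemma bounded_by_duality:
  fixes u :: "'a::euclidean_space \<Rightarrow> complex" and W :: "'a \<Rightarrow> real"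
  assumes [measurable]: "u \<in> borel_measurable borel" "W \<in> borel_measurable borel"
    and u: "\<And>x. norm (u x) \<le> B" and W: "\<And>x. 0 \<le> W x" "\<And>x. W x \<le> B'"
    and dual: "\<And>\<phi> R. continuous_on UNIV \<phi> \<Longrightarrow> (\<And>x. R < norm x \<Longrightarrow> \<phi> x = 0) \<Longrightarrow>
      norm (\<integral>x. u x * \<phi> x \<partial>lborel) \<le> (\<integral>x. W x * norm (\<phi> x) \<partial>lborel)"
  shows "AE x in lborel. norm (u x) \<le> W x"
proof -
  have "AE x in lborel. x \<in> ball 0 (real n) \<longrightarrow> norm (u x) \<le> W x" for n
  proof -
    define R where "R = real n"
    define E where "E = {x \<in> ball 0 R. W x < norm (u x)}"
    have E[measurable]: "E \<in> sets borel" unfolding E_def by measurable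
    define \<omega> where "\<omega> x = (if x \<in> E then cnj (u x) / complex_of_real (norm (u x)) else 0)" for x
    have [measurable]: "cnj \<in> borel_measurable borel"
      by (intro borel_measurable_continuous_onI continuous_intros)
    have [measurable]: "\<omega> \<in> borel_measurable borel" unfolding \<omega>_def by measurable
    have u0: "u x \<noteq> 0" if "x \<in> E" for x using that W(1)[of x] by (auto simp: E_def)
    have \<omega>1: "norm (\<omega> x) \<le> 1" for x by (auto simp: \<omega>_def norm_divide)
    \<comment> \<open>By definition of \<open>measurable_on\<close>, \<omega> is then an almost
      everywhere limit of continuous functions.\<close>
    have "\<omega> measurable_on UNIV"
      by (rule lebesgue_measurable_imp_measurable_on) (auto intro: measurable_completion)
    then obtain N g where N: "negligible N" and g: "\<And>n. continuous_on UNIV (g n)"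
      and lim: "\<And>x. x \<notin> N \<Longrightarrow> (\<lambda>n. g n x) \<longlonglongrightarrow> \<omega> x"
      unfolding measurable_on_def by auto
    define cut where "cut x = complex_of_real (max 0 (min 1 (R + 1 - norm x)))" for x :: 'a
    \<comment> \<open>The division brings the modulus down to at most 1 and \<open>cut\<close> gives
      compact support. Neither changes the limit: |\<omega>| \<le> 1, \<omega> vanishes outside the
      ball of radius R, and \<open>cut\<close> is 1 on that ball.\<close>
    define \<phi> where "\<phi> n x = cut x * (g n x / complex_of_real (max 1 (norm (g n x))))" for n x
    have AEN: "AE x in lborel. x \<notin> N"
      using N AE_not_in[of N lebesgue] by (simp add: negligible_iff_null_sets AE_completion_iff)
    have c: "continuous_on UNIV (\<phi> n)" for n
      unfolding \<phi>_def cut_def by (intro continuous_intros g) (auto simp: max_def)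
    have [measurable]: "\<phi> n \<in> borel_measurable borel" for n
      using c by (rule borel_measurable_continuous_onI)
    have supp: "\<phi> n x = 0" if "R + 1 < norm x" for n x using that by (simp add: \<phi>_def cut_def)
    have \<phi>1: "norm (\<phi> n x) \<le> 1" for n x
    proof -
      have "norm (cut x) \<le> 1" by (simp add: cut_def)
      moreover have "norm (g n x / complex_of_real (max 1 (norm (g n x)))) \<le> 1"
        by (auto simp: norm_divide divide_le_eq_1 max_def)
      ultimately show ?thesis unfolding \<phi>_def norm_mult by (intro mult_le_one) auto
    qed
    have \<phi>_lim: "(\<lambda>n. \<phi> n x) \<longlonglongrightarrow> \<omega> x" if "x \<notin> N" for x
    proof -
      have "(\<lambda>n. \<phi> n x) \<longlonglongrightarrow> cut x * (\<omega> x / complex_of_real (max 1 (norm (\<omega> x))))"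
        unfolding \<phi>_def by (intro tendsto_intros lim that) (auto simp: max_def)
      moreover have "cut x * (\<omega> x / complex_of_real (max 1 (norm (\<omega> x)))) = \<omega> x"
        using \<omega>1[of x] by (auto simp: max_def \<omega>_def cut_def E_def)
      ultimately show ?thesis by simp
    qed
    let ?D = "\<lambda>x::'a. indicator (cball 0 (R + 1)) x :: real"
    have iD: "integrable lborel ?D"
      using emeasure_lborel_cball_finite[of "0::'a" "R + 1"] by (intro integrable_real_indicator) auto
    have "(\<lambda>n. \<integral>x. u x * \<phi> n x \<partial>lborel) \<longlonglongrightarrow> (\<integral>x. u x * \<omega> x \<partial>lborel)"
    proof (rule integral_dominated_convergence[where w = "\<lambda>x. B * ?D x"])
      show "integrable lborel (\<lambda>x. B * ?D x)" using iD by (rule integrable_mult_right)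
      show "AE x in lborel. (\<lambda>n. u x * \<phi> n x) \<longlonglongrightarrow> u x * \<omega> x"
        using AEN by eventually_elim (intro tendsto_intros \<phi>_lim)
      show "AE x in lborel. norm (u x * \<phi> n x) \<le> B * ?D x" for n
      proof (rule AE_I2)
        fix x show "norm (u x * \<phi> n x) \<le> B * ?D x"
        proof (cases "R + 1 < norm x")
          case False
          have "norm (u x * \<phi> n x) \<le> B * 1"
            unfolding norm_mult using \<phi>1 u order_trans[OF norm_ge_zero u] by (intro mult_mono) auto
          then show ?thesis using False by simp
        qed (simp add: supp)
      qed
    qed measurable
    moreover have "(\<lambda>n. \<integral>x. W x * norm (\<phi> n x) \<partial>lborel) \<longlonglongrightarrow> (\<integral>x. W x * norm (\<omega> x) \<partial>lborel)"
    proof (rule integral_dominated_convergence[where w = "\<lambda>x. B' * ?D x"])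
      show "integrable lborel (\<lambda>x. B' * ?D x)" using iD by (rule integrable_mult_right)
      show "AE x in lborel. (\<lambda>n. W x * norm (\<phi> n x)) \<longlonglongrightarrow> W x * norm (\<omega> x)"
        using AEN by eventually_elim (intro tendsto_intros \<phi>_lim)
      show "AE x in lborel. norm (W x * norm (\<phi> n x)) \<le> B' * ?D x" for n
      proof (rule AE_I2)
        fix x show "norm (W x * norm (\<phi> n x)) \<le> B' * ?D x"
        proof (cases "R + 1 < norm x")
          case False
          have "W x * norm (\<phi> n x) \<le> B' * 1"
            using \<phi>1 W order_trans[OF W] by (intro mult_mono) auto
          then show ?thesis using False W(1)[of x] by (simp add: abs_mult)
        qed (simp add: supp)
      qed
    qed measurable
    ultimately have "norm (\<integral>x. u x * \<omega> x \<partial>lborel) \<le> (\<integral>x. W x * norm (\<omega> x) \<partial>lborel)"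
      using dual[OF c supp] by (intro tendsto_le[OF _ _ tendsto_norm]) auto
    moreover have "(\<integral>x. u x * \<omega> x \<partial>lborel) = complex_of_real (\<integral>x. norm (u x) * indicator E x \<partial>lborel)"
    proof -
      have "u x * \<omega> x = complex_of_real (norm (u x) * indicator E x)" for x
        using u0[of x] by (auto simp: \<omega>_def complex_norm_square[symmetric] power2_eq_square field_simps
            simp del: of_real_power)
      then show ?thesis by (simp del: of_real_mult)
    qed
    moreover have "W x * norm (\<omega> x) = W x * indicator E x" for x
      using u0[of x] by (auto simp: \<omega>_def norm_divide)
    ultimately have le: "(\<integral>x. norm (u x) * indicator E x \<partial>lborel) \<le> (\<integral>x. W x * indicator E x \<partial>lborel)"
      by simp
    have iE: "integrable lborel (\<lambda>x. norm (u x) * indicator E x)" "integrable lborel (\<lambda>x. W x * indicator E x)"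
    proof -
      have "norm (norm (u x) * indicator E x) \<le> norm (B * ?D x)" for x
        using u[of x] by (auto simp: E_def indicator_def)
      then show "integrable lborel (\<lambda>x. norm (u x) * indicator E x)"
        by (intro Bochner_Integration.integrable_bound[OF integrable_mult_right[OF iD, of B]]) auto
      have "norm (W x * indicator E x) \<le> norm (B' * ?D x)" for x
        using W[of x] by (auto simp: E_def indicator_def)
      then show "integrable lborel (\<lambda>x. W x * indicator E x)"
        by (intro Bochner_Integration.integrable_bound[OF integrable_mult_right[OF iD, of B']]) auto
    qed
    let ?q = "\<lambda>x. norm (u x) * indicator E x - W x * indicator E x"
    have iq: "integrable lborel ?q" by (rule Bochner_Integration.integrable_diff[OF iE])
    have q0: "0 \<le> ?q x" for x by (auto simp: E_def indicator_def)
    have "(\<integral>x. ?q x \<partial>lborel) \<le> 0" using le by (simp add: Bochner_Integration.integral_diff[OF iE])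
    moreover have "0 \<le> (\<integral>x. ?q x \<partial>lborel)" by (intro integral_nonneg_AE AE_I2 q0)
    ultimately have "(\<integral>x. ?q x \<partial>lborel) = 0" by linarith
    then have "AE x in lborel. ?q x = 0"
      using integral_nonneg_eq_0_iff_AE[OF iq] q0 by auto
    then show ?thesis
      by eventually_elim (auto simp: E_def R_def indicator_def split: if_splits)
  qed
  then have "AE x in lborel. \<forall>n. x \<in> ball 0 (real n) \<longrightarrow> norm (u x) \<le> W x"
    unfolding AE_all_countable by blast
  then show ?thesis
  proof eventually_elim
    case (elim x)
    obtain n where "norm x < real n" using reals_Archimedean2 by blast
    then show ?case using elim by auto
  qed
qed

lemma norm_integral_le_nn_integral:
  fixes f :: "'b \<Rightarrow> complex"
  assumes "(\<integral>\<^sup>+x. ennreal (norm (f x)) \<partial>N) \<le> ennreal C" "0 \<le> C"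
  shows "norm (integral\<^sup>L N f) \<le> C"
proof (cases "integrable N f")
  case True
  have "ennreal (norm (integral\<^sup>L N f)) \<le> ennreal C"
    using integral_norm_bound_ennreal[OF True] assms(1) by (rule order_trans)
  then show ?thesis using assms(2) by simp
next
  \<comment> \<open>The integral of a non-integrable function is 0 by convention.\<close>
  case False
  then show ?thesis using assms(2) by (simp add: not_integrable_integral_eq)
qed

section \<open>The parametrix\<close>

lemma fourier_modulate:
  assumes [measurable]: "h \<in> borel_measurable borel"
  shows "fourier (\<lambda>\<xi>. h \<xi> * fexp \<xi> (- a)) x = fourier h (x - a)"
proof -
  have "fourier (\<lambda>\<xi>. h \<xi> * fexp \<xi> (- a)) x =
    (\<integral>\<xi>. fexp \<xi> x * (h \<xi> * fexp \<xi> (- a)) \<partial>lborel)"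
    by (rule fourier_lborel) measurable
  also have "\<dots> = (\<integral>\<xi>. fexp \<xi> (x - a) * h \<xi> \<partial>lborel)"
  proof (intro Bochner_Integration.integral_cong refl)
    fix \<xi>
    have "fexp \<xi> (x - a) =
      fexp \<xi> x * fexp \<xi> (- a)"
      by (simp add: inner_diff_right algebra_simps flip: exp_add)
    then show "fexp \<xi> x * (h \<xi> * fexp \<xi> (- a)) =
      fexp \<xi> (x - a) * h \<xi>" by simp
  qed
  also have "\<dots> = fourier h (x - a)" by (simp add: fourier_lborel)
  finally show ?thesis .
qed

lemma fourier_scale:
  fixes \<eta> :: "'a::euclidean_space \<Rightarrow> complex"
  assumes [measurable]: "\<eta> \<in> borel_measurable borel" and \<kappa>: "0 < \<kappa>"
  shows "fourier (\<lambda>\<xi>. \<eta> (\<kappa> *\<^sub>R \<xi>)) y = complex_of_real (1 / \<kappa> ^ DIM('a)) * fourier \<eta> (y /\<^sub>R \<kappa>)"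
proof -
  let ?e = "\<lambda>w. fexp w (y /\<^sub>R \<kappa>) * \<eta> w"
  have "fourier (\<lambda>\<xi>. \<eta> (\<kappa> *\<^sub>R \<xi>)) y = (\<integral>\<xi>. fexp \<xi> y * \<eta> (\<kappa> *\<^sub>R \<xi>) \<partial>lborel)"
    by (rule fourier_lborel) measurable
  also have "\<dots> = (\<integral>\<xi>. ?e (0 + \<kappa> *\<^sub>R \<xi>) \<partial>lborel)"
  proof (intro Bochner_Integration.integral_cong refl)
    fix \<xi> :: 'a
    have "(0 + \<kappa> *\<^sub>R \<xi>) \<bullet> (y /\<^sub>R \<kappa>) = \<xi> \<bullet> y" using \<kappa> by simp
    then show "fexp \<xi> y * \<eta> (\<kappa> *\<^sub>R \<xi>) = ?e (0 + \<kappa> *\<^sub>R \<xi>)"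
      by (simp only:) simp
  qed
  also have "\<dots> = (1 / \<bar>\<kappa>\<bar> ^ DIM('a)) *\<^sub>R (\<integral>\<xi>. ?e \<xi> \<partial>lborel)"
    by (rule lborel_integral_affine) (use \<kappa> in auto)
  also have "(\<integral>\<xi>. ?e \<xi> \<partial>lborel) = fourier \<eta> (y /\<^sub>R \<kappa>)" by (simp add: fourier_lborel)
  finally show ?thesis using \<kappa> by (simp add: scaleR_conv_of_real)
qed

context elliptic_equation
begin

text \<open>At 0 the first factor vanishes because \<eta> 0 = 1, whatever \<open>p 0\<close>
  is.\<close>

definition parametrix :: "real \<Rightarrow> real \<Rightarrow> 'a \<Rightarrow> complex" where
  "parametrix n \<delta> \<xi> = (1 - \<eta> (n *\<^sub>R \<xi>)) * inverse (p \<xi>) * \<eta> (\<delta> *\<^sub>R \<xi>)"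

text \<open>All factors have symbol constants independent of n and \<delta>: the two cutoffs by
  dilation invariance, and 1/p because it contains neither parameter.\<close>

lemma parametrix_symbol:
  "\<exists>A\<ge>0. \<forall>b\<in>Basis. \<forall>i\<in>{0<..} \<times> {0<..}. symbol b (- M) A k 0 (parametrix (fst i) (snd i))"
proof (rule symbol_uniform_Basis)
  fix b :: 'a assume b: "b \<in> Basis"
  obtain A where A: "0 \<le> A" "\<And>l. 0 < l \<Longrightarrow> symbol b 0 A k 0 (\<lambda>\<xi>. \<eta> (l *\<^sub>R \<xi>))"
    using test_function_scaled_symbol[OF \<eta>, of k] b by (metis greaterThan_iff)
  obtain B where B: "0 \<le> B" "symbol b M B k 0 p" using p_symbol[of k] b by blast
  obtain E where E: "0 \<le> E" "symbol b (- M) E k 0 (\<lambda>\<xi>. inverse (p \<xi>))"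
    using symbol_inverse[OF c p_lower B] by blast
  define A1 where "A1 = 2 ^ k * norm (- 1 :: complex) * A"
  define A2 where "A2 = norm (1 :: complex) + A1"
  define A3 where "A3 = 2 ^ k * A2 * E"
  define A4 where "A4 = 2 ^ k * A3 * A"
  have nn: "0 \<le> A1" "0 \<le> A2" "0 \<le> A3" using A(1) E(1) by (auto simp: A1_def A2_def A3_def)
  have "symbol b (- M) A4 k 0 (parametrix n \<delta>)" if n: "0 < n" and \<delta>: "0 < \<delta>" for n \<delta>
  proof -
    have 1: "symbol b (0 + 0) A1 k (0 + 0) (\<lambda>\<xi>. - 1 * \<eta> (n *\<^sub>R \<xi>))"
      unfolding A1_def by (rule symbol_mult[OF norm_ge_zero A(1) symbol_const A(2)[OF n]])
    have 2: "symbol b (0 + 0) A2 k (0 + 0) (\<lambda>\<xi>. 1 + - 1 * \<eta> (n *\<^sub>R \<xi>))"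
      unfolding A2_def by (rule symbol_add[OF _ 1]) (use symbol_const[of b "1::complex" k] in simp)
    have 3: "symbol b (0 + 0 + - M) A3 k (0 + 0 + 0) (\<lambda>\<xi>. (1 + - 1 * \<eta> (n *\<^sub>R \<xi>)) * inverse (p \<xi>))"
      unfolding A3_def by (rule symbol_mult[OF nn(2) E(1) 2 E(2)])
    have 4: "symbol b (0 + 0 + - M + 0) A4 k (0 + 0 + 0 + 0)
        (\<lambda>\<xi>. (1 + - 1 * \<eta> (n *\<^sub>R \<xi>)) * inverse (p \<xi>) * \<eta> (\<delta> *\<^sub>R \<xi>))"
      unfolding A4_def by (rule symbol_mult[OF nn(3) A(1) 3 A(2)[OF \<delta>]])
    then show ?thesis by (simp add: parametrix_def[abs_def])
  qed
  then show "\<exists>A. \<forall>i\<in>{0<..} \<times> {0<..}. symbol b (- M) A k 0 (parametrix (fst i) (snd i))"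
    by (intro exI[of _ A4]) auto
qed

lemma parametrix_measurable [measurable]: "parametrix n \<delta> \<in> borel_measurable borel"
  unfolding parametrix_def by measurable

lemma \<eta>_support: obtains R where "0 < R" "\<And>\<xi>. R < norm \<xi> \<Longrightarrow> \<eta> \<xi> = 0"
  using test_function_support[OF \<eta>] by blast

lemma \<eta>_near_0: obtains \<rho> where "0 < \<rho>" "\<And>\<xi>. norm \<xi> < \<rho> \<Longrightarrow> \<eta> \<xi> = 1"
  using \<eta>_0 unfolding eventually_nhds_metric by (auto simp: dist_norm)

text \<open>Since \<langle>\<xi>\<rangle>^-M \<le> |\<xi>|^-r for 0 \<le> r \<le> M, one symbol
  estimate yields a family of kernel bounds: r = 0 is the one for infinity, r > 0 gives
  integrability at the origin.\<close>

lemma parametrix_kernel_bound: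
  assumes r: "0 \<le> r" "r \<le> M" "r < real DIM('a)"
  shows "\<exists>C\<ge>0. \<forall>n>0. \<forall>\<delta>>0. \<forall>y. y \<noteq> 0 \<longrightarrow>
    norm (fourier (parametrix n \<delta>) y) \<le> C * norm y powr (r - real DIM('a))"
proof -
  from fourier_kernel_bound[OF r(1,3)] obtain C where C: "0 \<le> C"
    "\<And>A f x. 0 \<le> A \<Longrightarrow> integrable lborel f \<Longrightarrow> (\<forall>b\<in>Basis. symbol b 0 A (Suc DIM('a)) r f) \<Longrightarrow>
      x \<noteq> (0::'a) \<Longrightarrow> norm (fourier f x) \<le> C * A * norm x powr (r - real DIM('a))"
    by (elim exE conjE) blast
  obtain A where A: "0 \<le> A" "\<forall>b\<in>Basis. \<forall>i\<in>{0<..} \<times> {0<..}. symbol b (- M) A (Suc DIM('a)) 0 (parametrix (fst i) (snd i))"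
    using parametrix_symbol[of "Suc DIM('a)"] by (elim exE conjE)
  have "norm (fourier (parametrix n \<delta>) y) \<le> C * A * norm y powr (r - real DIM('a))"
    if n: "0 < n" and \<delta>: "0 < \<delta>" and y: "y \<noteq> 0" for n \<delta> y
  proof (rule C(2)[OF A(1) _ _ y])
    have sym: "symbol b (- M) A (Suc DIM('a)) 0 (parametrix n \<delta>)" if "b \<in> Basis" for b
      using A(2)[rule_format, of b "(n, \<delta>)"] that n \<delta> by simp
    obtain R where R: "0 < R" "\<And>\<xi>. R < norm \<xi> \<Longrightarrow> \<eta> \<xi> = 0" by (rule \<eta>_support, rule that)
    have supp: "parametrix n \<delta> \<xi> = 0" if "R / \<delta> < norm \<xi>" for \<xi>
      using R(2)[of "\<delta> *\<^sub>R \<xi>"] that \<delta> by (simp add: parametrix_def field_simps)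
    obtain b :: 'a where b: "b \<in> Basis" by (rule Basis_ex)
    have "0 < R / \<delta>" using R(1) \<delta> by simp
    from symbol_compact_support[OF A(1) this sym[OF b] supp]
    show "integrable lborel (parametrix n \<delta>)"
      by (rule symbol_decay_integrable(1)) (assumption, intro mult_nonneg_nonneg A(1) powr_ge_zero)
    show "\<forall>b\<in>Basis. symbol b 0 A (Suc DIM('a)) r (parametrix n \<delta>)"
    proof
      fix b :: 'a assume b: "b \<in> Basis"
      have "symbol b 0 (A * 1) (Suc DIM('a)) (0 + r) (parametrix n \<delta>)"
      proof (rule symbol_reweight[OF _ A(1) sym[OF b]])
        fix \<xi> :: 'a assume "\<xi> \<noteq> 0"
        have "\<langle>\<xi>\<rangle> powr - M \<le> \<langle>\<xi>\<rangle> powr - r" using japanese_ge_1[of \<xi>] r by (intro powr_mono) auto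
        also have "\<dots> \<le> norm \<xi> powr - r"
          using \<open>\<xi> \<noteq> 0\<close> japanese_ge_norm[of \<xi>] r by (intro powr_minus_antimono) auto
        finally show "\<langle>\<xi>\<rangle> powr - M \<le> 1 * \<langle>\<xi>\<rangle> powr 0 * norm \<xi> powr - r" by simp
      qed
      then show "symbol b 0 A (Suc DIM('a)) r (parametrix n \<delta>)" by simp
    qed
  qed
  then show ?thesis using C(1) A(1) by (intro exI[of _ "C * A"]) auto
qed

text \<open>By scaling, the transform is n^-d times that of \<eta> at y / n, and \<langle>y\<rangle>
  \<le> n \<langle>y / n\<rangle> for n \<ge> 1 absorbs the factor n^-d. This is the majorant for
  the limit n \<rightarrow> \<infinity>.\<close>

lemma cutoff_kernel_bound:
  "\<exists>C\<ge>0. \<forall>n\<ge>1. \<forall>y. norm (fourier (\<lambda>\<xi>. \<eta> (n *\<^sub>R \<xi>)) y) \<le> C * \<langle>y\<rangle> powr - real DIM('a)"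
proof -
  define d where "d = real DIM('a)"
  obtain E where E: "0 \<le> E" "\<And>z. norm (fourier \<eta> z) \<le> E * \<langle>z\<rangle> powr - d"
    using rapid_bound[OF rapid_fourier[OF \<eta>]] by blast
  have "norm (fourier (\<lambda>\<xi>. \<eta> (n *\<^sub>R \<xi>)) y) \<le> E * \<langle>y\<rangle> powr - d" if n: "1 \<le> n" for n y
  proof -
    have n0: "0 < n" using n by linarith
    have "n *\<^sub>R (y /\<^sub>R n) = y" using n0 by simp
    have "\<langle>y\<rangle> \<le> n * \<langle>y /\<^sub>R n\<rangle>"
    proof (rule power2_le_imp_le)
      have "(norm (y /\<^sub>R n))\<^sup>2 = (norm y)\<^sup>2 / n\<^sup>2" using n0 by (simp add: power_mult_distrib power_divide divide_inverse power_inverse)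
      then have "(n * \<langle>y /\<^sub>R n\<rangle>)\<^sup>2 = n\<^sup>2 + (norm y)\<^sup>2"
        using n0 by (simp add: japanese_def power_mult_distrib add_nonneg_nonneg distrib_left)
      moreover have "1 \<le> n\<^sup>2" using n by simp
      ultimately show "\<langle>y\<rangle>\<^sup>2 \<le> (n * \<langle>y /\<^sub>R n\<rangle>)\<^sup>2" by (simp add: japanese_def add_nonneg_nonneg)
    qed (use n0 in \<open>simp add: less_imp_le\<close>)
    then have "(n * \<langle>y /\<^sub>R n\<rangle>) powr - d \<le> \<langle>y\<rangle> powr - d"
      by (intro powr_minus_antimono) (auto simp: d_def)
    moreover have "(n * \<langle>y /\<^sub>R n\<rangle>) powr - d = 1 / n ^ DIM('a) * \<langle>y /\<^sub>R n\<rangle> powr - d"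
      using n0 by (simp add: powr_mult powr_minus d_def powr_realpow divide_inverse less_imp_le)
    ultimately have "E * (1 / n ^ DIM('a) * \<langle>y /\<^sub>R n\<rangle> powr - d) \<le> E * \<langle>y\<rangle> powr - d"
      using E(1) by (intro mult_left_mono) auto
    moreover have "norm (fourier (\<lambda>\<xi>. \<eta> (n *\<^sub>R \<xi>)) y) \<le> 1 / n ^ DIM('a) * (E * \<langle>y /\<^sub>R n\<rangle> powr - d)"
      using n0 E(2)[of "y /\<^sub>R n"]
      by (subst fourier_scale) (auto simp: norm_mult norm_power norm_divide intro!: divide_right_mono)
    ultimately show ?thesis by (simp add: mult_ac)
  qed
  then show ?thesis using E(1) unfolding d_def by blast
qed

text \<open>Once \<open>n\<close> is large against \<open>\<delta>\<close>, \<open>\<eta> (\<delta> *\<^sub>R \<xi>) = 1\<close> on the support of \<open>\<eta> (n *\<^sub>R \<xi>)\<close>.\<close>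

lemma parametrix_identity:
  assumes n: "0 < n" and \<delta>: "0 < \<delta>" and R: "0 < R" "\<And>\<xi>. R < norm \<xi> \<Longrightarrow> \<eta> \<xi> = 0"
    and \<rho>: "0 < \<rho>" "\<And>\<xi>. norm \<xi> < \<rho> \<Longrightarrow> \<eta> \<xi> = 1" and large: "\<delta> * R < n * \<rho>"
  shows "(\<integral>x. u x * (fourier (\<lambda>\<xi>. \<eta> (\<delta> *\<^sub>R \<xi>)) (x - a) - fourier (\<lambda>\<xi>. \<eta> (n *\<^sub>R \<xi>)) (x - a)) \<partial>lborel)
    = (\<integral>x. v x * fourier (parametrix n \<delta>) (x - a) \<partial>lborel)"
proof -
  let ?e = "\<lambda>\<xi>. fexp \<xi> (- a)"
  let ?f = "\<lambda>\<xi>. parametrix n \<delta> \<xi> * ?e \<xi>"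
  \<comment> \<open>The number of derivatives that \<open>shell_pairing\<close> asks for;
    \<open>phase_symbol\<close> needs a weight at least as large.\<close>
  define t where "t = real (Suc DIM('a) + 2)"
  have pairing: "(\<integral>x. u x * fourier (\<lambda>\<xi>. p \<xi> * ?f \<xi>) x \<partial>lborel) = (\<integral>x. v x * fourier ?f x \<partial>lborel)"
  proof (rule shell_pairing)
    show "0 < \<rho> / n" using \<rho> n by simp
    show "supported_in_shell (\<rho> / n) (R / \<delta>) ?f"
      unfolding supported_in_shell_def
    proof (intro allI impI)
      fix \<xi> :: 'a assume "norm \<xi> < \<rho> / n \<or> R / \<delta> < norm \<xi>"
      then show "?f \<xi> = 0"
        using R(2)[of "\<delta> *\<^sub>R \<xi>"] \<rho>(2)[of "n *\<^sub>R \<xi>"] n \<delta> by (auto simp: parametrix_def field_simps)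
    qed
    fix b :: 'a assume b: "b \<in> Basis"
    obtain A where A: "0 \<le> A" "\<forall>b\<in>Basis. \<forall>i\<in>{0<..} \<times> {0<..}. symbol b (- M) A (Suc DIM('a) + 2) 0 (parametrix (fst i) (snd i))"
      using parametrix_symbol[of "Suc DIM('a) + 2"] by (elim exE conjE)
    have 1: "symbol b (- M) A (Suc DIM('a) + 2) 0 (parametrix n \<delta>)"
      using A(2)[rule_format, of b "(n, \<delta>)"] b n \<delta> by simp
    have "0 + real (Suc DIM('a) + 2) \<le> t" by (simp add: t_def)
    from phase_symbol[OF order_refl this, of b 1 "- a"] obtain B where
      B: "0 \<le> B" "symbol b t B (Suc DIM('a) + 2) 0 (\<lambda>\<xi>. 1 * ?e \<xi>)" by blast
    have "symbol b (- M + t) (2 ^ (Suc DIM('a) + 2) * A * B) (Suc DIM('a) + 2) (0 + 0) (\<lambda>\<xi>. parametrix n \<delta> \<xi> * (1 * ?e \<xi>))"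
      by (rule symbol_mult[OF A(1) B(1) 1 B(2)])
    then show "\<exists>A\<ge>0. symbol b (- M + t) A (Suc DIM('a) + 2) 0 ?f"
      using A(1) B(1) by (intro exI[of _ "2 ^ (Suc DIM('a) + 2) * A * B"]) simp
  qed
  have p0: "p \<xi> \<noteq> 0" if "\<xi> \<noteq> 0" for \<xi>
    using p_lower[OF that] c by (smt (verit) japanese_neq_0 mult_pos_pos norm_zero powr_gt_zero)
  have prod: "\<eta> (n *\<^sub>R \<xi>) * \<eta> (\<delta> *\<^sub>R \<xi>) = \<eta> (n *\<^sub>R \<xi>)" for \<xi>
  proof (cases "R < norm (n *\<^sub>R \<xi>)")
    case True
    then show ?thesis using R(2)[of "n *\<^sub>R \<xi>"] by simp
  next
    case False
    then have "n * norm \<xi> \<le> R" using n by simp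
    then have "\<delta> * (n * norm \<xi>) \<le> \<delta> * R" using \<delta> by (intro mult_left_mono) auto
    then have "n * (\<delta> * norm \<xi>) < n * \<rho>" using large by (simp add: mult_ac)
    then have "norm (\<delta> *\<^sub>R \<xi>) < \<rho>" using n \<delta> by simp
    then show ?thesis using \<rho>(2)[of "\<delta> *\<^sub>R \<xi>"] by simp
  qed
  have 1: "p \<xi> * ?f \<xi> = (\<eta> (\<delta> *\<^sub>R \<xi>) - \<eta> (n *\<^sub>R \<xi>)) * ?e \<xi>" for \<xi>
  proof (cases "\<xi> = 0")
    \<comment> \<open>At the origin both sides vanish because both cutoffs equal 1 there,
      irrespective of \<open>p 0\<close>.\<close>
    case True
    then show ?thesis by (simp add: parametrix_def \<eta>_at_0)
  next
    case False
    have "p \<xi> * parametrix n \<delta> \<xi> = (p \<xi> * inverse (p \<xi>)) * ((1 - \<eta> (n *\<^sub>R \<xi>)) * \<eta> (\<delta> *\<^sub>R \<xi>))"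
      by (simp only: parametrix_def mult_ac)
    also have "p \<xi> * inverse (p \<xi>) = 1" using p0[OF False] by simp
    finally have "p \<xi> * parametrix n \<delta> \<xi> = \<eta> (\<delta> *\<^sub>R \<xi>) - \<eta> (n *\<^sub>R \<xi>) * \<eta> (\<delta> *\<^sub>R \<xi>)"
      by (simp add: left_diff_distrib)
    then show ?thesis by (simp add: prod mult.assoc[symmetric])
  qed
  have 2: "fourier (\<lambda>\<xi>. (\<eta> (\<delta> *\<^sub>R \<xi>) - \<eta> (n *\<^sub>R \<xi>)) * ?e \<xi>) x =
      fourier (\<lambda>\<xi>. \<eta> (\<delta> *\<^sub>R \<xi>)) (x - a) - fourier (\<lambda>\<xi>. \<eta> (n *\<^sub>R \<xi>)) (x - a)" for x
    by (subst fourier_modulate, measurable)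
      (intro fourier_diff test_function_integrable test_function_scale \<eta> n \<delta>)
  have 3: "fourier ?f x = fourier (parametrix n \<delta>) (x - a)" for x
    by (rule fourier_modulate) measurable
  show ?thesis using pairing by (simp only: 1 2 3)
qed

text \<open>The integral is, up to normalisation, the regularisation of \<open>u\<close> at scale
  \<delta>. By \<open>parametrix_identity\<close> it consists of an integral of \<open>v\<close>
  against the truncated kernel, bounded through \<open>kernel_convolution\<close> uniformly in n and
  \<delta>, and of a low-frequency term that disappears as n \<rightarrow> \<infinity>.\<close>

lemma smoothed_decay:
  assumes t: "0 < t" "t \<le> real DIM('a)" "t < s"
  shows "\<exists>C\<ge>0. \<forall>\<delta>>0. \<forall>a. norm (\<integral>x. u x * fourier (\<lambda>\<xi>. \<eta> (\<delta> *\<^sub>R \<xi>)) (x - a) \<partial>lborel) \<le> C * \<langle>a\<rangle> powr - t"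
proof -
  define d where "d = real DIM('a)"
  have d1: "1 \<le> d" by (simp add: d_def Suc_leI)
  \<comment> \<open>Positive because M > 0, and below the dimension, which is at least 1.\<close>
  define r where "r = min M (1/2)"
  have r: "0 < r" "r \<le> M" "r < d" using M d1 by (auto simp: r_def)
  obtain C0 where C0: "0 \<le> C0" "\<And>n \<delta> y. 0 < n \<Longrightarrow> 0 < \<delta> \<Longrightarrow> y \<noteq> 0 \<Longrightarrow>
      norm (fourier (parametrix n \<delta>) y) \<le> C0 * norm y powr (0 - d)"
    using parametrix_kernel_bound[of 0] M d1 unfolding d_def by auto
  obtain C1 where C1: "0 \<le> C1" "\<And>n \<delta> y. 0 < n \<Longrightarrow> 0 < \<delta> \<Longrightarrow> y \<noteq> 0 \<Longrightarrow>
      norm (fourier (parametrix n \<delta>) y) \<le> C1 * norm y powr (r - d)"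
    using parametrix_kernel_bound[of r] r unfolding d_def by auto
  define C2 where "C2 = max C0 C1"
  have C2: "0 \<le> C2" using C0 by (simp add: C2_def)
  define k where "k y = min (norm y powr - d) (norm y powr (r - d))" for y :: 'a
  have k0: "0 \<le> k y" for y by (simp add: k_def)
  have [measurable]: "k \<in> borel_measurable borel" unfolding k_def by measurable
  have pk: "norm (fourier (parametrix n \<delta>) y) \<le> C2 * k y" if "0 < n" "0 < \<delta>" "y \<noteq> 0" for n \<delta> y
  proof -
    have "C0 * norm y powr (0 - d) \<le> C2 * norm y powr - d" "C1 * norm y powr (r - d) \<le> C2 * norm y powr (r - d)"
      by (auto simp: C2_def intro!: mult_right_mono)
    then have "norm (fourier (parametrix n \<delta>) y) \<le> C2 * norm y powr - d"
      "norm (fourier (parametrix n \<delta>) y) \<le> C2 * norm y powr (r - d)"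
      using C0(2)[OF that] C1(2)[OF that] by linarith+
    then show ?thesis by (auto simp: k_def min_def)
  qed
  obtain C3 where C3: "0 \<le> C3" "\<And>a. (\<integral>\<^sup>+x. ennreal (\<langle>x\<rangle> powr - s * k (x - a)) \<partial>lborel) \<le> ennreal (C3 * \<langle>a\<rangle> powr - t)"
    using kernel_convolution[OF r(1) _ t] r(3) unfolding k_def d_def by blast
  have Bv: "0 \<le> Bv" using order_trans[OF norm_ge_zero v_bound[of 0]] by (simp add: japanese_def)
  define C4 where "C4 = Bv * C2 * C3"
  have C4: "0 \<le> C4" using Bv C2 C3 by (simp add: C4_def)
  have vb: "norm (\<integral>x. v x * fourier (parametrix n \<delta>) (x - a) \<partial>lborel) \<le> C4 * \<langle>a\<rangle> powr - t"
    if n: "0 < n" "0 < \<delta>" for n \<delta> a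
  proof (rule norm_integral_le_nn_integral)
    have "(\<integral>\<^sup>+x. ennreal (norm (v x * fourier (parametrix n \<delta>) (x - a))) \<partial>lborel) \<le>
        (\<integral>\<^sup>+x. ennreal (Bv * C2) * ennreal (\<langle>x\<rangle> powr - s * k (x - a)) \<partial>lborel)"
    proof (rule nn_integral_mono_AE)
      have "AE x in lborel. x \<noteq> a" by (rule AE_lborel_singleton)
      then show "AE x in lborel. ennreal (norm (v x * fourier (parametrix n \<delta>) (x - a))) \<le>
        ennreal (Bv * C2) * ennreal (\<langle>x\<rangle> powr - s * k (x - a))"
      proof eventually_elim
        case (elim x)
        have "norm (v x * fourier (parametrix n \<delta>) (x - a)) \<le> (Bv * \<langle>x\<rangle> powr - s) * (C2 * k (x - a))"
          unfolding norm_mult using elim n Bv by (intro mult_mono v_bound pk) auto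
        also have "\<dots> = (Bv * C2) * (\<langle>x\<rangle> powr - s * k (x - a))" by simp
        finally show ?case using Bv C2 k0 by (simp add: ennreal_mult[symmetric] ennreal_leI)
      qed
    qed
    also have "\<dots> = ennreal (Bv * C2) * (\<integral>\<^sup>+x. ennreal (\<langle>x\<rangle> powr - s * k (x - a)) \<partial>lborel)"
      by (rule nn_integral_cmult) measurable
    also have "\<dots> \<le> ennreal (Bv * C2) * ennreal (C3 * \<langle>a\<rangle> powr - t)"
      by (intro mult_left_mono C3) auto
    also have "\<dots> = ennreal (C4 * \<langle>a\<rangle> powr - t)"
      using Bv C2 C3 by (simp add: C4_def ennreal_mult[symmetric] mult.assoc)
    finally show "(\<integral>\<^sup>+x. ennreal (norm (v x * fourier (parametrix n \<delta>) (x - a))) \<partial>lborel) \<le> ennreal (C4 * \<langle>a\<rangle> powr - t)" .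
  qed (use C4 in auto)
  obtain R where R: "0 < R" "\<And>\<xi>. R < norm \<xi> \<Longrightarrow> \<eta> \<xi> = 0" by (rule \<eta>_support, rule that)
  obtain \<rho> where \<rho>: "0 < \<rho>" "\<And>\<xi>. norm \<xi> < \<rho> \<Longrightarrow> \<eta> \<xi> = 1" by (rule \<eta>_near_0, rule that)
  obtain E where E: "0 \<le> E" "\<And>n y. 1 \<le> n \<Longrightarrow> norm (fourier (\<lambda>\<xi>. \<eta> (n *\<^sub>R \<xi>)) y) \<le> E * \<langle>y\<rangle> powr - d"
    using cutoff_kernel_bound unfolding d_def by blast
  have "norm (\<integral>x. u x * fourier (\<lambda>\<xi>. \<eta> (\<delta> *\<^sub>R \<xi>)) (x - a) \<partial>lborel) \<le> C4 * \<langle>a\<rangle> powr - t"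
    if \<delta>: "0 < \<delta>" for \<delta> a
  proof -
    let ?\<Theta> = "\<lambda>l. fourier (\<lambda>\<xi>. \<eta> (l *\<^sub>R \<xi>))"
    have shift: "\<langle>x - a\<rangle> powr - d \<le> 2 powr d * \<langle>a\<rangle> powr d * \<langle>x\<rangle> powr - d" for x
      by (rule japanese_powr_shift) (simp add: d_def)
    have bound: "norm (?\<Theta> n (x - a)) \<le> (E * (2 powr d * \<langle>a\<rangle> powr d)) * \<langle>x\<rangle> powr - d" if "1 \<le> n" for n x
      using order_trans[OF E(2)[OF that] mult_left_mono[OF shift E(1)]] by (simp add: mult.assoc)
    \<comment> \<open>The low-frequency term vanishes in the limit: its kernel is at most n^-d times
      the L1 norm of \<eta>, and the decay of \<open>u\<close> provides an integrable
      majorant.\<close>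
    have lim: "(\<lambda>n. \<integral>x. u x * ?\<Theta> (real (Suc n)) (x - a) \<partial>lborel) \<longlonglongrightarrow> (\<integral>x. 0 \<partial>(lborel :: 'a measure))"
    proof (rule integral_dominated_convergence[where w = "\<lambda>x. Bu * (E * (2 powr d * \<langle>a\<rangle> powr d)) * \<langle>x\<rangle> powr - (\<epsilon> + d)"])
      show "integrable lborel (\<lambda>x::'a. Bu * (E * (2 powr d * \<langle>a\<rangle> powr d)) * \<langle>x\<rangle> powr - (\<epsilon> + d))"
        by (intro integrable_mult_right integrable_japanese) (use \<epsilon> in \<open>simp add: d_def\<close>)
      show "AE x in lborel. norm (u x * ?\<Theta> (real (Suc n)) (x - a)) \<le> Bu * (E * (2 powr d * \<langle>a\<rangle> powr d)) * \<langle>x\<rangle> powr - (\<epsilon> + d)" for n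
        by (rule AE_I2, rule integrable_weighted_mult(2)[OF _ _ u_bound bound]) (use \<epsilon> in \<open>auto simp: d_def\<close>)
      show "AE x in lborel. (\<lambda>n. u x * ?\<Theta> (real (Suc n)) (x - a)) \<longlonglongrightarrow> 0"
      proof (rule AE_I2)
        fix x :: 'a
        define I where "I = (\<integral>\<xi>. norm (\<eta> \<xi>) \<partial>lborel)"
        have l: "(\<lambda>n. 1 / real (Suc n)) \<longlonglongrightarrow> 0" by (rule LIMSEQ_Suc[OF lim_1_over_n])
        have "(\<lambda>n. (1 / real (Suc n)) ^ DIM('a) * I) \<longlonglongrightarrow> 0 ^ DIM('a) * I"
          by (intro tendsto_intros l)
        then have l2: "(\<lambda>n. (1 / real (Suc n)) ^ DIM('a) * I) \<longlonglongrightarrow> 0"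
          by (simp only: zero_power[OF DIM_positive] mult_zero_left)
        have "(\<lambda>n. ?\<Theta> (real (Suc n)) (x - a)) \<longlonglongrightarrow> 0"
        proof (rule Lim_null_comparison[OF _ l2], rule always_eventually, rule allI)
          fix n
          have "norm (?\<Theta> (real (Suc n)) (x - a)) = (1 / real (Suc n)) ^ DIM('a) * norm (fourier \<eta> ((x - a) /\<^sub>R real (Suc n)))"
            by (subst fourier_scale) (auto simp: norm_mult norm_divide norm_power power_divide simp del: of_nat_Suc)
          also have "\<dots> \<le> (1 / real (Suc n)) ^ DIM('a) * I"
            unfolding I_def by (intro mult_left_mono norm_fourier_le test_function_integrable \<eta>) auto
          finally show "norm (?\<Theta> (real (Suc n)) (x - a)) \<le> (1 / real (Suc n)) ^ DIM('a) * I" .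
        qed
        from tendsto_mult[OF tendsto_const this, of "u x"]
        show "(\<lambda>n. u x * ?\<Theta> (real (Suc n)) (x - a)) \<longlonglongrightarrow> 0" by simp
      qed
    qed measurable
    obtain E\<delta> where E\<delta>: "\<And>y. norm (?\<Theta> \<delta> y) \<le> E\<delta> * \<langle>y\<rangle> powr - d"
      using rapid_bound[OF rapid_fourier[OF test_function_scale[OF \<eta> \<delta>]]] by blast
    have E\<delta>0: "0 \<le> E\<delta>" using order_trans[OF norm_ge_zero E\<delta>[of 0]] by (simp add: japanese_def)
    have bound\<delta>: "norm (?\<Theta> \<delta> (x - a)) \<le> (E\<delta> * (2 powr d * \<langle>a\<rangle> powr d)) * \<langle>x\<rangle> powr - d" for x
      using order_trans[OF E\<delta> mult_left_mono[OF shift E\<delta>0]] by (simp add: mult.assoc)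
    have i\<delta>: "integrable lborel (\<lambda>x. u x * ?\<Theta> \<delta> (x - a))"
      by (rule integrable_weighted_mult(1)[OF _ _ u_bound bound\<delta>]) (use \<epsilon> in \<open>auto simp: d_def\<close>)
    have i_n: "integrable lborel (\<lambda>x. u x * ?\<Theta> n (x - a))" if "1 \<le> n" for n
      by (rule integrable_weighted_mult(1)[OF _ _ u_bound bound[OF that]]) (use \<epsilon> in \<open>auto simp: d_def\<close>)
    let ?J = "\<integral>x. u x * ?\<Theta> \<delta> (x - a) \<partial>lborel"
    have "(\<lambda>n. ?J - (\<integral>x. u x * ?\<Theta> (real (Suc n)) (x - a) \<partial>lborel)) \<longlonglongrightarrow> ?J - (\<integral>x. 0 \<partial>(lborel :: 'a measure))"
      by (intro tendsto_diff tendsto_const lim)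
    then have lim': "(\<lambda>n. norm (?J - (\<integral>x. u x * ?\<Theta> (real (Suc n)) (x - a) \<partial>lborel))) \<longlonglongrightarrow> norm ?J"
      using tendsto_norm by fastforce
    \<comment> \<open>Beyond \<open>n0\<close> the parameter is large enough against \<delta> for
      \<open>parametrix_identity\<close>.\<close>
    obtain n0 :: nat where n0: "\<delta> * R / \<rho> < real n0" using reals_Archimedean2 by blast
    have "norm (?J - (\<integral>x. u x * ?\<Theta> (real (Suc n)) (x - a) \<partial>lborel)) \<le> C4 * \<langle>a\<rangle> powr - t" if "n0 \<le> n" for n
    proof -
      have "\<delta> * R / \<rho> < real (Suc n)" using n0 that by linarith
      then have "\<delta> * R < real (Suc n) * \<rho>" using \<rho>(1) by (simp add: divide_less_eq)
      then have "(\<integral>x. u x * (?\<Theta> \<delta> (x - a) - ?\<Theta> (real (Suc n)) (x - a)) \<partial>lborel)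
          = (\<integral>x. v x * fourier (parametrix (real (Suc n)) \<delta>) (x - a) \<partial>lborel)"
        by (intro parametrix_identity[OF _ \<delta> R \<rho>]) auto
      moreover have "(\<integral>x. u x * (?\<Theta> \<delta> (x - a) - ?\<Theta> (real (Suc n)) (x - a)) \<partial>lborel) =
          ?J - (\<integral>x. u x * ?\<Theta> (real (Suc n)) (x - a) \<partial>lborel)"
        unfolding right_diff_distrib by (rule Bochner_Integration.integral_diff[OF i\<delta> i_n]) simp
      ultimately show ?thesis using vb[of "real (Suc n)" \<delta> a] \<delta> by simp
    qed
    then show ?thesis
      by (intro tendsto_upperbound[OF lim']) (auto simp: eventually_sequentially)
  qed
  then show ?thesis using C4 by blast
qed

text \<open>The regularisation is transposed onto the test function: regularised \<open>u\<close>
  paired with \<phi> is \<open>u\<close> paired with a mollification of \<phi>, which converges as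
  \<delta> \<rightarrow> 0. The uniform bound survives the limit, and
  \<open>bounded_by_duality\<close> makes it pointwise.\<close>

lemma decay:
  assumes t: "0 < t" "t \<le> real DIM('a)" "t < s"
  shows "\<exists>C\<ge>0. AE x in lborel. norm (u x) \<le> C * \<langle>x\<rangle> powr - t"
proof -
  define d where "d = real DIM('a)"
  obtain C where C: "0 \<le> C" "\<And>\<delta> a. 0 < \<delta> \<Longrightarrow>
      norm (\<integral>x. u x * fourier (\<lambda>\<xi>. \<eta> (\<delta> *\<^sub>R \<xi>)) (x - a) \<partial>lborel) \<le> C * \<langle>a\<rangle> powr - t"
    using smoothed_decay[OF t] by blast
  let ?c = "complex_of_real ((2 * pi) ^ DIM('a))"
  \<comment> \<open>The transform of \<eta> has integral (2 \<pi>)^d, so the regularisations tend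
    weakly to (2 \<pi>)^d u; the factor is divided out here.\<close>
  define C' where "C' = C / (2 * pi) ^ DIM('a)"
  have C': "0 \<le> C'" using C(1) by (simp add: C'_def)
  have Bu: "0 \<le> Bu" using order_trans[OF norm_ge_zero u_bound[of 0]] by (simp add: japanese_def)
  have ub: "norm (u x) \<le> Bu" for x by (rule norm_le_of_weight[OF u_bound]) (use \<epsilon> in simp)
  have "AE x in lborel. norm (u x) \<le> C' * \<langle>x\<rangle> powr - t"
  proof (rule bounded_by_duality[where B = Bu and B' = C'])
    show "C' * \<langle>x\<rangle> powr - t \<le> C'" for x :: 'a
      using mult_left_mono[OF japanese_powr_le_1[of t x] C'] t by simp
    fix \<phi> :: "'a \<Rightarrow> complex" and R
    assume \<phi>: "continuous_on UNIV \<phi>" and supp: "\<And>x. R < norm x \<Longrightarrow> \<phi> x = 0"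
    have [measurable]: "\<phi> \<in> borel_measurable borel" using \<phi> by (rule borel_measurable_continuous_onI)
    have i\<phi>: "integrable lborel \<phi>" by (rule continuous_compact_support_integrable[OF \<phi> supp])
    \<comment> \<open>An exponent above d, so that the majorants for Fubini and for the limit are
      integrable.\<close>
    define L where "L = d + 1"
    obtain B\<phi> where B\<phi>: "\<And>x. norm (\<phi> x) \<le> B\<phi>" using bounded_continuous_support[OF \<phi> supp] by blast
    have "continuous_on UNIV (\<lambda>x. complex_of_real (\<langle>x\<rangle> powr L) * \<phi> x)"
      using \<phi> by (intro continuous_intros) auto
    then obtain B where B: "0 \<le> B" "\<And>x. norm (complex_of_real (\<langle>x\<rangle> powr L) * \<phi> x) \<le> B"
      using bounded_continuous_support[of "\<lambda>x. complex_of_real (\<langle>x\<rangle> powr L) * \<phi> x" R] supp by auto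
    have \<phi>L: "norm (\<phi> x) \<le> B * \<langle>x\<rangle> powr - L" for x
      using B(2)[of x] by (simp add: norm_mult powr_minus field_simps)
    define \<delta> where "\<delta> n = 1 / real (Suc n)" for n
    have \<delta>: "0 < \<delta> n" "\<delta> n \<le> 1" for n by (auto simp: \<delta>_def)
    have \<delta>0: "\<delta> \<longlonglongrightarrow> 0" unfolding \<delta>_def by (rule LIMSEQ_Suc[OF lim_1_over_n])
    let ?\<Theta> = "\<lambda>l. fourier (\<lambda>\<xi>. \<eta> (l *\<^sub>R \<xi>))"
    define m where "m n = mollify (fourier \<eta>) (\<delta> n) \<phi>" for n
    have swap: "(\<integral>a. (\<integral>x. u x * ?\<Theta> (\<delta> n) (x - a) \<partial>lborel) * \<phi> a \<partial>lborel) = (\<integral>x. u x * m n x \<partial>lborel)" for n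
    proof -
      obtain E where E: "0 \<le> E" "\<And>y. norm (?\<Theta> (\<delta> n) y) \<le> E * \<langle>y\<rangle> powr - L"
        using rapid_bound[OF rapid_fourier[OF test_function_scale[OF \<eta> \<delta>(1)]]] by blast
      let ?f = "\<lambda>x::'a. complex_of_real (Bu * E * 2 powr L * \<langle>x\<rangle> powr - L)"
      let ?g = "\<lambda>a. complex_of_real (\<langle>a\<rangle> powr L) * \<phi> a"
      have "continuous_on UNIV ?g" using \<phi> by (intro continuous_intros) auto
      then have g: "integrable lborel ?g"
        using continuous_compact_support_integrable[of ?g R] supp by auto
      have f: "integrable lborel ?f"
        by (intro integrable_of_real integrable_mult_right integrable_japanese) (simp add: d_def L_def)
      have int: "integrable (lborel \<Otimes>\<^sub>M lborel) (\<lambda>(a, x). u x * ?\<Theta> (\<delta> n) (x - a) * \<phi> a)"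
      proof (rule lborel_integrable_tensor_bound[OF g f])
        fix a x :: 'a
        have le: "\<langle>x - a\<rangle> powr - L \<le> 2 powr L * \<langle>a\<rangle> powr L * \<langle>x\<rangle> powr - L"
          by (rule japanese_powr_shift) (simp add: L_def d_def)
        have "norm (u x * ?\<Theta> (\<delta> n) (x - a)) \<le> Bu * (E * (2 powr L * \<langle>a\<rangle> powr L * \<langle>x\<rangle> powr - L))"
          unfolding norm_mult
          by (intro mult_mono ub order_trans[OF E(2) mult_left_mono[OF le E(1)]] Bu norm_ge_zero)
        then have "norm (u x * ?\<Theta> (\<delta> n) (x - a)) * norm (\<phi> a) \<le>
            Bu * (E * (2 powr L * \<langle>a\<rangle> powr L * \<langle>x\<rangle> powr - L)) * norm (\<phi> a)"
          by (rule mult_right_mono) simp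
        then show "norm (u x * ?\<Theta> (\<delta> n) (x - a) * \<phi> a) \<le> norm (?g a) * norm (?f x)"
          using Bu E(1) by (simp add: norm_mult mult_ac)
      qed measurable
      have "(\<integral>a. (\<integral>x. u x * ?\<Theta> (\<delta> n) (x - a) \<partial>lborel) * \<phi> a \<partial>lborel) =
          (\<integral>a. \<integral>x. u x * ?\<Theta> (\<delta> n) (x - a) * \<phi> a \<partial>lborel \<partial>lborel)" by simp
      also have "\<dots> = (\<integral>x. \<integral>a. u x * ?\<Theta> (\<delta> n) (x - a) * \<phi> a \<partial>lborel \<partial>lborel)"
        by (rule lborel_pair.Fubini_integral[OF int, symmetric])
      also have "\<dots> = (\<integral>x. u x * m n x \<partial>lborel)"
      proof (intro Bochner_Integration.integral_cong refl)
        fix x :: 'a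
        have "(\<integral>a. ?\<Theta> (\<delta> n) (x - a) * \<phi> a \<partial>lborel) =
            (\<integral>a. complex_of_real (1 / \<delta> n ^ DIM('a)) * (fourier \<eta> ((x - a) /\<^sub>R \<delta> n) * \<phi> a) \<partial>lborel)"
          by (simp add: fourier_scale[OF _ \<delta>(1)] mult.assoc)
        also have "\<dots> = complex_of_real (1 / \<delta> n ^ DIM('a)) * (\<integral>a. fourier \<eta> ((x - a) /\<^sub>R \<delta> n) * \<phi> a \<partial>lborel)"
          by (rule integral_mult_right_zero)
        also have "\<dots> = (\<integral>z. fourier \<eta> z * \<phi> (x - \<delta> n *\<^sub>R z) \<partial>lborel)"
          using lborel_integral_affine[of "\<lambda>a. fourier \<eta> ((x - a) /\<^sub>R \<delta> n) * \<phi> a" "- \<delta> n" x] \<delta>(1)[of n]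
          by (simp add: scaleR_conv_of_real)
        finally have "(\<integral>a. ?\<Theta> (\<delta> n) (x - a) * \<phi> a \<partial>lborel) = m n x" by (simp add: m_def mollify_def)
        then show "(\<integral>a. u x * ?\<Theta> (\<delta> n) (x - a) * \<phi> a \<partial>lborel) = u x * m n x"
          by (simp add: mult.assoc)
      qed
      finally show ?thesis .
    qed
    have "0 \<le> L" by (simp add: L_def d_def)
    from mollify_bound[OF rapid_fourier[OF \<eta>] this] obtain K where
      K: "\<And>n x. norm (m n x) \<le> K * B * \<langle>x\<rangle> powr - L"
      unfolding m_def using \<phi>L \<delta> less_imp_le \<open>\<phi> \<in> borel_measurable borel\<close> by metis
    have [measurable]: "m n \<in> borel_measurable borel" for n
      unfolding m_def using continuous_on_mollify[OF rapid_integrable[OF rapid_fourier[OF \<eta>]] \<phi> B\<phi>]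
      by (rule borel_measurable_continuous_onI)
    have "(\<lambda>n. \<integral>x. u x * m n x \<partial>lborel) \<longlonglongrightarrow> (\<integral>x. u x * (?c * \<phi> x) \<partial>lborel)"
    proof (rule integral_dominated_convergence[where w = "\<lambda>x. Bu * (K * B) * \<langle>x\<rangle> powr - (\<epsilon> + L)"])
      show "integrable lborel (\<lambda>x::'a. Bu * (K * B) * \<langle>x\<rangle> powr - (\<epsilon> + L))"
        by (intro integrable_mult_right integrable_japanese) (use \<epsilon> in \<open>simp add: d_def L_def\<close>)
      show "AE x in lborel. norm (u x * m n x) \<le> Bu * (K * B) * \<langle>x\<rangle> powr - (\<epsilon> + L)" for n
        by (rule AE_I2, rule integrable_weighted_mult(2)[OF _ _ u_bound K]) (use \<epsilon> in \<open>auto simp: d_def L_def\<close>)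
      show "AE x in lborel. (\<lambda>n. u x * m n x) \<longlonglongrightarrow> u x * (?c * \<phi> x)"
      proof (intro AE_I2 tendsto_mult tendsto_const)
        fix x
        have "(\<lambda>n. m n x) \<longlonglongrightarrow> mollify (fourier \<eta>) 0 \<phi> x"
          unfolding m_def
          by (rule tendsto_mollify[OF rapid_integrable[OF rapid_fourier[OF \<eta>]] \<phi> B\<phi> tendsto_const \<delta>0])
        then show "(\<lambda>n. m n x) \<longlonglongrightarrow> ?c * \<phi> x"
          by (simp add: mollify_0 integral_fourier_test_function[OF \<eta>] \<eta>_at_0)
      qed
    qed measurable
    then have lim: "(\<lambda>n. norm (\<integral>x. u x * m n x \<partial>lborel)) \<longlonglongrightarrow> norm (\<integral>x. u x * (?c * \<phi> x) \<partial>lborel)"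
      by (rule tendsto_norm)
    have iW: "integrable lborel (\<lambda>x. C * \<langle>x\<rangle> powr - t * norm (\<phi> x))"
    proof -
      have "continuous_on UNIV (\<lambda>x. complex_of_real (C * \<langle>x\<rangle> powr - t) * \<phi> x)"
        using \<phi> by (intro continuous_intros) auto
      from continuous_compact_support_integrable[OF this, of R] supp
      have "integrable lborel (\<lambda>x. norm (complex_of_real (C * \<langle>x\<rangle> powr - t) * \<phi> x))" by auto
      then show ?thesis using C(1) by (simp add: norm_mult abs_mult)
    qed
    have "norm (\<integral>x. u x * m n x \<partial>lborel) \<le> (\<integral>x. C * \<langle>x\<rangle> powr - t * norm (\<phi> x) \<partial>lborel)" for n
      unfolding swap[symmetric]
    proof (rule Bochner_Integration.integral_norm_bound_integral[OF _ iW])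
      have le: "norm ((\<integral>x. u x * ?\<Theta> (\<delta> n) (x - a) \<partial>lborel) * \<phi> a) \<le> C * \<langle>a\<rangle> powr - t * norm (\<phi> a)" for a
        unfolding norm_mult by (intro mult_right_mono C(2) \<delta>) simp
      then show "norm ((\<integral>x. u x * ?\<Theta> (\<delta> n) (x - a) \<partial>lborel) * \<phi> a) \<le> C * \<langle>a\<rangle> powr - t * norm (\<phi> a)" for a .
      show "integrable lborel (\<lambda>a. (\<integral>x. u x * ?\<Theta> (\<delta> n) (x - a) \<partial>lborel) * \<phi> a)"
        by (rule Bochner_Integration.integrable_bound[OF iW])
          (auto intro!: AE_I2 order_trans[OF le abs_ge_self])
    qed
    then have "norm (\<integral>x. u x * (?c * \<phi> x) \<partial>lborel) \<le> (\<integral>x. C * \<langle>x\<rangle> powr - t * norm (\<phi> x) \<partial>lborel)"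
      by (intro tendsto_upperbound[OF lim]) auto
    moreover have "(\<integral>x. u x * (?c * \<phi> x) \<partial>lborel) = ?c * (\<integral>x. u x * \<phi> x \<partial>lborel)"
      by (simp only: mult.left_commute[of _ ?c] integral_mult_right_zero)
    moreover have "norm ?c = (2 * pi) ^ DIM('a)" by (simp only: norm_of_real) simp
    ultimately have "(2 * pi) ^ DIM('a) * norm (\<integral>x. u x * \<phi> x \<partial>lborel) \<le> (\<integral>x. C * \<langle>x\<rangle> powr - t * norm (\<phi> x) \<partial>lborel)"
      by (simp only: norm_mult)
    moreover have "(\<integral>x. C * \<langle>x\<rangle> powr - t * norm (\<phi> x) \<partial>lborel) =
        (2 * pi) ^ DIM('a) * (\<integral>x. C' * \<langle>x\<rangle> powr - t * norm (\<phi> x) \<partial>lborel)"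
      unfolding integral_mult_right_zero[symmetric] by (simp add: C'_def)
    ultimately show "norm (\<integral>x. u x * \<phi> x \<partial>lborel) \<le> (\<integral>x. C' * \<langle>x\<rangle> powr - t * norm (\<phi> x) \<partial>lborel)"
      by simp
  qed (use ub C' in auto)
  then show ?thesis using C' by blast
qed

end

section \<open>Bootstrap\<close>

text \<open>As the degrees lie between 0 and M, the bound |\<xi>|^(m_j) \<le>
  \<langle>\<xi>\<rangle>^M puts all terms under the common weight M, while each derivative keeps
  its factor |\<xi>|^-1.\<close>

lemma homogeneous_sum_symbol:
  fixes f :: "nat \<Rightarrow> 'a::euclidean_space \<Rightarrow> complex"
  assumes J: "finite J" and smooth: "\<And>j. j \<in> J \<Longrightarrow> smooth_on (- {0}) (f j)"
    and hom: "\<And>j. j \<in> J \<Longrightarrow> pos_homogeneous (m j) (f j)" and m: "\<And>j. j \<in> J \<Longrightarrow> 0 \<le> m j \<and> m j \<le> M"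
  shows "\<exists>A\<ge>0. \<forall>b\<in>Basis. symbol b M A k 0 (\<lambda>\<xi>. \<Sum>j\<in>J. f j \<xi>)"
proof -
  have "\<exists>A\<ge>0. \<forall>b\<in>Basis. \<forall>i\<in>UNIV. symbol b M A k 0 ((\<lambda>_::unit. \<lambda>\<xi>. \<Sum>j\<in>J. f j \<xi>) i)"
  proof (rule symbol_uniform_Basis)
    fix b :: 'a assume b: "b \<in> Basis"
    have "\<exists>A\<ge>0. symbol b M A k 0 (\<lambda>\<xi>. \<Sum>j\<in>J. f j \<xi>)"
    proof (rule symbol_sum[OF J])
      fix j assume j: "j \<in> J"
      have "Ck_on k (- {0}) (f j)" using smooth[OF j] by (simp add: smooth_on_def)
      then obtain A where "symbol b 0 A k (- m j) (f j)"
        using pos_homogeneous_symbol[OF _ hom[OF j] b] by blast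
      then have A: "symbol b 0 \<bar>A\<bar> k (- m j) (f j)" by (rule symbol_mono) simp
      have "symbol b M (\<bar>A\<bar> * 1) k (- m j + m j) (f j)"
      proof (rule symbol_reweight[OF _ abs_ge_zero A])
        fix \<xi> :: 'a assume "\<xi> \<noteq> 0"
        have "norm \<xi> powr m j \<le> \<langle>\<xi>\<rangle> powr m j"
          using m[OF j] japanese_ge_norm[of \<xi>] by (intro powr_mono2) auto
        also have "\<dots> \<le> \<langle>\<xi>\<rangle> powr M"
          using m[OF j] japanese_ge_1[of \<xi>] by (intro powr_mono) auto
        finally show "\<langle>\<xi>\<rangle> powr 0 \<le> 1 * \<langle>\<xi>\<rangle> powr M * norm \<xi> powr - m j"
          using \<open>\<xi> \<noteq> 0\<close> by (simp add: powr_minus field_simps)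
      qed
      then show "\<exists>A\<ge>0. symbol b M A k 0 (f j)" by (intro exI[of _ "\<bar>A\<bar>"]) simp
    qed
    then show "\<exists>A. \<forall>i\<in>UNIV. symbol b M A k 0 ((\<lambda>_::unit. \<lambda>\<xi>. \<Sum>j\<in>J. f j \<xi>) i)" by blast
  qed
  then show ?thesis by auto
qed

section \<open>Borel representatives of Lebesgue measurable data\<close>

lemma completion_ex_borel_measurable_complex:
  fixes g :: "'a \<Rightarrow> complex"
  assumes g: "g \<in> borel_measurable (completion N)"
  shows "\<exists>g'\<in>borel_measurable N. AE x in N. g x = g' x"
proof -
  have "(\<lambda>x. Re (g x)) \<in> borel_measurable (completion N)" "(\<lambda>x. Im (g x)) \<in> borel_measurable (completion N)"
    using measurable_compose[OF g borel_measurable_Re] measurable_compose[OF g borel_measurable_Im] by auto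
  note ex = this[THEN completion_ex_borel_measurable_real]
  obtain r where r[measurable]: "r \<in> borel_measurable N" and ae_r: "AE x in N. Re (g x) = r x"
    using ex(1) by (elim bexE)
  obtain i where i[measurable]: "i \<in> borel_measurable N" and ae_i: "AE x in N. Im (g x) = i x"
    using ex(2) by (elim bexE)
  have "(\<lambda>x. Complex (r x) (i x)) \<in> borel_measurable N"
    unfolding Complex_eq by measurable
  moreover have "AE x in N. g x = Complex (r x) (i x)"
    using ae_r ae_i by eventually_elim (simp add: complex_eq_iff)
  ultimately show ?thesis by (intro bexI[of _ "\<lambda>x. Complex (r x) (i x)"])
qed

lemma dist_of_cong_AE:
  assumes "f \<in> borel_measurable lebesgue" "g \<in> borel_measurable lebesgue"
    and "AE x in lebesgue. f x = g x" and "\<phi> \<in> borel_measurable borel"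
  shows "dist_of f \<phi> = dist_of g \<phi>"
proof -
  have [measurable]: "f \<in> borel_measurable lebesgue" "g \<in> borel_measurable lebesgue" by fact+
  have [measurable]: "\<phi> \<in> borel_measurable lebesgue" using assms(4) by (auto intro: measurable_completion)
  show ?thesis
    unfolding dist_of_def by (rule integral_cong_AE) (use assms(3) in \<open>auto elim!: eventually_mono\<close>)
qed

lemma convolve_cong_AE:
  assumes "f \<in> borel_measurable lebesgue" "g \<in> borel_measurable lebesgue"
    and "AE x in lebesgue. f x = g x" and "k \<in> borel_measurable borel"
  shows "convolve k f = convolve k g"
proof
  fix x
  have [measurable]: "f \<in> borel_measurable lebesgue" "g \<in> borel_measurable lebesgue" by fact+
  have "(\<lambda>y. k (x - y)) \<in> borel_measurable borel" using assms(4) by measurable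
  then have [measurable]: "(\<lambda>y. k (x - y)) \<in> borel_measurable lebesgue"
    by (auto intro: measurable_completion)
  show "convolve k f x = convolve k g x"
    unfolding convolve_def by (rule integral_cong_AE) (use assms(3) in \<open>auto elim!: eventually_mono\<close>)
qed

lemma borel_measurable_inv_fourier:
  fixes g :: "'a::euclidean_space \<Rightarrow> complex"
  assumes [measurable]: "g \<in> borel_measurable borel"
  shows "inv_fourier g \<in> borel_measurable borel"
  unfolding inv_fourier_conv_fourier[OF assms] by measurable

lemma fourier_multiplier_cong_AE:
  assumes u: "u \<in> borel_measurable lebesgue" "w \<in> borel_measurable lebesgue" "AE x in lebesgue. u x = w x"
    and [measurable]: "\<eta> \<in> borel_measurable borel" "p \<in> borel_measurable borel" "\<phi> \<in> borel_measurable borel"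
  shows "fourier_multiplier \<eta> p u \<phi> = fourier_multiplier \<eta> p w \<phi>"
proof -
  have [measurable]: "inv_fourier \<phi> \<in> borel_measurable borel"
    by (rule borel_measurable_inv_fourier) measurable
  have "(\<lambda>\<xi>. (1 - \<eta> \<xi>) * p \<xi> * inv_fourier \<phi> \<xi>) \<in> borel_measurable borel" by measurable
  then have "fourier (\<lambda>\<xi>. (1 - \<eta> \<xi>) * p \<xi> * inv_fourier \<phi> \<xi>) \<in> borel_measurable borel"
    by (rule borel_measurable_fourier)
  note 1 = dist_of_cong_AE[OF u this]
  have "inv_fourier (\<lambda>\<xi>. \<eta> \<xi> * p \<xi>) \<in> borel_measurable borel"
    by (rule borel_measurable_inv_fourier) measurable
  note 2 = convolve_cong_AE[OF u this]
  show ?thesis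
    by (simp add: fourier_multiplier_def dist_inv_fourier_def dist_mult_def dist_fourier_def 1 2)
qed

text \<open>The representative is set to 0 where the bound fails, which happens on a null set; the
  weighted bound then holds at every point, as \<open>elliptic_equation\<close> demands.\<close>

lemma L_inf_weight_borel_version:
  assumes "L_inf (\<lambda>x. complex_of_real (\<langle>x\<rangle> powr e) * u x)"
  obtains w B where "w \<in> borel_measurable borel" "AE x in lborel. u x = w x" "0 \<le> B"
    "\<And>x. norm (w x) \<le> B * \<langle>x\<rangle> powr - e" "u \<in> borel_measurable lebesgue"
proof -
  let ?f = "\<lambda>x. complex_of_real (\<langle>x\<rangle> powr e) * u x"
  have f[measurable]: "?f \<in> borel_measurable lebesgue" using assms by (simp add: L_inf_def)
  have [measurable]: "(\<lambda>x::'a. complex_of_real (\<langle>x\<rangle> powr - e)) \<in> borel_measurable lebesgue"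
    by (intro measurable_completion) measurable
  have "(\<lambda>x. complex_of_real (\<langle>x\<rangle> powr - e) * ?f x) \<in> borel_measurable lebesgue" by measurable
  moreover have "(\<lambda>x. complex_of_real (\<langle>x\<rangle> powr - e) * ?f x) = u"
    by (auto simp: powr_minus)
  ultimately have u: "u \<in> borel_measurable lebesgue" by simp
  then obtain g where g[measurable]: "g \<in> borel_measurable lborel" and ug: "AE x in lborel. u x = g x"
    using completion_ex_borel_measurable_complex by blast
  have [measurable]: "g \<in> borel_measurable borel" using g by simp
  obtain B where "AE x in lebesgue. norm (?f x) \<le> B" using assms by (auto simp: L_inf_def)
  then have fB: "AE x in lborel. norm (?f x) \<le> B" by (simp add: AE_completion_iff)
  define w where "w x = (if norm (g x) \<le> \<bar>B\<bar> * \<langle>x\<rangle> powr - e then g x else 0)" for x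
  have "w \<in> borel_measurable borel" unfolding w_def by measurable
  moreover have "AE x in lborel. u x = w x"
    using ug fB
  proof eventually_elim
    case (elim x)
    have "norm (u x) \<le> \<bar>B\<bar> * \<langle>x\<rangle> powr - e"
      using elim(2) by (simp add: norm_mult powr_minus field_simps)
    then show ?case using elim(1) by (simp add: w_def)
  qed
  moreover have "norm (w x) \<le> \<bar>B\<bar> * \<langle>x\<rangle> powr - e" for x by (simp add: w_def)
  ultimately show ?thesis using that u by (meson abs_ge_zero)
qed

theorem theorem1p1:
  fixes h :: nat
    and m :: "nat \<Rightarrow> real"
    and M C \<sigma> \<epsilon>\<^sub>0 :: real
    and pm :: "nat \<Rightarrow> 'a::euclidean_space \<Rightarrow> complex"
    and p :: "'a \<Rightarrow> complex"
    and F :: "complex \<Rightarrow> complex"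
    and \<eta> u :: "'a \<Rightarrow> complex"
  assumes "h \<ge> 1"
    and "m 0 = 0" and "strict_mono_on {0..h} m" and "m h = M"
    and "\<And>j. j \<le> h \<Longrightarrow> smooth_on (- {0}) (pm j)"
    and "\<And>j. j \<le> h \<Longrightarrow> pos_homogeneous (m j) (pm j)"
    and "\<And>\<xi>. p \<xi> = (\<Sum>j=0..h. pm j \<xi>)"
    and "C > 0"
    and "\<And>\<xi>. \<xi> \<noteq> 0 \<Longrightarrow> norm (p \<xi>) \<ge> C * \<langle>\<xi>\<rangle> powr M"
    and "F \<in> borel_measurable borel"
    and "\<sigma> > 1"
    and "\<And>K. compact K \<Longrightarrow> \<exists>C\<^sub>K>0. \<forall>z\<in>K. norm (F z) \<le> C\<^sub>K * norm z powr \<sigma>"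
    and "\<epsilon>\<^sub>0 > 0"
    and "L_inf (\<lambda>x. complex_of_real (\<langle>x\<rangle> powr \<epsilon>\<^sub>0) * u x)"
    and "low_cutoff \<eta>"
    and "dist_eq (fourier_multiplier \<eta> p u) (dist_of (\<lambda>x. F (u x)))"
  shows "L_inf (\<lambda>x. complex_of_real (\<langle>x\<rangle> ^ DIM('a)) * u x)"
proof -
  define d where "d = real DIM('a)"
  have d: "0 < d" by (simp add: d_def)
  \<comment> \<open>This is where h \<ge> 1 enters: a top degree above m 0 = 0 makes the kernel
    integrable at the origin.\<close>
  have M: "0 < M" using strict_mono_onD[OF assms(3), of 0 h] assms(1,2,4) by simp
  have mj: "0 \<le> m j \<and> m j \<le> M" if "j \<in> {0..h}" for j
    using strict_mono_on_leD[OF assms(3), of 0 j] strict_mono_on_leD[OF assms(3), of j h] that assms(2,4) by simp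
  have p_sum: "p = (\<lambda>\<xi>. \<Sum>j\<in>{0..h}. pm j \<xi>)" by (rule ext) (rule assms(7))
  have p_symbol: "\<exists>A\<ge>0. \<forall>b\<in>Basis. symbol b M A k 0 p" for k
    unfolding p_sum by (rule homogeneous_sum_symbol[OF _ _ _ mj]) (use assms(5,6) in auto)
  obtain b :: 'a where "b \<in> Basis" using nonempty_Basis by blast
  then have [measurable]: "p \<in> borel_measurable borel" using p_symbol[of 0] symbol_measurable by blast
  have \<eta>: "test_function \<eta>" "\<forall>\<^sub>F \<xi> in nhds 0. \<eta> \<xi> = 1" using assms(15) by (auto simp: low_cutoff_def)
  have [measurable]: "\<eta> \<in> borel_measurable borel"
    using borel_measurable_continuous_onI[OF test_function_continuous[OF \<eta>(1)]] .
  note [measurable] = assms(10)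
  obtain w B where w[measurable]: "w \<in> borel_measurable borel" and uw: "AE x in lborel. u x = w x"
    and B: "0 \<le> B" "\<And>x. norm (w x) \<le> B * \<langle>x\<rangle> powr - \<epsilon>\<^sub>0" and u[measurable]: "u \<in> borel_measurable lebesgue"
    by (rule L_inf_weight_borel_version[OF assms(14)], rule that)
  have w_leb: "w \<in> borel_measurable lebesgue" using w by (auto intro: measurable_completion)
  have uw': "AE x in lebesgue. u x = w x" using uw by (simp add: AE_completion_iff)
  have wB: "norm (w x) \<le> B" for x by (rule norm_le_of_weight[OF B(2)]) (use assms(13) in simp)
  \<comment> \<open>All values of \<open>w\<close> lie in one closed ball, so a single constant
    serves every round of the iteration.\<close>
  obtain CK where CK: "0 < CK" "\<And>z. norm z \<le> B \<Longrightarrow> norm (F z) \<le> CK * norm z powr \<sigma>"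
    using assms(12)[of "cball 0 B"] by auto
  have equation: "fourier_multiplier \<eta> p w \<phi> = dist_of v \<phi>"
    if \<phi>: "test_function \<phi>" and v: "v \<in> borel_measurable borel" "AE x in lborel. F (w x) = v x" for v \<phi>
  proof -
    have [measurable]: "\<phi> \<in> borel_measurable borel"
      using borel_measurable_continuous_onI[OF test_function_continuous[OF \<phi>]] .
    have "fourier_multiplier \<eta> p w \<phi> = fourier_multiplier \<eta> p u \<phi>"
      by (rule fourier_multiplier_cong_AE[OF u w_leb uw', symmetric]) measurable
    also have "\<dots> = dist_of (\<lambda>x. F (u x)) \<phi>" using assms(16) \<phi> by (simp add: dist_eq_def)
    also have "\<dots> = dist_of v \<phi>"
    proof (rule dist_of_cong_AE)
      show "(\<lambda>x. F (u x)) \<in> borel_measurable lebesgue" by measurable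
      show "v \<in> borel_measurable lebesgue" using v by (auto intro: measurable_completion)
      have "AE x in lborel. F (u x) = v x" using uw v(2) by eventually_elim simp
      then show "AE x in lebesgue. F (u x) = v x" by (simp add: AE_completion_iff)
    qed measurable
    finally show ?thesis .
  qed
  \<comment> \<open>A growth factor strictly between 1 and \<sigma>: the exponents still grow
    geometrically, while \<open>decay\<close> requires t strictly below \<sigma> e.\<close>
  define \<rho> where "\<rho> = (1 + \<sigma>) / 2"
  have \<rho>: "1 < \<rho>" "\<rho> < \<sigma>" using assms(11) by (auto simp: \<rho>_def)
  have step: "\<exists>C\<ge>0. AE x in lborel. norm (w x) \<le> C * \<langle>x\<rangle> powr - t"
    if e: "0 < e" "0 \<le> D" "AE x in lborel. norm (w x) \<le> D * \<langle>x\<rangle> powr - e"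
      and t: "0 < t" "t \<le> d" "t < \<sigma> * e" for e D t
  proof -
    define B2 where "B2 = CK * D powr \<sigma>"
    \<comment> \<open>The almost everywhere bound on \<open>w\<close> gives one on F w; the
      truncation makes it hold at every point.\<close>
    define v where "v x = (if norm (F (w x)) \<le> B2 * \<langle>x\<rangle> powr - (\<sigma> * e) then F (w x) else 0)" for x
    have [measurable]: "v \<in> borel_measurable borel" unfolding v_def by measurable
    have Fv: "AE x in lborel. F (w x) = v x"
      using e(3)
    proof eventually_elim
      case (elim x)
      have "norm (w x) powr \<sigma> \<le> (D * \<langle>x\<rangle> powr - e) powr \<sigma>"
        using elim assms(11) by (intro powr_mono2) auto
      also have "\<dots> = D powr \<sigma> * \<langle>x\<rangle> powr - (\<sigma> * e)"
        using e(2) by (simp add: powr_mult powr_powr mult.commute)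
      finally have "CK * norm (w x) powr \<sigma> \<le> CK * (D powr \<sigma> * \<langle>x\<rangle> powr - (\<sigma> * e))"
        using CK(1) by (intro mult_left_mono) auto
      then have "norm (F (w x)) \<le> B2 * \<langle>x\<rangle> powr - (\<sigma> * e)"
        using CK(2)[OF wB[of x]] by (simp add: B2_def mult.assoc)
      then show ?case by (simp add: v_def)
    qed
    \<comment> \<open>The bound on \<open>w\<close> keeps its original rate
      \<open>\<epsilon>\<^sub>0\<close> in every round; the progress is in the rate \<sigma> e of
      \<open>v\<close>.\<close>
    interpret elliptic_equation p \<eta> w v M C B \<epsilon>\<^sub>0 B2 "\<sigma> * e"
    proof
      show "norm (v x) \<le> B2 * \<langle>x\<rangle> powr - (\<sigma> * e)" for x
        using CK(1) by (simp add: v_def B2_def)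
      show "fourier_multiplier \<eta> p w \<phi> = dist_of v \<phi>" if "test_function \<phi>" for \<phi>
        by (rule equation[OF that _ Fv]) measurable
    qed (use M assms(8,9,11,13) p_symbol \<eta> B e(1) in auto)
    show ?thesis by (rule decay) (use t in \<open>auto simp: d_def\<close>)
  qed
  have pow: "0 < \<rho> ^ n * \<epsilon>\<^sub>0" for n using \<rho>(1) assms(13) by simp
  \<comment> \<open>The exponent is capped at d, the largest rate that \<open>decay\<close>
    delivers; at the cap, d < \<sigma> d still leaves the strict gap.\<close>
  have iterate: "\<exists>C\<ge>0. AE x in lborel. norm (w x) \<le> C * \<langle>x\<rangle> powr - min d (\<rho> ^ n * \<epsilon>\<^sub>0)" for n
  proof (induction n)
    case 0
    have "norm (w x) \<le> B * \<langle>x\<rangle> powr - min d \<epsilon>\<^sub>0" for x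
    proof -
      have "\<langle>x\<rangle> powr - \<epsilon>\<^sub>0 \<le> \<langle>x\<rangle> powr - min d \<epsilon>\<^sub>0" using japanese_ge_1[of x] by (intro powr_mono) auto
      then show ?thesis using B(2)[of x] mult_left_mono[OF _ B(1)] by (meson order_trans)
    qed
    then show ?case using B(1) by auto
  next
    case (Suc n)
    let ?e = "min d (\<rho> ^ n * \<epsilon>\<^sub>0)"
    obtain D where D: "0 \<le> D" "AE x in lborel. norm (w x) \<le> D * \<langle>x\<rangle> powr - ?e" using Suc.IH by blast
    have e: "0 < ?e" using d pow by simp
    have "min d (\<rho> ^ Suc n * \<epsilon>\<^sub>0) < \<sigma> * ?e"
    proof (cases "d \<le> \<rho> ^ n * \<epsilon>\<^sub>0")
      case True
      have "1 * d < \<sigma> * d" using d assms(11) by (intro mult_strict_right_mono) auto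
      then show ?thesis using True by (simp add: min_def)
    next
      case False
      have "\<rho> * (\<rho> ^ n * \<epsilon>\<^sub>0) < \<sigma> * (\<rho> ^ n * \<epsilon>\<^sub>0)" using \<rho>(2) pow by (intro mult_strict_right_mono) auto
      then show ?thesis using False by (simp add: min_def mult.assoc)
    qed
    then show ?case using step[OF e D, of "min d (\<rho> ^ Suc n * \<epsilon>\<^sub>0)"] d pow[of "Suc n"] by simp
  qed
  obtain n where "d / \<epsilon>\<^sub>0 < \<rho> ^ n" using real_arch_pow[OF \<rho>(1)] by blast
  then have "min d (\<rho> ^ n * \<epsilon>\<^sub>0) = d" using assms(13) by (simp add: min_def divide_less_eq)
  then obtain D where "AE x in lborel. norm (w x) \<le> D * \<langle>x\<rangle> powr - d" using iterate[of n] by auto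
  then have "AE x in lborel. norm (complex_of_real (\<langle>x\<rangle> ^ DIM('a)) * u x) \<le> D"
    using uw
  proof eventually_elim
    case (elim x)
    have "\<langle>x\<rangle> ^ DIM('a) * \<langle>x\<rangle> powr - d = 1" by (simp add: d_def powr_minus powr_realpow)
    then have "\<langle>x\<rangle> ^ DIM('a) * (D * \<langle>x\<rangle> powr - d) = D" by simp
    moreover have "\<langle>x\<rangle> ^ DIM('a) * norm (w x) \<le> \<langle>x\<rangle> ^ DIM('a) * (D * \<langle>x\<rangle> powr - d)"
      using elim by (intro mult_left_mono) (auto simp: less_imp_le)
    ultimately have "\<langle>x\<rangle> ^ DIM('a) * norm (w x) \<le> D" by (simp only:)
    then show ?case using elim by (simp add: norm_mult norm_power less_imp_le)
  qed
  then have "AE x in lebesgue. norm (complex_of_real (\<langle>x\<rangle> ^ DIM('a)) * u x) \<le> D"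
    by (simp only: AE_completion_iff)
  moreover have "(\<lambda>x. complex_of_real (\<langle>x\<rangle> ^ DIM('a)) * u x) \<in> borel_measurable lebesgue"
  proof -
    have [measurable]: "(\<lambda>x::'a. complex_of_real (\<langle>x\<rangle> ^ DIM('a))) \<in> borel_measurable lebesgue"
      by (intro measurable_completion) measurable
    show ?thesis by measurable
  qed
  ultimately show ?thesis unfolding L_inf_def by blast
qed

end
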